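(* Let $f\in\mathfrak{ls}_{\mathcal Q}$ be nonzero and let $d$ be minimal such that $f^{(d)}\neq 0$. Then \[\chi_E(f)\equiv\chi_B(f)\mod \mathcal Q^{(d+4)},\] i.e. $\chi_E(f)^{(r)}=\chi_B(f)^{(r)}$ for all $r\le d+3$.
   Context: For $r\ge0$ let $\mathbb Q(x_1,\dots,x_r)$ be the field of rational functions in $r$ variables ($=\mathbb Q$ for $r=0$). For $k\in\mathbb Z$ let $\mathcal Q_k$ be the set of sequences $f=(f^{(r)})_{r\ge0}$ with $f^{(r)}\in\mathbb Q(x_1,\dots,x_r)$ homogeneous of degree $k-r$ (the zero function is allowed), and $\mathcal Q=\bigoplus_{k\in\mathbb Z}\mathcal Q_k$. Depth filtration: $\mathcal Q^{(d)}=\{f\in\mathcal Q: f^{(r)}=0 \text{ for } 0\le r\le d-1\}$; infinite sums converge in the topology of this filtration. Let $\mathcal L=\{f: f^{(0)}=0\}$, $\mathcal G=\{f: f^{(0)}=1\}$, $\mathbf 1=(1,0,0,\dots)$. An element $h^{(r)}\in\mathbb Q(x_1,\dots,x_r)$ is identified with the sequence having $h^{(r)}$ in depth $r$ and $0$ elsewhere. Word notation: for letters $\mathsf x_{n}$ ($n\ge1$), $f(\mathsf x_{n_1}\cdots\mathsf x_{n_r}):=f^{(r)}(x_{n_1},\dots,x_{n_r})$, $f(\varnothing)=f^{(0)}$, extended linearly to linear combinations of words with rational-function coefficients. The shuffle product $\sqcup\!\sqcup$ on words is defined by $\mathsf x_nw_1\sqcup\!\sqcup\mathsf x_mw_2=\mathsf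 x_n(w_1\sqcup\!\sqcup\mathsf x_mw_2)+\mathsf x_m(\mathsf x_nw_1\sqcup\!\sqcup w_2)$, $\varnothing\sqcup\!\sqcup w=w\sqcup\!\sqcup\varnothing=w$, extended bilinearly. Maps $\sharp,\flat:\mathcal Q\to\mathcal Q$: $(f^\sharp)^{(r)}(x_1,\dots,x_r)=f^{(r)}(x_1,x_1+x_2,\dots,x_1+\cdots+x_r)$, $(f^\flat)^{(r)}(x_1,\dots,x_r)=f^{(r)}(x_1,x_2-x_1,\dots,x_r-x_{r-1})$ (mutually inverse). $\mathfrak{ls}_{\mathcal Q}$ is the set of $f\in\mathcal Q$ with $f^{(0)}=0$, $f^{(1)}(-x_1)=f^{(1)}(x_1)$, and for all $r\ge2$, $1\le i<r$: $f^\sharp(\mathsf x_1\cdots\mathsf x_i\sqcup\!\sqcup\mathsf x_{i+1}\cdots\mathsf x_r)=f(\mathsf x_1\cdots\mathsf x_i\sqcup\!\sqcup\mathsf x_{i+1}\cdots\mathsf x_r)=0$. It is bigraded by weight and depth; for $f\in\mathfrak{ls}_{\mathcal Q}$ each single-depth component $f^{(r)}$ again lies in $\mathfrak{ls}_{\mathcal Q}$. Ihara bracket on $\mathcal L$: the bilinear map $\odot$ with $(f\odot g)^{(n)}=\sum_{r+s=n}f^{(r)}\odot g^{(s)}$, where (with $x_0:=0$) $(f^{(r)}\odot g^{(s)})(x_1,\dots,x_{r+s})=\sum_{i=0}^s f^{(r)}(x_{i+1}-x_i,\dots,x_{i+r}-x_i)\,g^{(s)}(x_1,\dots,x_i,x_{i+r+1},\dots,x_{r+s})+(-1)^r\sum_{i=1}^s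 f^{(r)}(x_{i+r}-x_{i+r-1},\dots,x_{i+r}-x_i)\,g^{(s)}(x_1,\dots,x_{i-1},x_{i+r},\dots,x_{r+s})$; and $\{f,g\}=f\odot g-g\odot f$. Ari bracket on $\mathcal L$: the bilinear map $\odot_{\rm ari}$ with $(f\odot_{\rm ari}g)^{(n)}=\sum_{r+s=n}f^{(r)}\odot_{\rm ari}g^{(s)}$, where $(f^{(r)}\odot_{\rm ari}g^{(s)})(x_1,\dots,x_{r+s})=\sum_{i=0}^s f^{(r)}(x_{i+1},\dots,x_{i+r})\,g^{(s)}(x_1,\dots,x_i,\sum_{j=i+1}^{i+r+1}x_j,x_{i+r+2},\dots,x_{r+s})-\sum_{i=1}^s f^{(r)}(x_{i+1},\dots,x_{i+r})\,g^{(s)}(x_1,\dots,x_{i-1},\sum_{j=i}^{i+r}x_j,x_{i+r+1},\dots,x_{r+s})$; and $\{f,g\}_{\rm ari}=f\odot_{\rm ari}g-g\odot_{\rm ari}f$. Ari-exponential: for $f\in\mathcal L$, $f^1=f$, $f^n=f\odot_{\rm ari}f^{n-1}$, $\exp_{\rm ari}(f)=\mathbf 1+\sum_{n\ge1}f^n/n!$; this is a bijection $\mathcal L\to\mathcal G$ with inverse $\log_{\rm ari}$. For $G\in\mathcal G$, $f\in\mathcal L$: $\mathrm{Ad}_{\rm ari}(G)(f)=\sum_{n\ge0}\frac1{n!}\mathrm{ad}_{\rm ari}^n(g)(f)$ where $g=\log_{\rm ari}(G)$, $\mathrm{ad}^0_{\rm ari}(g)(f)=f$, $\mathrm{ad}^n_{\rm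 ari}(g)(f)=\{\mathrm{ad}^{n-1}_{\rm ari}(g)(f),g\}_{\rm ari}$. The mould $P\in\mathcal G$: $P^{(0)}=1$, $P^{(r)}(x_1,\dots,x_r)=\frac1{x_1+\cdots+x_r}\sum_{i=0}^{r-1}P^{(i)}(x_1,\dots,x_i)\,d^{(r-i)}(x_{i+1},\dots,x_r)$, where $d^{(r)}(x_1,\dots,x_r)=\frac{B_r}{r!}\sum_{i=0}^{r-1}(-1)^i\binom{r-1}{i}\frac{x_{r-i}}{x_1\cdots x_r}$ for $r\ge1$ ($B_r$ Bernoulli numbers, $B_1=-1/2$). Ecalle's map: $\chi_E(f):=\big(\mathrm{Ad}_{\rm ari}(P)(f^\sharp)\big)^\flat$ for $f\in\mathfrak{ls}_{\mathcal Q}$. Brown's map: with $x_0=0$, let $s_r=\sum_{i=0}^{r-1}(r-i)\prod_{0\le j\le r,\,j\ne i}\frac1{x_j-x_i}\in\mathbb Q(x_1,\dots,x_r)$ and $\psi_0^{(r)}=\binom{r+1}{2}^{-1}s_r$ ($r\ge1$). For $f\in\mathfrak{ls}_{\mathcal Q}$ concentrated in depth $d$, define $\chi_B(f)$ by $\chi_B(f)^{(i)}=0$ for $i<d$, $\chi_B(f)^{(d)}=f^{(d)}$, and $\chi_B(f)^{(d+r)}=\frac1{2r}\sum_{i=1}^r\{\psi_0^{(i)},\chi_B(f)^{(d+r-i)}\}$ for $r\ge1$; extend $\chi_B$ to all of $\mathfrak{ls}_{\mathcal Q}$ by linearity and continuity.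
   Formalization: In the definition of d^{(r)}, the numerator x_{r-i} is replaced by x_{i+1}, flipping the sign of d^{(r)} for even r; with x_{r-i} as printed the claim fails, e.g. for f=x_1^2 (d=1) in depth 3 at (1,2,4), where the two sides differ by 1/3. *)

theory Defs
  imports Complex_Main "HOL-Library.Poly_Mapping" "HOL-Library.Multiset"
    "HOL-Computational_Algebra.Fraction_Field"
begin

section \<open>Rational functions over the rationals\<close>

text \<open>All fields of rational functions in \<open>x_1, \<dots>, x_r\<close> live inside the fraction field of the
  rational polynomials in the variables indexed by \<^typ>\<open>nat\<close>.\<close>

type_synonym ratpoly = "(nat \<Rightarrow>\<^sub>0 nat) \<Rightarrow>\<^sub>0 rat"
type_synonym ratfun = "ratpoly fract"

instance fract :: ("{idom, ring_char_0}") field_char_0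
proof
  show "inj (of_nat :: nat \<Rightarrow> 'a fract)"
  proof (rule injI)
    fix m n :: nat
    assume "(of_nat m :: 'a fract) = of_nat n"
    then show "m = n" by (simp add: of_nat_fract eq_fract)
  qed
qed

definition poly_vars :: "ratpoly \<Rightarrow> nat set" where
  "poly_vars p = (\<Union>m \<in> Poly_Mapping.keys p. Poly_Mapping.keys m)"

definition homogeneous_poly :: "nat \<Rightarrow> ratpoly \<Rightarrow> bool" where
  "homogeneous_poly n p \<longleftrightarrow>
     (\<forall>m \<in> Poly_Mapping.keys p. (\<Sum>j \<in> Poly_Mapping.keys m. Poly_Mapping.lookup m j) = n)"

text \<open>The elements of \<open>\<rat>(x_1, \<dots>, x_r)\<close> that are zero or homogeneous of degree \<open>e\<close>.\<close>

definition homogeneous_ratfuns :: "nat \<Rightarrow> int \<Rightarrow> ratfun set" where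
  "homogeneous_ratfuns r e = insert 0
     {Fract a b | a b m n. poly_vars a \<subseteq> {1..r} \<and> poly_vars b \<subseteq> {1..r} \<and> b \<noteq> 0 \<and>
        homogeneous_poly m a \<and> homogeneous_poly n b \<and> int m - int n = e}"

text \<open>\<open>xvar 0\<close> is the constant 0, following the convention \<open>x_0 = 0\<close>; the polynomial variable with
  index 0 is never used.\<close>

definition xvar :: "nat \<Rightarrow> ratfun" where
  "xvar n = (if n = 0 then 0 else Fract (Poly_Mapping.single (Poly_Mapping.single n 1) 1) 1)"

definition Xs :: "nat \<Rightarrow> nat \<Rightarrow> ratfun list" where
  "Xs i j = map xvar [i..<Suc j]"

definition poly_subst :: "(nat \<Rightarrow> ratfun) \<Rightarrow> ratpoly \<Rightarrow> ratfun" where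
  "poly_subst \<sigma> p = (\<Sum>m \<in> Poly_Mapping.keys p. of_rat (Poly_Mapping.lookup p m) *
     (\<Prod>j \<in> Poly_Mapping.keys m. \<sigma> j ^ Poly_Mapping.lookup m j))"

text \<open>The value does not depend on the representing fraction as long as the denominator does not
  become 0. Such a fraction always exists when \<open>q\<close> is a rational function of \<open>x_1, \<dots>, x_r\<close> and the
  elements substituted for these variables are algebraically independent, which is the case for all
  substitutions (by linearly independent linear forms) below.\<close>

definition ratfun_subst :: "(nat \<Rightarrow> ratfun) \<Rightarrow> ratfun \<Rightarrow> ratfun" where
  "ratfun_subst \<sigma> q = (THE y. \<exists>a b. q = Fract a b \<and> poly_subst \<sigma> b \<noteq> 0 \<and>
      y = poly_subst \<sigma> a / poly_subst \<sigma> b)"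

text \<open>\<open>ev q [t_1, \<dots>, t_r]\<close> is \<open>q(t_1, \<dots>, t_r)\<close>.\<close>

definition ev :: "ratfun \<Rightarrow> ratfun list \<Rightarrow> ratfun" where
  "ev q ts = ratfun_subst (\<lambda>j. if 1 \<le> j \<and> j \<le> length ts then ts ! (j - 1) else 0) q"


section \<open>Sequences of rational functions\<close>

type_synonym mould = "nat \<Rightarrow> ratfun"

definition \<Q>_weight :: "int \<Rightarrow> mould set" where
  "\<Q>_weight k = {f. \<forall>r. f r \<in> homogeneous_ratfuns r (k - int r)}"

definition \<Q> :: "mould set" where
  "\<Q> = {f. \<exists>K g. finite K \<and> (\<forall>k\<in>K. g k \<in> \<Q>_weight k) \<and> f = (\<lambda>r. \<Sum>k\<in>K. g k r)}"

definition \<Q>_depth :: "nat \<Rightarrow> mould set" where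
  "\<Q>_depth d = {f \<in> \<Q>. \<forall>r<d. f r = 0}"

definition \<L> :: "mould set" where
  "\<L> = {f \<in> \<Q>. f 0 = 0}"

definition in_depth :: "nat \<Rightarrow> ratfun \<Rightarrow> mould" where
  "in_depth r h = (\<lambda>n. if n = r then h else 0)"

definition unit_mould :: mould where
  "unit_mould = in_depth 0 1"

text \<open>Infinite sums for the topology of the depth filtration: for every \<open>d\<close>, the partial sums
  eventually agree with the limit in depths less than \<open>d\<close>.\<close>

definition depth_sums :: "(nat \<Rightarrow> mould) \<Rightarrow> mould \<Rightarrow> bool" where
  "depth_sums a s \<longleftrightarrow> (\<forall>d. \<exists>N. \<forall>n\<ge>N. \<forall>r<d. (\<Sum>i<n. a i r) = s r)"

definition depth_suminf :: "(nat \<Rightarrow> mould) \<Rightarrow> mould" where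
  "depth_suminf a = (THE s. depth_sums a s)"

definition sharp :: "mould \<Rightarrow> mould" where
  "sharp f = (\<lambda>r. ev (f r) (map (\<lambda>j. \<Sum>k=1..j. xvar k) [1..<Suc r]))"

definition flat :: "mould \<Rightarrow> mould" where
  "flat f = (\<lambda>r. ev (f r) (map (\<lambda>j. xvar j - xvar (j - 1)) [1..<Suc r]))"


section \<open>Linearized double shuffle equations\<close>

text \<open>Words are lists of letter indices. The shuffle product is a sum of words with natural
  multiplicities, i.e. a multiset; unlike the library's \<open>shuffles\<close> it keeps multiplicities.\<close>

fun shuffle_product :: "nat list \<Rightarrow> nat list \<Rightarrow> nat list multiset" where
  "shuffle_product [] w = {#w#}"
| "shuffle_product (n # w1) [] = {#n # w1#}"
| "shuffle_product (n # w1) (m # w2) =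
     image_mset ((#) n) (shuffle_product w1 (m # w2)) +
     image_mset ((#) m) (shuffle_product (n # w1) w2)"

definition word_ev :: "mould \<Rightarrow> nat list multiset \<Rightarrow> ratfun" where
  "word_ev f M = (\<Sum>w \<in># M. ev (f (length w)) (map xvar w))"

definition ls_Q :: "mould set" where
  "ls_Q = {f \<in> \<Q>. f 0 = 0 \<and> ev (f 1) [- xvar 1] = f 1 \<and>
     (\<forall>r i. 2 \<le> r \<and> 1 \<le> i \<and> i < r \<longrightarrow>
        word_ev (sharp f) (shuffle_product [1..<Suc i] [Suc i..<Suc r]) = 0 \<and>
        word_ev f (shuffle_product [1..<Suc i] [Suc i..<Suc r]) = 0)}"


section \<open>Ihara bracket\<close>

definition ihara_comp :: "nat \<Rightarrow> nat \<Rightarrow> ratfun \<Rightarrow> ratfun \<Rightarrow> ratfun" where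
  "ihara_comp r s a b =
     (\<Sum>i=0..s. ev a (map (\<lambda>j. xvar (i + j) - xvar i) [1..<Suc r]) *
                ev b (Xs 1 i @ Xs (i + r + 1) (r + s)))
     + (- 1) ^ r *
     (\<Sum>i=1..s. ev a (map (\<lambda>j. xvar (i + r) - xvar (i + r - j)) [1..<Suc r]) *
                ev b (Xs 1 (i - 1) @ Xs (i + r) (r + s)))"

definition ihara_prod :: "mould \<Rightarrow> mould \<Rightarrow> mould" where
  "ihara_prod f g = (\<lambda>n. \<Sum>r\<le>n. ihara_comp r (n - r) (f r) (g (n - r)))"

definition ihara_bracket :: "mould \<Rightarrow> mould \<Rightarrow> mould" where
  "ihara_bracket f g = (\<lambda>n. ihara_prod f g n - ihara_prod g f n)"


section \<open>Ari bracket, exponential and adjoint action\<close>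

text \<open>For \<open>i = s\<close> in the first sum, the argument \<open>x_{i+1} + \<dots> + x_{i+r+1}\<close> would be the
  \<open>(s+1)\<close>-st argument of \<open>b\<close> and is absent: \<open>b\<close> is evaluated at \<open>x_1, \<dots>, x_s\<close>. This is the reading
  for which \<open>\<sharp>\<close> transports the corresponding terms of the Ihara product to those of the ari
  product.\<close>

definition ari_comp :: "nat \<Rightarrow> nat \<Rightarrow> ratfun \<Rightarrow> ratfun \<Rightarrow> ratfun" where
  "ari_comp r s a b =
     (\<Sum>i=0..s. ev a (Xs (i + 1) (i + r)) *
                ev b (if i = s then Xs 1 s
                      else Xs 1 i @ [\<Sum>j=i+1..i+r+1. xvar j] @ Xs (i + r + 2) (r + s)))
     - (\<Sum>i=1..s. ev a (Xs (i + 1) (i + r)) *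
                ev b (Xs 1 (i - 1) @ [\<Sum>j=i..i+r. xvar j] @ Xs (i + r + 1) (r + s)))"

definition ari_prod :: "mould \<Rightarrow> mould \<Rightarrow> mould" where
  "ari_prod f g = (\<lambda>n. \<Sum>r\<le>n. ari_comp r (n - r) (f r) (g (n - r)))"

definition ari_bracket :: "mould \<Rightarrow> mould \<Rightarrow> mould" where
  "ari_bracket f g = (\<lambda>n. ari_prod f g n - ari_prod g f n)"

text \<open>The \<open>n\<close>-th summand below is \<open>f\<^sup>n\<^sup>+\<^sup>1 / (n+1)!\<close>.\<close>

definition exp_ari :: "mould \<Rightarrow> mould" where
  "exp_ari f = (\<lambda>r. unit_mould r +
     depth_suminf (\<lambda>n r. (ari_prod f ^^ n) f r / fact (Suc n)) r)"

definition log_ari :: "mould \<Rightarrow> mould" where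
  "log_ari = inv_into \<L> exp_ari"

definition Ad_ari :: "mould \<Rightarrow> mould \<Rightarrow> mould" where
  "Ad_ari G f =
     depth_suminf (\<lambda>n r. ((\<lambda>h. ari_bracket h (log_ari G)) ^^ n) f r / fact n)"


section \<open>Ecalle's map\<close>

fun bernoulli_number :: "nat \<Rightarrow> rat" where
  "bernoulli_number 0 = 1"
| "bernoulli_number (Suc n) =
     - (\<Sum>k\<le>n. of_nat ((n + 2) choose k) * bernoulli_number k) / of_nat (n + 2)"

text \<open>The numerator is \<open>\<Sum>\<^sub>i (-1)\<^sup>i (r-1 choose i) x_{i+1}\<close>, as for Ecalle's mould dupal. Writing
  \<open>x_{r-i}\<close> in place of \<open>x_{i+1}\<close> would change the sign of the components of even depth (and only
  these, as the Bernoulli numbers of odd index at least 3 vanish). With that sign, Ecalle's and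
  Brown's maps already differ on \<open>x_1\<^sup>2\<close> in depth 3.\<close>

definition dupal :: mould where
  "dupal r = of_rat (bernoulli_number r / fact r) *
     (\<Sum>i<r. (- 1) ^ i * of_nat ((r - 1) choose i) * (xvar (i + 1) / (\<Prod>j=1..r. xvar j)))"

fun pal :: mould where
  "pal 0 = 1"
| "pal (Suc n) = 1 / (\<Sum>j=1..Suc n. xvar j) *
     (\<Sum>i\<le>n. pal i * ev (dupal (Suc n - i)) (Xs (i + 1) (Suc n)))"

definition chi_E :: "mould \<Rightarrow> mould" where
  "chi_E f = flat (Ad_ari pal (sharp f))"


section \<open>Brown's map\<close>

definition s_brown :: "nat \<Rightarrow> ratfun" where
  "s_brown r = (\<Sum>i<r. of_nat (r - i) * (\<Prod>j \<in> {0..r} - {i}. 1 / (xvar j - xvar i)))"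

definition psi_0 :: "nat \<Rightarrow> ratfun" where
  "psi_0 r = s_brown r / of_nat (Suc r choose 2)"

text \<open>\<open>chi_B_comp d h r\<close> is the component in depth \<open>d + r\<close> of Brown's map applied to \<open>h\<close> in
  depth \<open>d\<close>.\<close>

fun chi_B_comp :: "nat \<Rightarrow> ratfun \<Rightarrow> nat \<Rightarrow> ratfun" where
  "chi_B_comp d h 0 = h"
| "chi_B_comp d h (Suc r) = 1 / (2 * of_nat (Suc r)) *
     (\<Sum>i=1..Suc r. ihara_bracket (in_depth i (psi_0 i))
        (in_depth (d + (Suc r - i)) (chi_B_comp d h (Suc r - i))) (d + Suc r))"

definition chi_B_single :: "nat \<Rightarrow> ratfun \<Rightarrow> mould" where
  "chi_B_single d h = (\<lambda>n. if n < d then 0 else chi_B_comp d h (n - d))"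

text \<open>Extension by linearity and continuity along \<open>f = \<Sum>\<^sub>d f\<^sup>(\<^sup>d\<^sup>)\<close>.\<close>

definition chi_B :: "mould \<Rightarrow> mould" where
  "chi_B f = depth_suminf (\<lambda>d. chi_B_single d (f d))"

end

theory Submission
  imports Defs
begin

text \<open>Written in the points \<open>y\<^sub>0 = 0\<close>, \<open>y\<^sub>i = x\<^sub>i\<close>, with a mould evaluated at differences of points, both
  brackets become one and the same bracket of functions on words: \<open>f \<odot> g\<close> sums, over all blocks of
  consecutive letters, the value of \<open>f\<close> at the block times \<open>g\<close> at the word with the block contracted to
  its first letter, minus the same with the last letter. For the Ihara bracket this uses the
  invariance of \<open>f\<^sup>\<sharp>\<close> under signed reversal, which the shuffle relations imply by the antipode identity
  and which the bracket preserves. The contraction operators are derivations of the deconcatenation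
  convolution, and their commutators can be computed on words of one letter; this gives the pre-Lie
  identity and hence the Jacobi identity.

  If \<open>p = log_ari P\<close>, then \<open>\<chi>\<^sub>E\<close> is the exponential of \<open>f \<mapsto> {f, p}\<close>. Explicit computation in depth at
  most 3 gives \<open>p\<^sub>1 = - \<psi>\<^sub>1 / 2\<close>, \<open>p\<^sub>2 = - \<psi>\<^sub>2 / 4\<close> and \<open>p\<^sub>3 = - \<psi>\<^sub>3 / 6 + {\<psi>\<^sub>1, \<psi>\<^sub>2} / 48\<close>, and with the Jacobi
  identity the first four components of the exponential agree with those of Brown's recursion.\<close>

section \<open>Contracting blocks of words\<close>

text \<open>The coefficients of \<open>p\<close> have a source. With a formal parameter t marking
  the added depth, Brown's recursion is the differential equation t C'(t) = 1/2 sum_i t^i {psi_i,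
  C(t)}. Its solution operator at t = 1 has a Magnus logarithm, which through depth 3 is the adjoint
  action of psi_1/2, psi_2/4 and psi_3/6 - {psi_1, psi_2}/48. This is -p, the sign being that of {f,
  p} = -{p, f}. The proof verifies these values directly instead of solving the equation. Depth 3 of
  \<open>p\<close> suffices because \<open>f\<close> starts in depth d and each bracket with
  \<open>p\<close> adds at least one. Two obstacles shape the rest. \<open>ev\<close> is given by a
  definite description and acts as a field homomorphism at algebraically independent arguments;
  hence words with a repeated letter get the value 0, and much of the work is to establish
  independence. Moreover, the congruence asserts that the difference lies in \<open>\<Q>\<close>, so
  a finite set of weights has to be followed through both maps.\<close>

definition splits3 :: "'a list \<Rightarrow> ('a list \<times> 'a list \<times> 'a list) set" where
  "splits3 w = {(a, b, c). a @ b @ c = w \<and> b \<noteq> []}"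

definition splits2 :: "'a list \<Rightarrow> ('a list \<times> 'a list) set" where
  "splits2 w = {(u, v). u @ v = w}"

definition contract_diff ::
  "('a list \<Rightarrow> 'b::comm_ring_1) \<Rightarrow> ('a list \<Rightarrow> 'b) \<Rightarrow> 'a list \<Rightarrow> 'b" where
  "contract_diff F K w =
     (\<Sum>(a, b, c)\<in>splits3 w. F b * (K (a @ hd b # c) - K (a @ last b # c)))"

text \<open>In terms of the points \<open>y\<^sub>0, y\<^sub>1, \<dots>\<close> whose consecutive differences are the arguments of a mould,
  a flexion of the ari product replaces a block of points by its first or by its last point. The point
  \<open>y\<^sub>0\<close> is never removed, whence the case distinction.\<close>

definition contract ::
  "('a list \<Rightarrow> 'b::comm_ring_1) \<Rightarrow> ('a list \<Rightarrow> 'b) \<Rightarrow> 'a list \<Rightarrow> 'b" where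
  "contract F K w = (\<Sum>(a, b, c)\<in>splits3 w.
     F b * (K (a @ hd b # c) - (if a = [] then 0 else K (a @ last b # c))))"

text \<open>Convolution for the deconcatenation coproduct when \<open>K u v\<close> is a product; a
  general \<open>K\<close> lets an operator act on one factor with the other as a parameter.\<close>

definition deconcat :: "('a list \<Rightarrow> 'a list \<Rightarrow> 'b::comm_ring_1) \<Rightarrow> 'a list \<Rightarrow> 'b" where
  "deconcat K w = (\<Sum>(u, v)\<in>splits2 w. K u v)"

text \<open>What the case distinction in \<open>contract\<close> adds: for a block at the start of
  the word, the contraction to its last letter is not subtracted. The words \<open>u\<close> and
  \<open>last u # v\<close> share one letter.\<close>

definition overlap ::
  "('a list \<Rightarrow> 'b::comm_ring_1) \<Rightarrow> ('a list \<Rightarrow> 'b) \<Rightarrow> 'a list \<Rightarrow> 'b" where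
  "overlap F G w = (\<Sum>(u, v)\<in>{(u, v). u @ v = w \<and> u \<noteq> []}. F u * G (last u # v))"

definition word_bracket ::
  "('a list \<Rightarrow> 'b::comm_ring_1) \<Rightarrow> ('a list \<Rightarrow> 'b) \<Rightarrow> 'a list \<Rightarrow> 'b" where
  "word_bracket F G w = contract F G w - contract G F w"

lemma splits2_eq: "splits2 w = (\<lambda>i. (take i w, drop i w)) ` {..length w}"
proof -
  have "(u, v) \<in> (\<lambda>i. (take i w, drop i w)) ` {..length w}" if "u @ v = w" for u v
    by (rule image_eqI[of _ _ "length u"]) (use that in auto)
  then show ?thesis
    unfolding splits2_def by auto
qed

lemma finite_splits2 [simp]: "finite (splits2 w)"
  by (simp add: splits2_eq)

lemma finite_splits3 [simp]: "finite (splits3 w)"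
proof -
  have "splits3 w \<subseteq> (\<lambda>(i, j). (take i w, take j (drop i w), drop j (drop i w))) `
      ({..length w} \<times> {..length w})"
  proof
    fix s assume "s \<in> splits3 w"
    then obtain a b c where "s = (a, b, c)" "w = a @ b @ c"
      by (auto simp: splits3_def)
    then show "s \<in> (\<lambda>(i, j). (take i w, take j (drop i w), drop j (drop i w))) `
        ({..length w} \<times> {..length w})"
      by (intro image_eqI[of _ _ "(length a, length b)"]) auto
  qed
  then show ?thesis
    by (rule finite_subset) auto
qed

lemma splits2_Nil [simp]: "splits2 [] = {([], [])}"
  by (auto simp: splits2_def)

lemma splits2_Cons: "splits2 (x # w) = insert ([], x # w) ((\<lambda>(u, v). (x # u, v)) ` splits2 w)"
  by (auto simp: splits2_def append_eq_Cons_conv image_iff)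

lemma splits3_Nil [simp]: "splits3 [] = {}"
  by (auto simp: splits3_def)

lemma splits3_Cons: "splits3 (x # w) =
    (\<lambda>(u, v). ([], x # u, v)) ` splits2 w \<union> (\<lambda>(a, b, c). (x # a, b, c)) ` splits3 w"
  by (auto simp: splits3_def splits2_def append_eq_Cons_conv image_iff)

lemma deconcat_Nil [simp]: "deconcat K [] = K [] []"
  by (simp add: deconcat_def)

lemma deconcat_Cons: "deconcat K (x # w) = K [] (x # w) + deconcat (\<lambda>u. K (x # u)) w"
  unfolding deconcat_def splits2_Cons
  by (subst sum.insert, simp, force, subst sum.reindex) (auto simp: inj_on_def case_prod_beta)

lemma contract_diff_Nil [simp]: "contract_diff F K [] = 0"
  by (simp add: contract_diff_def)

lemma contract_Nil [simp]: "contract F K [] = 0"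
  by (simp add: contract_def)

lemma sum_splits3_Cons:
  "sum f (splits3 (x # w)) =
     (\<Sum>(u, v)\<in>splits2 w. f ([], x # u, v)) + (\<Sum>(a, b, c)\<in>splits3 w. f (x # a, b, c))"
proof -
  have "sum f (splits3 (x # w)) = sum f ((\<lambda>(u, v). ([], x # u, v)) ` splits2 w) +
      sum f ((\<lambda>(a, b, c). (x # a, b, c)) ` splits3 w)"
    unfolding splits3_Cons by (rule sum.union_disjoint) auto
  moreover have "sum f ((\<lambda>(u, v). ([], x # u, v)) ` splits2 w) =
      (\<Sum>(u, v)\<in>splits2 w. f ([], x # u, v))"
    by (subst sum.reindex) (auto simp: inj_on_def case_prod_beta)
  moreover have "sum f ((\<lambda>(a, b, c). (x # a, b, c)) ` splits3 w) =
      (\<Sum>(a, b, c)\<in>splits3 w. f (x # a, b, c))"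
    by (subst sum.reindex) (auto simp: inj_on_def case_prod_beta)
  ultimately show ?thesis by simp
qed

text \<open>A block starting at \<open>x\<close> keeps only the term contracted to \<open>x\<close>,
  which makes the sum a deconcatenation. The other blocks have a nonempty left context, so the case
  distinction disappears for them.\<close>

lemma contract_Cons:
  "contract F K (x # w) =
     deconcat (\<lambda>u v. F (x # u) * K (x # v)) w + contract_diff F (\<lambda>v. K (x # v)) w"
  by (simp add: contract_def contract_diff_def deconcat_def sum_splits3_Cons case_prod_beta)

lemma contract_eq_diff_overlap: "contract F K w = contract_diff F K w + overlap F K w"
proof -
  have "contract F K w = contract_diff F K w +
      (\<Sum>(a, b, c)\<in>splits3 w. if a = [] then F b * K (last b # c) else 0)"
    unfolding contract_def contract_diff_def sum.distrib[symmetric]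
    by (intro sum.cong) (auto simp: algebra_simps)
  also have "(\<Sum>(a, b, c)\<in>splits3 w. if a = [] then F b * K (last b # c) else 0) =
      (\<Sum>(a, b, c)\<in>{s \<in> splits3 w. fst s = []}. F b * K (last b # c))"
    by (subst sum.inter_filter) (auto intro!: sum.cong)
  also have "\<dots> = overlap F K w"
    unfolding overlap_def
    by (rule sum.reindex_bij_witness[of _ "\<lambda>(u, v). ([], u, v)" "\<lambda>(a, b, c). (b, c)"])
       (auto simp: splits3_def)
  finally show ?thesis .
qed

section \<open>Contractions as derivations of deconcatenation\<close>

lemma deconcat_add: "deconcat (\<lambda>u v. K u v + K' u v) w = deconcat K w + deconcat K' w"
  by (simp add: deconcat_def case_prod_beta sum.distrib)

lemma deconcat_diff: "deconcat (\<lambda>u v. K u v - K' u v) w = deconcat K w - deconcat K' w"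
  by (simp add: deconcat_def case_prod_beta sum_subtractf)

text \<open>\<open>p\<close> will be the letter left over from a contracted block: a cut leaves it
  either in the first factor or in the second.\<close>

lemma deconcat_append1:
  "deconcat K (a @ p # c) = deconcat (\<lambda>u v. K (a @ p # u) v) c + deconcat (\<lambda>u v. K u (v @ p # c)) a"
proof -
  have "deconcat K (a @ p # c) = sum (\<lambda>(u, v). K u v)
     ((\<lambda>(u, v). (a @ p # u, v)) ` splits2 c \<union> (\<lambda>(u, v). (u, v @ p # c)) ` splits2 a)"
    unfolding deconcat_def splits2_def
    by (rule arg_cong[of _ _ "sum _"])
       (auto simp: append_eq_append_conv2 Cons_eq_append_conv append_eq_Cons_conv image_iff)
  also have "\<dots> = sum (\<lambda>(u, v). K u v) ((\<lambda>(u, v). (a @ p # u, v)) ` splits2 c) +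
      sum (\<lambda>(u, v). K u v) ((\<lambda>(u, v). (u, v @ p # c)) ` splits2 a)"
    by (rule sum.union_disjoint) (simp, simp, auto simp: splits2_def)
  also have "\<dots> = deconcat (\<lambda>u v. K (a @ p # u) v) c + deconcat (\<lambda>u v. K u (v @ p # c)) a"
    unfolding deconcat_def
    by (intro arg_cong2[of _ _ _ _ "(+)"]; subst sum.reindex)
       (auto simp: inj_on_def case_prod_beta splits2_def)
  finally show ?thesis .
qed

text \<open>Leibniz rule. Contracting a block leaves one letter, so a later cut falls beside it;
  cutting first and contracting in the factor that contains the block gives the same terms.\<close>

lemma contract_diff_deconcat:
  "contract_diff F (deconcat K) w =
     deconcat (\<lambda>u v. contract_diff F (\<lambda>u. K u v) u + contract_diff F (K u) v) w"
proof -
  let ?A = "\<lambda>(a, b, c) (u, v). F b * (K (a @ hd b # u) v - K (a @ last b # u) v)"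
  let ?B = "\<lambda>(a, b, c) (u, v). F b * (K u (v @ hd b # c) - K u (v @ last b # c))"
  have "contract_diff F (deconcat K) w =
      (\<Sum>s\<in>splits3 w. \<Sum>t\<in>splits2 (snd (snd s)). ?A s t) +
      (\<Sum>s\<in>splits3 w. \<Sum>t\<in>splits2 (fst s). ?B s t)"
    unfolding contract_diff_def sum.distrib[symmetric]
    by (intro sum.cong refl, simp only: deconcat_append1 case_prod_beta)
       (simp add: deconcat_def case_prod_beta sum_distrib_left[symmetric]
         sum_subtractf algebra_simps)
  also have "(\<Sum>s\<in>splits3 w. \<Sum>t\<in>splits2 (snd (snd s)). ?A s t) =
     (\<Sum>(s, t)\<in>(SIGMA s:splits3 w. splits2 (snd (snd s))). ?A s t)"
    by (subst sum.Sigma) auto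
  also have "\<dots> = (\<Sum>((u, v), (a, b, c))\<in>(SIGMA t:splits2 w. splits3 (fst t)).
      F b * (K (a @ hd b # c) v - K (a @ last b # c) v))"
    by (rule sum.reindex_bij_witness[of _ "\<lambda>((u, v), (a, b, c)). ((a, b, c @ v), (c, v))"
        "\<lambda>((a, b, c), (u, v)). ((a @ b @ u, v), (a, b, u))"])
       (auto simp: splits3_def splits2_def)
  also have "\<dots> = deconcat (\<lambda>u v. contract_diff F (\<lambda>u. K u v) u) w"
    unfolding deconcat_def contract_diff_def
    by (subst sum.Sigma[symmetric]) (auto intro!: sum.cong simp: case_prod_beta)
  also have "(\<Sum>s\<in>splits3 w. \<Sum>t\<in>splits2 (fst s). ?B s t) =
     (\<Sum>(s, t)\<in>(SIGMA s:splits3 w. splits2 (fst s)). ?B s t)"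
    by (subst sum.Sigma) auto
  also have "\<dots> = (\<Sum>((u, v), (a, b, c))\<in>(SIGMA t:splits2 w. splits3 (snd t)).
      F b * (K u (a @ hd b # c) - K u (a @ last b # c)))"
    by (rule sum.reindex_bij_witness[of _ "\<lambda>((u, v), (a, b, c)). ((u @ a, b, c), (u, a))"
        "\<lambda>((a, b, c), (u, v)). ((u, v @ b @ c), (v, b, c))"])
       (auto simp: splits3_def splits2_def)
  also have "\<dots> = deconcat (\<lambda>u v. contract_diff F (K u) v) w"
    unfolding deconcat_def contract_diff_def
    by (subst sum.Sigma[symmetric]) (auto intro!: sum.cong simp: case_prod_beta)
  finally show ?thesis
    by (simp add: deconcat_add)
qed

lemma contract_diff_add:
  "contract_diff F (\<lambda>u. K u + K' u) w = contract_diff F K w + contract_diff F K' w"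
  by (simp add: contract_diff_def case_prod_beta sum.distrib[symmetric] algebra_simps)

text \<open>The two operators act on different variables. In the second-order Leibniz rule this
  makes the mixed terms symmetric in \<open>F\<close> and \<open>G\<close>.\<close>

lemma contract_diff_commute:
  "contract_diff F (\<lambda>u. contract_diff G (K u) v) w =
   contract_diff G (\<lambda>v. contract_diff F (\<lambda>u. K u v) w) v"
proof -
  have "contract_diff F (\<lambda>u. contract_diff G (K u) v) w =
    (\<Sum>s\<in>splits3 w. \<Sum>t\<in>splits3 v. case (s, t) of ((a, b, c), (a', b', c')) \<Rightarrow>
      F b * (G b' * (K (a @ hd b # c) (a' @ hd b' # c') - K (a @ hd b # c) (a' @ last b' # c') -
        K (a @ last b # c) (a' @ hd b' # c') + K (a @ last b # c) (a' @ last b' # c'))))"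
    by (simp add: contract_diff_def case_prod_beta sum_distrib_left sum_subtractf[symmetric]
        algebra_simps sum.distrib[symmetric])
  also have "\<dots> = (\<Sum>t\<in>splits3 v. \<Sum>s\<in>splits3 w. case (s, t) of ((a, b, c), (a', b', c')) \<Rightarrow>
      F b * (G b' * (K (a @ hd b # c) (a' @ hd b' # c') - K (a @ hd b # c) (a' @ last b' # c') -
        K (a @ last b # c) (a' @ hd b' # c') + K (a @ last b # c) (a' @ last b' # c'))))"
    by (rule sum.swap)
  also have "\<dots> = contract_diff G (\<lambda>v. contract_diff F (\<lambda>u. K u v) w) v"
    by (simp add: contract_diff_def case_prod_beta sum_distrib_left sum_subtractf[symmetric]
        algebra_simps sum.distrib[symmetric])
  finally show ?thesis .
qed

text \<open>The bracket here is formed with \<open>contract\<close>, although the operators are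
  \<open>contract_diff\<close>: their commutator on functions of one letter produces overlap terms
  as well.\<close>

definition commutator_defect ::
  "('a list \<Rightarrow> 'b::comm_ring_1) \<Rightarrow> ('a list \<Rightarrow> 'b) \<Rightarrow> ('a list \<Rightarrow> 'b) \<Rightarrow> 'a list \<Rightarrow> 'b" where
  "commutator_defect F G K w =
     contract_diff F (contract_diff G K) w - contract_diff G (contract_diff F K) w -
     contract_diff (word_bracket F G) K w"

lemma contract_diff2_deconcat:
  "contract_diff F (contract_diff G (deconcat K)) w =
     deconcat (\<lambda>u v. contract_diff F (contract_diff G (\<lambda>u. K u v)) u +
       contract_diff F (contract_diff G (K u)) v +
       (contract_diff F (\<lambda>u. contract_diff G (K u) v) u +
        contract_diff G (\<lambda>u. contract_diff F (K u) v) u)) w"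
proof -
  have *: "contract_diff G (deconcat K) =
      deconcat (\<lambda>u v. contract_diff G (\<lambda>u. K u v) u + contract_diff G (K u) v)"
    by (rule ext) (rule contract_diff_deconcat)
  show ?thesis
    unfolding * contract_diff_deconcat contract_diff_add
    by (simp add: contract_diff_commute[of F G "\<lambda>v u. K u v"] add_ac)
qed

text \<open>The mixed terms of the two second-order Leibniz rules are equal and cancel, and the
  bracket acts by a derivation too.\<close>

lemma commutator_defect_deconcat:
  "commutator_defect F G (deconcat K) w =
     deconcat (\<lambda>u v. commutator_defect F G (\<lambda>u. K u v) u + commutator_defect F G (K u) v) w"
  unfolding commutator_defect_def contract_diff2_deconcat contract_diff_deconcat
    deconcat_diff[symmetric]
  by (rule arg_cong2[of _ _ _ _ deconcat]) (auto simp: fun_eq_iff algebra_simps)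

text \<open>Only the contraction of the whole word leaves a single letter.\<close>

lemma contract_diff_letter:
  assumes "\<And>u. length u \<noteq> 1 \<Longrightarrow> K u = 0"
  shows "contract_diff F K w = (if w = [] then 0 else F w * (K [hd w] - K [last w]))"
proof (cases "w = []")
  case False
  have "contract_diff F K w = (\<Sum>(a, b, c)\<in>{([], w, [])}. F b * (K (a @ hd b # c) - K (a @ last b # c)))"
    unfolding contract_diff_def
  proof (rule sum.mono_neutral_right)
    show "\<forall>s\<in>splits3 w - {([], w, [])}.
        (case s of (a, b, c) \<Rightarrow> F b * (K (a @ hd b # c) - K (a @ last b # c))) = 0"
    proof
      fix s assume "s \<in> splits3 w - {([], w, [])}"
      moreover obtain a b c where s: "s = (a, b, c)"
        by (cases s)
      ultimately have "\<not> (a = [] \<and> c = [])"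
        by (auto simp: splits3_def)
      then have "a \<noteq> [] \<or> c \<noteq> []" by auto
      then have "length (a @ p # c) \<noteq> 1" for p by (auto simp: neq_Nil_conv)
      from assms[OF this] s show
          "(case s of (a, b, c) \<Rightarrow> F b * (K (a @ hd b # c) - K (a @ last b # c))) = 0"
        by simp
    qed
  next
    show "{([], w, [])} \<subseteq> splits3 w" using False by (simp add: splits3_def)
  qed simp
  then show ?thesis using False by simp
qed auto

text \<open>Both sums run over the factorizations of \<open>w\<close> as p x q with a marked letter
  x, and add F at x q times G at p x times k at x. The left one takes the suffix x q as block, the
  right one the prefix p x.\<close>

lemma overlap_rev_weight:
  "(\<Sum>(a, b, c)\<in>splits3 w. if c = [] then F b * G (a @ [hd b]) * k (hd b) else 0) =
   (\<Sum>(a, b, c)\<in>splits3 w. if a = [] then G b * F (last b # c) * k (last b) else 0)"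
  for F G :: "'a list \<Rightarrow> 'b::comm_ring_1"
proof -
  have "(\<Sum>(a, b, c)\<in>splits3 w. if c = [] then F b * G (a @ [hd b]) * k (hd b) else 0) =
      (\<Sum>(a, b, c)\<in>{s \<in> splits3 w. snd (snd s) = []}. F b * G (a @ [hd b]) * k (hd b))"
    by (subst sum.inter_filter) (auto intro!: sum.cong)
  also have "\<dots> = (\<Sum>(a, b, c)\<in>{s \<in> splits3 w. fst s = []}. G b * F (last b # c) * k (last b))"
    by (rule sum.reindex_bij_witness[of _
          "\<lambda>(a, b, c). (butlast b, last b # c, [])" "\<lambda>(a, b, c). ([], a @ [hd b], tl b)"])
       (auto simp: splits3_def)
  also have "\<dots> =
      (\<Sum>(a, b, c)\<in>splits3 w. if a = [] then G b * F (last b # c) * k (last b) else 0)"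
    by (subst sum.inter_filter) (auto intro!: sum.cong)
  finally show ?thesis .
qed

lemma overlap_eq_splits3:
  "overlap F G w = (\<Sum>(a, b, c)\<in>splits3 w. if a = [] then F b * G (last b # c) else 0)"
proof -
  have "overlap F G w = (\<Sum>(a, b, c)\<in>{s \<in> splits3 w. fst s = []}. F b * G (last b # c))"
    unfolding overlap_def
    by (rule sum.reindex_bij_witness[of _ "\<lambda>(a, b, c). (b, c)" "\<lambda>(u, v). ([], u, v)"])
       (auto simp: splits3_def)
  also have "\<dots> = (\<Sum>(a, b, c)\<in>splits3 w. if a = [] then F b * G (last b # c) else 0)"
    by (subst sum.inter_filter) (auto intro!: sum.cong)
  finally show ?thesis .
qed

lemma overlap_eq_splits3':
  "overlap F G w = (\<Sum>(a, b, c)\<in>splits3 w. if c = [] then G b * F (a @ [hd b]) else 0)"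
  using overlap_rev_weight[of G F "\<lambda>_. 1" w] by (simp add: overlap_eq_splits3 cong: if_cong)

text \<open>The inner contraction has to take the whole remaining word, so only its end letters
  matter. They change only if the outer block touches an end: \<open>?Q\<close> corrects for
  suffixes, \<open>?R\<close> for prefixes. The remaining \<open>X G F + X F G\<close> is symmetric
  and drops out of the commutator.\<close>

lemma contract_diff_letter2:
  assumes "\<And>u. length u \<noteq> 1 \<Longrightarrow> K u = 0" and "w \<noteq> []"
  defines "k \<equiv> \<lambda>x. K [x]"
  defines "X \<equiv> \<lambda>F G. \<Sum>(a, b, c)\<in>splits3 w. if a = [] then F b * G (last b # c) * k (last b) else 0"
  shows "contract_diff F (contract_diff G K) w =
    contract_diff F G w * (k (hd w) - k (last w)) + overlap G F w * k (last w) +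
    overlap F G w * k (hd w) - X G F - X F G"
proof -
  let ?P = "\<Sum>(a, b, c)\<in>splits3 w. F b * (G (a @ hd b # c) - G (a @ last b # c)) * (k (hd w) - k (last w))"
  let ?Q = "\<Sum>(a, b, c)\<in>splits3 w. if c = [] then F b * G (a @ [hd b]) * (k (last w) - k (hd b)) else 0"
  let ?R = "\<Sum>(a, b, c)\<in>splits3 w. if a = [] then F b * G (last b # c) * (k (hd w) - k (last b)) else 0"
  have "contract_diff G K v = (if v = [] then 0 else G v * (k (hd v) - k (last v)))" for v
    unfolding k_def by (rule contract_diff_letter) (rule assms(1))
  then have eq: "contract_diff F (contract_diff G K) w = ?P + ?Q + ?R"
    unfolding contract_diff_def[of F] sum.distrib[symmetric]
    by (intro sum.cong refl)
       (auto simp: splits3_def algebra_simps hd_append last_append split: if_splits)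
  have P: "?P = contract_diff F G w * (k (hd w) - k (last w))"
    by (simp add: contract_diff_def sum_distrib_right case_prod_beta)
  have Q: "?Q = overlap G F w * k (last w) - X G F"
    unfolding X_def overlap_rev_weight[symmetric] overlap_eq_splits3' sum_distrib_right
      sum_subtractf[symmetric]
    by (intro sum.cong refl) (auto simp: algebra_simps)
  have R: "?R = overlap F G w * k (hd w) - X F G"
    unfolding X_def overlap_eq_splits3 sum_distrib_right sum_subtractf[symmetric]
    by (intro sum.cong refl) (auto simp: algebra_simps)
  show ?thesis unfolding eq P Q R by (simp add: algebra_simps)
qed

lemma commutator_defect_letter:
  assumes "\<And>u. length u \<noteq> 1 \<Longrightarrow> K u = 0"
  shows "commutator_defect F G K w = 0"
proof (cases "w = []")
  case False
  then show ?thesis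
    unfolding commutator_defect_def
    by (simp add: contract_diff_letter2[OF assms] contract_diff_letter[OF assms]
        word_bracket_def contract_eq_diff_overlap algebra_simps)
qed (simp add: commutator_defect_def)

lemma contract_diff_cong:
  assumes "\<And>u. u \<noteq> [] \<Longrightarrow> length u \<le> length w \<Longrightarrow> K u = K' u"
  shows "contract_diff F K w = contract_diff F K' w"
  unfolding contract_diff_def
  by (intro sum.cong refl) (auto simp: splits3_def Suc_le_eq intro!: arg_cong[of _ _ "(*) _"]
      arg_cong2[of _ _ _ _ "(-)"] assms)

text \<open>The defect is a second-order expression in two derivations of the deconcatenation convolution
  but itself a derivation, so it is enough to see that it kills functions of one letter.\<close>

lemma commutator_defect_zero: "commutator_defect F G K w = 0"
proof (induction w arbitrary: K rule: length_induct)
  case (1 w)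
  \<comment> \<open>The first letter is split off. On nonempty words the deconcatenation of
    \<open>?K\<close> is \<open>K\<close> itself; at the empty word it is 0, but a contraction never
    evaluates there.\<close>
  let ?K = "\<lambda>u v. if length u = 1 then K (u @ v) else 0"
  have eq: "deconcat ?K u = K u" if u: "u \<noteq> []" for u
  proof -
    obtain x u' where [simp]: "u = x # u'" using u by (cases u) auto
    show ?thesis
      by (cases u') (auto simp: deconcat_Cons deconcat_def[of "\<lambda>_ _. 0"])
  qed
  have eq': "contract_diff F' K = contract_diff F' (deconcat ?K)" for F'
    by (rule ext, rule contract_diff_cong) (rule eq[symmetric])
  have "commutator_defect F G K w = commutator_defect F G (deconcat ?K) w"
    unfolding commutator_defect_def eq'[symmetric] ..
  \<comment> \<open>As a function of \<open>u\<close>, \<open>?K\<close> is supported on one letter,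
    so \<open>commutator_defect_letter\<close> removes the half acting on the left factor.\<close>
  also have "\<dots> = deconcat (\<lambda>u v. commutator_defect F G (?K u) v) w"
    unfolding commutator_defect_deconcat
    by (subst commutator_defect_letter) auto
  also have "\<dots> = 0"
    unfolding deconcat_def
  proof (intro sum.neutral ballI)
    fix s assume "s \<in> splits2 w"
    then obtain u v where s: "s = (u, v)" "w = u @ v"
      by (auto simp: splits2_def)
    \<comment> \<open>A nonempty \<open>u\<close> makes \<open>v\<close> shorter than
      \<open>w\<close>; for the empty \<open>u\<close> the function \<open>?K u\<close> is
      zero.\<close>
    have "commutator_defect F G (?K u) v = 0"
    proof (cases "u = []")
      case True
      then show ?thesis by (simp add: commutator_defect_def contract_diff_def)
    next
      case False
      with 1 s show ?thesis by auto
    qed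
    with s show "(case s of (u, v) \<Rightarrow> commutator_defect F G (?K u) v) = 0"
      by simp
  qed
  finally show ?case .
qed

lemma contract_diff_commutator:
  "contract_diff F (contract_diff G K) w - contract_diff G (contract_diff F K) w =
     contract_diff (word_bracket F G) K w"
  using commutator_defect_zero[of F G K w] by (simp add: commutator_defect_def)

section \<open>Transfer from \<open>contract_diff\<close> to \<open>contract\<close>\<close>

lemma deconcat_assoc:
  "deconcat (\<lambda>u v. F u * deconcat (\<lambda>u v. G u * K v) v) w =
   deconcat (\<lambda>u v. deconcat (\<lambda>u v. F u * G v) u * K v) (w :: 'a list)"
  for F G K :: "'a list \<Rightarrow> 'b::comm_ring_1"
proof -
  have "deconcat (\<lambda>u v. F u * deconcat (\<lambda>u v. G u * K v) v) w =
      (\<Sum>((a, v), (b, c))\<in>(SIGMA t:splits2 w. splits2 (snd t)). F a * (G b * K c))"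
    unfolding deconcat_def
    by (subst sum.Sigma[symmetric]) (auto intro!: sum.cong simp: case_prod_beta sum_distrib_left)
  also have "\<dots> = (\<Sum>((u, c), (a, b))\<in>(SIGMA t:splits2 w. splits2 (fst t)). F a * G b * K c)"
    by (rule sum.reindex_bij_witness[of _ "\<lambda>((u, c), (a, b)). ((a, b @ c), (b, c))"
        "\<lambda>((a, v), (b, c)). ((a @ b, c), (a, b))"])
       (auto simp: splits2_def mult_ac)
  also have "\<dots> = deconcat (\<lambda>u v. deconcat (\<lambda>u v. F u * G v) u * K v) w"
    unfolding deconcat_def
    by (subst sum.Sigma[symmetric]) (auto intro!: sum.cong simp: case_prod_beta sum_distrib_right)
  finally show ?thesis .
qed

lemma contract_diff_mult_const:
  "contract_diff F (\<lambda>u. c * K u) w = c * contract_diff F K w"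
  "contract_diff F (\<lambda>u. K u * c) w = contract_diff F K w * c"
  by (auto simp: contract_diff_def case_prod_beta sum_distrib_left sum_distrib_right algebra_simps
      intro!: sum.cong)

text \<open>The second and third summands are exchanged by swapping \<open>F\<close> and
  \<open>G\<close>, so a commutator retains only the first and the last.\<close>

lemma contract_contract_Cons:
  fixes F G K :: "'a list \<Rightarrow> 'b::comm_ring_1" and x :: 'a
  defines "f \<equiv> \<lambda>v. F (x # v)" and "g \<equiv> \<lambda>v. G (x # v)" and "k \<equiv> \<lambda>v. K (x # v)"
  shows "contract F (contract G K) (x # w) =
     deconcat (\<lambda>u v. contract F G (x # u) * k v) w +
     deconcat (\<lambda>u v. f u * contract_diff G k v) w +
     deconcat (\<lambda>u v. g u * contract_diff F k v) w +
     contract_diff F (contract_diff G k) w"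
proof -
  have G: "(\<lambda>v. contract G K (x # v)) =
      (\<lambda>v. deconcat (\<lambda>u v. g u * k v) v + contract_diff G k v)"
    by (simp add: contract_Cons g_def k_def)
  have "contract F (contract G K) (x # w) =
     deconcat (\<lambda>u v. f u * deconcat (\<lambda>u v. g u * k v) v) w +
     deconcat (\<lambda>u v. f u * contract_diff G k v) w +
     (deconcat (\<lambda>u v. contract_diff F g u * k v) w + deconcat (\<lambda>u v. g u * contract_diff F k v) w) +
     contract_diff F (contract_diff G k) w"
    unfolding contract_Cons[of F] G contract_diff_add contract_diff_deconcat f_def[symmetric]
    by (simp add: contract_Cons[of G] f_def[symmetric] g_def[symmetric] k_def[symmetric]
        distrib_left deconcat_add contract_diff_mult_const)
       (simp add: f_def g_def k_def)
  then show ?thesis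
    unfolding deconcat_assoc contract_Cons[of F G] f_def[symmetric] g_def[symmetric]
    by (simp add: distrib_right deconcat_add algebra_simps) (simp add: f_def g_def)
qed

text \<open>Left symmetry of the product. With the first letter split off, the first summand of
  \<open>contract_contract_Cons\<close> yields the bracket on prefixes, and the last one is handled
  by \<open>contract_diff_commutator\<close>.\<close>

theorem contract_commutator:
  "contract F (contract G K) w - contract G (contract F K) w = contract (word_bracket F G) K w"
proof (cases w)
  case (Cons x v)
  show ?thesis
    unfolding Cons contract_contract_Cons
    by (simp add: contract_Cons[of "word_bracket F G"] word_bracket_def[of F G "x # _"]
        contract_diff_commutator[symmetric] left_diff_distrib deconcat_diff algebra_simps)
qed auto

section \<open>Substitution into polynomials and rational functions\<close>

definition monom_subst :: "(nat \<Rightarrow> 'b::comm_ring_1) \<Rightarrow> (nat \<Rightarrow>\<^sub>0 nat) \<Rightarrow> 'b" where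
  "monom_subst \<sigma> m = (\<Prod>j \<in> Poly_Mapping.keys m. \<sigma> j ^ Poly_Mapping.lookup m j)"

lemma monom_subst_superset:
  assumes "finite S" "Poly_Mapping.keys m \<subseteq> S"
  shows "monom_subst \<sigma> m = (\<Prod>j \<in> S. \<sigma> j ^ Poly_Mapping.lookup m j)"
  unfolding monom_subst_def
  by (rule prod.mono_neutral_left) (use assms in \<open>auto simp: in_keys_iff\<close>)

lemma monom_subst_add: "monom_subst \<sigma> (m + n) = monom_subst \<sigma> m * monom_subst \<sigma> n"
proof -
  let ?S = "Poly_Mapping.keys m \<union> Poly_Mapping.keys n"
  show ?thesis
    using Poly_Mapping.keys_add[of m n]
    by (simp add: monom_subst_superset[of ?S] lookup_add power_add prod.distrib)
qed

lemma monom_subst_0 [simp]: "monom_subst \<sigma> 0 = 1"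
  by (simp add: monom_subst_def)

lemma poly_subst_monom:
  "poly_subst \<sigma> p = (\<Sum>m\<in>Poly_Mapping.keys p. of_rat (Poly_Mapping.lookup p m) * monom_subst \<sigma> m)"
  by (simp add: poly_subst_def monom_subst_def)

lemma poly_subst_superset:
  assumes "finite S" "Poly_Mapping.keys p \<subseteq> S"
  shows "poly_subst \<sigma> p = (\<Sum>m\<in>S. of_rat (Poly_Mapping.lookup p m) * monom_subst \<sigma> m)"
  unfolding poly_subst_monom
  by (rule sum.mono_neutral_left) (use assms in \<open>auto simp: in_keys_iff\<close>)

lemma poly_subst_0 [simp]: "poly_subst \<sigma> 0 = 0"
  by (simp add: poly_subst_def)

lemma poly_subst_single: "poly_subst \<sigma> (Poly_Mapping.single m c) = of_rat c * monom_subst \<sigma> m"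
  by (simp add: poly_subst_monom)

lemma poly_subst_1 [simp]: "poly_subst \<sigma> 1 = 1"
  by (simp add: poly_subst_monom)

lemma poly_subst_add: "poly_subst \<sigma> (p + q) = poly_subst \<sigma> p + poly_subst \<sigma> q"
proof -
  let ?S = "Poly_Mapping.keys p \<union> Poly_Mapping.keys q"
  show ?thesis
    using Poly_Mapping.keys_add[of p q]
    by (simp add: poly_subst_superset[of ?S] lookup_add of_rat_add distrib_right sum.distrib)
qed

lemma poly_subst_sum: "poly_subst \<sigma> (sum f A) = (\<Sum>x\<in>A. poly_subst \<sigma> (f x))"
  by (induction A rule: infinite_finite_induct) (auto simp: poly_subst_add)

lemma poly_expand:
  "(p :: 'a \<Rightarrow>\<^sub>0 'b::comm_monoid_add) =
     (\<Sum>m\<in>Poly_Mapping.keys p. Poly_Mapping.single m (Poly_Mapping.lookup p m))"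
  by (rule poly_mapping_eqI) (auto simp: lookup_sum lookup_single when_def in_keys_iff)

lemma poly_subst_mult: "poly_subst \<sigma> (p * q) = poly_subst \<sigma> p * poly_subst \<sigma> q"
proof -
  have "p * q = (\<Sum>m\<in>Poly_Mapping.keys p. \<Sum>n\<in>Poly_Mapping.keys q.
      Poly_Mapping.single (m + n) (Poly_Mapping.lookup p m * Poly_Mapping.lookup q n))"
    by (subst poly_expand[of p], subst poly_expand[of q]) (simp add: sum_product mult_single)
  then show ?thesis
    by (simp add: poly_subst_sum poly_subst_single monom_subst_add of_rat_mult)
       (simp add: poly_subst_monom sum_product mult_ac)
qed

lemma poly_subst_uminus: "poly_subst \<sigma> (- p) = - poly_subst \<sigma> p"
  using poly_subst_add[of \<sigma> p "- p"] by (simp add: add_eq_0_iff)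

lemma poly_subst_cong:
  assumes "\<And>j. j \<in> poly_vars p \<Longrightarrow> \<sigma> j = \<tau> j"
  shows "poly_subst \<sigma> p = poly_subst \<tau> p"
proof -
  have "\<sigma> j = \<tau> j" if "m \<in> Poly_Mapping.keys p" "j \<in> Poly_Mapping.keys m" for m j
    using assms that by (auto simp: poly_vars_def)
  then show ?thesis
    unfolding poly_subst_def by (intro sum.cong prod.cong arg_cong2[of _ _ _ _ "(*)"] refl) auto
qed

lemma poly_vars_0 [simp]: "poly_vars 0 = {}" and poly_vars_1 [simp]: "poly_vars 1 = {}"
  by (auto simp: poly_vars_def)

lemma poly_vars_uminus [simp]: "poly_vars (- p) = poly_vars p"
  by (auto simp: poly_vars_def in_keys_iff)

lemma poly_vars_add: "poly_vars (p + q) \<subseteq> poly_vars p \<union> poly_vars q"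
  using Poly_Mapping.keys_add[of p q] by (fastforce simp: poly_vars_def)

lemma poly_vars_mult: "poly_vars (p * q) \<subseteq> poly_vars p \<union> poly_vars q"
proof
  fix j assume "j \<in> poly_vars (p * q)"
  then obtain m where m: "m \<in> Poly_Mapping.keys (p * q)" "j \<in> Poly_Mapping.keys m"
    by (auto simp: poly_vars_def)
  obtain a b where "m = a + b" "a \<in> Poly_Mapping.keys p" "b \<in> Poly_Mapping.keys q"
    using keys_mult[of p q] m(1) by auto
  then show "j \<in> poly_vars p \<union> poly_vars q"
    using Poly_Mapping.keys_add[of a b] m(2) by (auto simp: poly_vars_def)
qed

lemma of_rat_eq_Fract: "of_rat c = Fract (Poly_Mapping.single (0 :: nat \<Rightarrow>\<^sub>0 nat) c) 1"
proof -
  have int: "of_int c = Fract (Poly_Mapping.single (0 :: nat \<Rightarrow>\<^sub>0 nat) (of_int c :: rat)) 1" for c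
    by (cases c rule: int_cases2) (auto simp: of_nat_fract single_uminus)
  obtain a b where c: "quotient_of c = (a, b)" by force
  then have b: "b > 0" and c': "c = of_int a / of_int b"
    by (auto simp: quotient_of_denom_pos quotient_of_div)
  have "of_int b * Fract (Poly_Mapping.single (0 :: nat \<Rightarrow>\<^sub>0 nat) c) 1 = (of_int a :: ratfun)"
    using b unfolding int mult_fract mult_single c' by simp
  moreover have "(of_int b :: ratfun) \<noteq> 0" using b by simp
  ultimately show ?thesis using b
    by (simp add: c' of_rat_divide divide_simps mult.commute)
qed

text \<open>Polynomials embed in the fraction field by sending variables to themselves. The bound on
  the variables excludes index 0, which \<open>xvar\<close> sends to 0.\<close>

lemma poly_subst_xvar:
  assumes "poly_vars p \<subseteq> {1..r}"
  shows "poly_subst xvar p = Fract p 1"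
proof -
  have Fract_prod: "(\<Prod>j\<in>A. Fract (f j) 1) = Fract (\<Prod>j\<in>A. f j) 1" for f :: "nat \<Rightarrow> ratpoly" and A
    by (induction A rule: infinite_finite_induct) (auto simp: One_fract_def)
  have Fract_sum: "(\<Sum>j\<in>A. Fract (f j) 1) = Fract (\<Sum>j\<in>A. f j) 1"
    for f :: "_ \<Rightarrow> ratpoly" and A :: "(nat \<Rightarrow>\<^sub>0 nat) set"
    by (induction A rule: infinite_finite_induct) (auto simp: Zero_fract_def)
  have Fract_power: "Fract a 1 ^ n = Fract (a ^ n) 1" for a :: ratpoly and n
    by (induction n) (auto simp: One_fract_def)
  have pow: "Poly_Mapping.single (Poly_Mapping.single j (1::nat)) (1::rat) ^ n =
      Poly_Mapping.single (Poly_Mapping.single j n) 1" for j n :: nat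
    by (induction n) (auto simp: mult_single single_add[symmetric])
  have prod: "(\<Prod>j\<in>A. Poly_Mapping.single (f j) (1::rat)) = Poly_Mapping.single (\<Sum>j\<in>A. f j) 1"
    for f :: "nat \<Rightarrow> nat \<Rightarrow>\<^sub>0 nat" and A
    by (induction A rule: infinite_finite_induct) (auto simp: mult_single)
  have monom: "monom_subst xvar m = Fract (Poly_Mapping.single m 1) 1"
    if "Poly_Mapping.keys m \<subseteq> {1..r}" for m
  proof -
    have "monom_subst xvar m = (\<Prod>j\<in>Poly_Mapping.keys m.
        Fract (Poly_Mapping.single (Poly_Mapping.single j (Poly_Mapping.lookup m j)) 1) 1)"
      unfolding monom_subst_def
      by (intro prod.cong refl) (use that in \<open>auto simp: xvar_def Fract_power pow simp flip: One_nat_def\<close>)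
    then show ?thesis
      by (simp add: Fract_prod prod poly_expand[symmetric])
  qed
  have "poly_subst xvar p = (\<Sum>m\<in>Poly_Mapping.keys p. Fract (Poly_Mapping.single m (Poly_Mapping.lookup p m)) 1)"
    unfolding poly_subst_monom
  proof (intro sum.cong refl)
    fix m assume "m \<in> Poly_Mapping.keys p"
    then have "Poly_Mapping.keys m \<subseteq> {1..r}"
      using assms by (auto simp: poly_vars_def)
    then show "of_rat (Poly_Mapping.lookup p m) * monom_subst xvar m =
        Fract (Poly_Mapping.single m (Poly_Mapping.lookup p m)) 1"
      by (simp add: monom of_rat_eq_Fract mult_single)
  qed
  then show ?thesis
    by (simp add: Fract_sum poly_expand[symmetric])
qed

section \<open>Rational functions in the first variables\<close>

text \<open>The field of rational functions without the grading. It is closed under the field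
  operations, and on it \<open>ev\<close> will be additive and multiplicative.\<close>

definition ratfuns :: "nat \<Rightarrow> ratfun set" where
  "ratfuns r = {Fract a b | a b. poly_vars a \<subseteq> {1..r} \<and> poly_vars b \<subseteq> {1..r} \<and> b \<noteq> 0}"

lemma ratfunsI:
  "poly_vars a \<subseteq> {1..r} \<Longrightarrow> poly_vars b \<subseteq> {1..r} \<Longrightarrow> b \<noteq> 0 \<Longrightarrow> Fract a b \<in> ratfuns r"
  unfolding ratfuns_def by blast

lemma ratfuns_0 [simp, intro]: "0 \<in> ratfuns r"
  unfolding Zero_fract_def by (intro ratfunsI) auto

lemma ratfuns_1 [simp, intro]: "1 \<in> ratfuns r"
  unfolding One_fract_def by (intro ratfunsI) auto

lemma ratfuns_add [intro]:
  assumes "p \<in> ratfuns r" "q \<in> ratfuns r"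
  shows "p + q \<in> ratfuns r"
proof -
  obtain a b c d where "p = Fract a b" "q = Fract c d" "b \<noteq> 0" "d \<noteq> 0"
      "poly_vars a \<subseteq> {1..r}" "poly_vars b \<subseteq> {1..r}" "poly_vars c \<subseteq> {1..r}" "poly_vars d \<subseteq> {1..r}"
    using assms unfolding ratfuns_def by auto
  moreover from this have "Fract (a * d + c * b) (b * d) \<in> ratfuns r"
    using poly_vars_add[of "a * d" "c * b"] poly_vars_mult[of a d] poly_vars_mult[of c b]
      poly_vars_mult[of b d]
    by (intro ratfunsI) (blast, blast, simp)
  ultimately show ?thesis by simp
qed

lemma ratfuns_mult [intro]:
  assumes "p \<in> ratfuns r" "q \<in> ratfuns r"
  shows "p * q \<in> ratfuns r"
proof -
  obtain a b c d where "p = Fract a b" "q = Fract c d" "b \<noteq> 0" "d \<noteq> 0"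
      "poly_vars a \<subseteq> {1..r}" "poly_vars b \<subseteq> {1..r}" "poly_vars c \<subseteq> {1..r}" "poly_vars d \<subseteq> {1..r}"
    using assms unfolding ratfuns_def by auto
  moreover from this have "Fract (a * c) (b * d) \<in> ratfuns r"
    using poly_vars_mult[of a c] poly_vars_mult[of b d]
    by (intro ratfunsI) (blast, blast, simp)
  ultimately show ?thesis by simp
qed

lemma ratfuns_uminus [intro]: "p \<in> ratfuns r \<Longrightarrow> - p \<in> ratfuns r"
  unfolding ratfuns_def by force

lemma ratfuns_diff [intro]: "p \<in> ratfuns r \<Longrightarrow> q \<in> ratfuns r \<Longrightarrow> p - q \<in> ratfuns r"
  using ratfuns_add[of p r "- q"] by auto

lemma ratfuns_inverse [intro]:
  assumes "p \<in> ratfuns r"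
  shows "inverse p \<in> ratfuns r"
proof (cases "p = 0")
  case False
  obtain a b where "p = Fract a b" "b \<noteq> 0" "poly_vars a \<subseteq> {1..r}" "poly_vars b \<subseteq> {1..r}"
    using assms unfolding ratfuns_def by auto
  moreover from this False have "a \<noteq> 0" by (auto simp: fract_collapse)
  ultimately show ?thesis
    using ratfunsI[of b r a] by simp
qed auto

lemma ratfuns_divide [intro]: "p \<in> ratfuns r \<Longrightarrow> q \<in> ratfuns r \<Longrightarrow> p / q \<in> ratfuns r"
  unfolding divide_inverse by auto

lemma ratfuns_sum [intro]: "(\<And>x. x \<in> A \<Longrightarrow> f x \<in> ratfuns r) \<Longrightarrow> sum f A \<in> ratfuns r"
  by (induction A rule: infinite_finite_induct) auto

lemma ratfuns_prod [intro]: "(\<And>x. x \<in> A \<Longrightarrow> f x \<in> ratfuns r) \<Longrightarrow> prod f A \<in> ratfuns r"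
  by (induction A rule: infinite_finite_induct) auto

lemma ratfuns_of_nat [simp, intro]: "of_nat n \<in> ratfuns r"
  by (induction n) auto

lemma ratfuns_of_int [simp, intro]: "of_int n \<in> ratfuns r"
  by (cases n rule: int_cases2) auto

lemma ratfuns_of_rat [simp, intro]: "of_rat c \<in> ratfuns r"
  by (cases c) (auto simp: of_rat_rat)

lemma ratfuns_numeral [simp, intro]: "numeral n \<in> ratfuns r"
  using ratfuns_of_nat[of "numeral n"] by simp

lemma ratfuns_power [intro]: "p \<in> ratfuns r \<Longrightarrow> p ^ n \<in> ratfuns r"
  by (induction n) auto

lemma poly_vars_single: "poly_vars (Poly_Mapping.single (Poly_Mapping.single j 1) 1) = {j}"
  by (simp add: poly_vars_def)

lemma ratfuns_xvar [simp, intro]: "j \<le> r \<Longrightarrow> xvar j \<in> ratfuns r"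
proof (cases "j = 0")
  case False
  moreover assume "j \<le> r"
  ultimately show ?thesis
    unfolding xvar_def using poly_vars_single[of j]
    by (auto intro!: ratfunsI)
qed (simp add: xvar_def)

section \<open>Evaluation at algebraically independent elements\<close>

text \<open>The substitution hidden in \<open>ev\<close>: variables count from 1 and list positions
  from 0.\<close>

definition list_subst :: "ratfun list \<Rightarrow> nat \<Rightarrow> ratfun" where
  "list_subst ts j = (if 1 \<le> j \<and> j \<le> length ts then ts ! (j - 1) else 0)"

text \<open>Algebraic independence, which makes \<^const>\<open>ev\<close> a field homomorphism.\<close>

definition indep :: "ratfun list \<Rightarrow> bool" where
  "indep ts \<longleftrightarrow>
     (\<forall>b. b \<noteq> 0 \<and> poly_vars b \<subseteq> {1..length ts} \<longrightarrow> poly_subst (list_subst ts) b \<noteq> 0)"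

text \<open>Uniqueness for the definite description: equal fractions have equal cross products, and
  substitution is multiplicative, so both quotients agree.\<close>

lemma ratfun_subst_Fract:
  assumes "poly_subst \<sigma> b \<noteq> 0"
  shows "ratfun_subst \<sigma> (Fract a b) = poly_subst \<sigma> a / poly_subst \<sigma> b"
  unfolding ratfun_subst_def
proof (rule the_equality)
  show "\<exists>a' b'. Fract a b = Fract a' b' \<and> poly_subst \<sigma> b' \<noteq> 0 \<and>
      poly_subst \<sigma> a / poly_subst \<sigma> b = poly_subst \<sigma> a' / poly_subst \<sigma> b'"
    using assms by blast
next
  fix y assume "\<exists>a' b'. Fract a b = Fract a' b' \<and> poly_subst \<sigma> b' \<noteq> 0 \<and>
      y = poly_subst \<sigma> a' / poly_subst \<sigma> b'"
  then obtain a' b' where *: "Fract a b = Fract a' b'" "poly_subst \<sigma> b' \<noteq> 0"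
      "y = poly_subst \<sigma> a' / poly_subst \<sigma> b'"
    by blast
  have "b \<noteq> 0" "b' \<noteq> 0" using assms * by auto
  then have "a * b' = a' * b" using * by (simp add: eq_fract)
  then have "poly_subst \<sigma> a * poly_subst \<sigma> b' = poly_subst \<sigma> a' * poly_subst \<sigma> b"
    by (metis poly_subst_mult)
  then show "y = poly_subst \<sigma> a / poly_subst \<sigma> b"
    using assms * by (simp add: frac_eq_eq)
qed

lemma ev_Fract:
  assumes "indep ts" "poly_vars b \<subseteq> {1..length ts}" "b \<noteq> 0"
  shows "ev (Fract a b) ts = poly_subst (list_subst ts) a / poly_subst (list_subst ts) b"
  using assms ratfun_subst_Fract[of "list_subst ts" b a]
  by (simp add: ev_def list_subst_def[abs_def] indep_def)

lemma ev_0 [simp]: "ev 0 ts = 0"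
  using ratfun_subst_Fract[of "list_subst ts" 1 0]
  by (simp add: ev_def list_subst_def[abs_def] flip: Zero_fract_def)

lemma ev_1 [simp]: "ev 1 ts = 1"
  using ratfun_subst_Fract[of "list_subst ts" 1 1]
  by (simp add: ev_def list_subst_def[abs_def] flip: One_fract_def)

context
  fixes ts r
  assumes ts: "indep ts" "length ts = r"
begin

lemma ev_add:
  assumes "p \<in> ratfuns r" "q \<in> ratfuns r"
  shows "ev (p + q) ts = ev p ts + ev q ts"
proof -
  obtain a b c d where *: "p = Fract a b" "q = Fract c d" "b \<noteq> 0" "d \<noteq> 0"
      "poly_vars a \<subseteq> {1..r}" "poly_vars b \<subseteq> {1..r}" "poly_vars c \<subseteq> {1..r}" "poly_vars d \<subseteq> {1..r}"
    using assms unfolding ratfuns_def by auto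
  moreover have "poly_vars (b * d) \<subseteq> {1..r}" using poly_vars_mult[of b d] * by auto
  moreover have "poly_subst (list_subst ts) b \<noteq> 0" "poly_subst (list_subst ts) d \<noteq> 0"
    using * ts by (auto simp: indep_def)
  ultimately show ?thesis
    using ts by (simp add: ev_Fract poly_subst_add poly_subst_mult divide_simps)
qed

lemma ev_mult:
  assumes "p \<in> ratfuns r" "q \<in> ratfuns r"
  shows "ev (p * q) ts = ev p ts * ev q ts"
proof -
  obtain a b c d where *: "p = Fract a b" "q = Fract c d" "b \<noteq> 0" "d \<noteq> 0"
      "poly_vars a \<subseteq> {1..r}" "poly_vars b \<subseteq> {1..r}" "poly_vars c \<subseteq> {1..r}" "poly_vars d \<subseteq> {1..r}"
    using assms unfolding ratfuns_def by auto
  moreover have "poly_vars (b * d) \<subseteq> {1..r}" using poly_vars_mult[of b d] * by auto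
  ultimately show ?thesis
    using ts by (simp add: ev_Fract poly_subst_mult)
qed

lemma ev_eq_0_iff:
  assumes "p \<in> ratfuns r"
  shows "ev p ts = 0 \<longleftrightarrow> p = 0"
proof -
  obtain a b where *: "p = Fract a b" "b \<noteq> 0" "poly_vars a \<subseteq> {1..r}" "poly_vars b \<subseteq> {1..r}"
    using assms unfolding ratfuns_def by auto
  moreover have "poly_subst (list_subst ts) b \<noteq> 0"
    using * ts by (auto simp: indep_def)
  moreover have "poly_subst (list_subst ts) a = 0 \<longleftrightarrow> a = 0"
    using * ts by (auto simp: indep_def)
  moreover have "Fract a b = 0 \<longleftrightarrow> a = 0"
    using * by (simp add: Zero_fract_def eq_fract)
  ultimately show ?thesis
    using ts by (simp add: ev_Fract)
qed

lemma ev_uminus: "p \<in> ratfuns r \<Longrightarrow> ev (- p) ts = - ev p ts"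
  using ev_add[of p "- p"] by (auto simp: add_eq_0_iff)

lemma ev_diff: "p \<in> ratfuns r \<Longrightarrow> q \<in> ratfuns r \<Longrightarrow> ev (p - q) ts = ev p ts - ev q ts"
  using ev_add[of p "- q"] by (simp add: ev_uminus ratfuns_uminus)

lemma ev_inverse:
  assumes "p \<in> ratfuns r"
  shows "ev (inverse p) ts = inverse (ev p ts)"
proof (cases "p = 0")
  case False
  then have "ev p ts * ev (inverse p) ts = 1"
    using assms by (subst ev_mult[symmetric]) auto
  then show ?thesis by (metis inverse_unique)
qed auto

lemma ev_divide: "p \<in> ratfuns r \<Longrightarrow> q \<in> ratfuns r \<Longrightarrow> ev (p / q) ts = ev p ts / ev q ts"
  by (simp add: divide_inverse ev_mult ev_inverse ratfuns_inverse)

lemma ev_sum: "(\<And>x. x \<in> A \<Longrightarrow> f x \<in> ratfuns r) \<Longrightarrow> ev (sum f A) ts = (\<Sum>x\<in>A. ev (f x) ts)"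
  by (induction A rule: infinite_finite_induct) (auto simp: ev_add ratfuns_sum)

lemma ev_prod: "(\<And>x. x \<in> A \<Longrightarrow> f x \<in> ratfuns r) \<Longrightarrow> ev (prod f A) ts = (\<Prod>x\<in>A. ev (f x) ts)"
  by (induction A rule: infinite_finite_induct) (auto simp: ev_mult ratfuns_prod)

lemma ev_power: "p \<in> ratfuns r \<Longrightarrow> ev (p ^ n) ts = ev p ts ^ n"
  by (induction n) (auto simp: ev_mult ratfuns_power)

lemma ev_of_nat [simp]: "ev (of_nat n) ts = of_nat n"
  by (induction n) (auto simp: ev_add)

lemma ev_of_int [simp]: "ev (of_int n) ts = of_int n"
  by (cases n rule: int_cases2) (auto simp: ev_uminus)

lemma ev_of_rat [simp]: "ev (of_rat c) ts = of_rat c"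
  by (cases c) (auto simp: of_rat_rat ev_divide)

lemma ev_numeral [simp]: "ev (numeral n) ts = numeral n"
  using ev_of_nat[of "numeral n"] by simp

lemma ev_xvar:
  assumes "1 \<le> j" "j \<le> r"
  shows "ev (xvar j) ts = ts ! (j - 1)"
  using assms ts
  by (simp add: xvar_def ev_Fract poly_subst_single monom_subst_def list_subst_def)

lemma ev_poly_subst:
  assumes "\<And>j. \<sigma> j \<in> ratfuns r"
  shows "ev (poly_subst \<sigma> p) ts = poly_subst (\<lambda>j. ev (\<sigma> j) ts) p"
  unfolding poly_subst_def using assms
  by (simp add: ev_sum ev_mult ev_prod ev_power ratfuns_mult ratfuns_prod ratfuns_power)

end

lemma xvar_0 [simp]: "xvar 0 = 0"
  by (simp add: xvar_def)

lemma poly_subst_ratfuns: "(\<And>j. \<sigma> j \<in> ratfuns r) \<Longrightarrow> poly_subst \<sigma> p \<in> ratfuns r"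
  unfolding poly_subst_def by (intro ratfuns_sum ratfuns_mult ratfuns_prod ratfuns_power) auto

lemma list_subst_ratfuns: "set ts \<subseteq> ratfuns n \<Longrightarrow> list_subst ts j \<in> ratfuns n"
  unfolding list_subst_def using nth_mem[of "j - 1" ts] by (auto simp: Suc_le_eq)

lemma ev_list_subst:
  "(\<lambda>j. ev (list_subst ts j) us) = list_subst (map (\<lambda>t. ev t us) ts)"
  by (auto simp: list_subst_def fun_eq_iff)

text \<open>A polynomial relation among the \<open>ts\<close> would persist after evaluation at
  \<open>us\<close>.\<close>

lemma indep_of_map_ev:
  assumes "indep (map (\<lambda>t. ev t us) ts)" "indep us" "set ts \<subseteq> ratfuns (length us)"
  shows "indep ts"
  unfolding indep_def
proof (intro allI impI, elim conjE)
  fix b assume b: "b \<noteq> 0" "poly_vars b \<subseteq> {1..length ts}"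
  have "ev (poly_subst (list_subst ts) b) us = poly_subst (list_subst (map (\<lambda>t. ev t us) ts)) b"
    using assms by (subst ev_poly_subst) (auto simp: list_subst_ratfuns ev_list_subst)
  also have "\<dots> \<noteq> 0" using assms(1) b by (auto simp: indep_def)
  finally show "poly_subst (list_subst ts) b \<noteq> 0" by auto
qed

text \<open>Evaluation at independent elements is injective on rational functions, so it cannot
  create a relation.\<close>

lemma indep_map_ev:
  assumes "indep ts" "indep us" "set ts \<subseteq> ratfuns (length us)"
  shows "indep (map (\<lambda>t. ev t us) ts)"
  unfolding indep_def
proof (intro allI impI, elim conjE)
  fix b assume b: "b \<noteq> 0" "poly_vars b \<subseteq> {1..length (map (\<lambda>t. ev t us) ts)}"
  then have "poly_subst (list_subst ts) b \<noteq> 0"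
    using assms(1) by (auto simp: indep_def)
  then have "ev (poly_subst (list_subst ts) b) us \<noteq> 0"
    using assms by (subst ev_eq_0_iff) (auto intro!: poly_subst_ratfuns list_subst_ratfuns)
  then show "poly_subst (list_subst (map (\<lambda>t. ev t us) ts)) b \<noteq> 0"
    using assms by (subst (asm) ev_poly_subst) (auto simp: list_subst_ratfuns ev_list_subst)
qed

lemma ev_ratfuns:
  assumes "q \<in> ratfuns (length ts)" "indep ts" "set ts \<subseteq> ratfuns n"
  shows "ev q ts \<in> ratfuns n"
proof -
  obtain a b where "q = Fract a b" "b \<noteq> 0" "poly_vars a \<subseteq> {1..length ts}" "poly_vars b \<subseteq> {1..length ts}"
    using assms unfolding ratfuns_def by auto
  then show ?thesis
    using assms by (auto simp: ev_Fract intro!: poly_subst_ratfuns list_subst_ratfuns)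
qed

text \<open>By independence the denominator survives both substitutions, so they can be composed on
  numerator and denominator as polynomials.\<close>

lemma ev_ev:
  assumes "q \<in> ratfuns (length ts)" "indep ts" "indep us" "set ts \<subseteq> ratfuns (length us)"
  shows "ev (ev q ts) us = ev q (map (\<lambda>t. ev t us) ts)"
proof -
  obtain a b where *: "q = Fract a b" "b \<noteq> 0" "poly_vars a \<subseteq> {1..length ts}" "poly_vars b \<subseteq> {1..length ts}"
    using assms unfolding ratfuns_def by auto
  have "poly_subst (list_subst ts) p \<in> ratfuns (length us)" for p
    using assms by (auto intro!: poly_subst_ratfuns list_subst_ratfuns)
  moreover have "ev (poly_subst (list_subst ts) p) us =
      poly_subst (list_subst (map (\<lambda>t. ev t us) ts)) p" for p
    using assms by (subst ev_poly_subst) (auto simp: list_subst_ratfuns ev_list_subst)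
  ultimately show ?thesis
    using assms * indep_map_ev[of ts us] by (simp add: ev_Fract ev_divide[of us "length us"])
qed

lemma indep_map_xvar: "indep (map xvar [1..<Suc n])"
  unfolding indep_def
proof (intro allI impI, elim conjE)
  fix b assume b: "b \<noteq> 0" "poly_vars b \<subseteq> {1..length (map xvar [1..<Suc n])}"
  have "poly_subst (list_subst (map xvar [1..<Suc n])) b = poly_subst xvar b"
    by (rule poly_subst_cong) (use b in \<open>auto simp: list_subst_def simp del: upt_Suc\<close>)
  then show "poly_subst (list_subst (map xvar [1..<Suc n])) b \<noteq> 0"
    using b by (simp add: poly_subst_xvar Zero_fract_def eq_fract)
qed

lemma ev_xvars:
  assumes "q \<in> ratfuns n"
  shows "ev q (map xvar [1..<Suc n]) = q"
proof -
  obtain a b where *: "q = Fract a b" "b \<noteq> 0" "poly_vars a \<subseteq> {1..n}" "poly_vars b \<subseteq> {1..n}"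
    using assms unfolding ratfuns_def by auto
  have "poly_subst (list_subst (map xvar [1..<Suc n])) p = Fract p 1" if "poly_vars p \<subseteq> {1..n}" for p
    using that by (subst poly_subst_xvar[symmetric, OF that], intro poly_subst_cong)
       (auto simp: list_subst_def simp del: upt_Suc)
  then show ?thesis
    using * indep_map_xvar[of n] by (simp add: ev_Fract del: upt_Suc)
qed

section \<open>Homogeneous rational functions\<close>

lemma homogeneous_poly_0 [simp]: "homogeneous_poly n 0"
  by (simp add: homogeneous_poly_def)

lemma homogeneous_poly_1 [simp]: "homogeneous_poly 0 1"
  by (simp add: homogeneous_poly_def)

lemma homogeneous_poly_uminus: "homogeneous_poly n p \<Longrightarrow> homogeneous_poly n (- p)"
  by (auto simp: homogeneous_poly_def in_keys_iff)

lemma homogeneous_poly_add: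
  "homogeneous_poly n p \<Longrightarrow> homogeneous_poly n q \<Longrightarrow> homogeneous_poly n (p + q)"
  unfolding homogeneous_poly_def using Poly_Mapping.keys_add[of p q] by fastforce

lemma homogeneous_poly_mult:
  assumes "homogeneous_poly n p" "homogeneous_poly m q"
  shows "homogeneous_poly (n + m) (p * q)"
  unfolding homogeneous_poly_def
proof
  let ?deg = "\<lambda>m. \<Sum>j\<in>Poly_Mapping.keys m. Poly_Mapping.lookup m j"
  have deg: "?deg a = (\<Sum>j\<in>S. Poly_Mapping.lookup a j)"
    if "finite S" "Poly_Mapping.keys a \<subseteq> S" for a :: "nat \<Rightarrow>\<^sub>0 nat" and S
    by (rule sum.mono_neutral_left) (use that in \<open>auto simp: in_keys_iff\<close>)
  fix l assume "l \<in> Poly_Mapping.keys (p * q)"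
  then obtain a b where "l = a + b" "a \<in> Poly_Mapping.keys p" "b \<in> Poly_Mapping.keys q"
    using keys_mult[of p q] by auto
  moreover have "?deg (a + b) = ?deg a + ?deg b"
    using Poly_Mapping.keys_add[of a b]
    by (subst (1 2 3) deg[of "Poly_Mapping.keys a \<union> Poly_Mapping.keys b"])
       (auto simp: lookup_add sum.distrib)
  ultimately show "?deg l = n + m"
    using assms by (auto simp: homogeneous_poly_def)
qed

lemma homogeneous_ratfunsI:
  assumes "poly_vars a \<subseteq> {1..r}" "poly_vars b \<subseteq> {1..r}" "b \<noteq> 0"
    "homogeneous_poly m a" "homogeneous_poly n b" "int m - int n = e"
  shows "Fract a b \<in> homogeneous_ratfuns r e"
  unfolding homogeneous_ratfuns_def using assms by blast

lemma homogeneous_ratfunsE: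
  assumes "p \<in> homogeneous_ratfuns r e"
  obtains "p = 0" | a b m n where "p = Fract a b" "poly_vars a \<subseteq> {1..r}" "poly_vars b \<subseteq> {1..r}" "b \<noteq> 0"
    "homogeneous_poly m a" "homogeneous_poly n b" "int m - int n = e"
  using assms unfolding homogeneous_ratfuns_def by blast

lemma homogeneous_imp_ratfuns: "p \<in> homogeneous_ratfuns r e \<Longrightarrow> p \<in> ratfuns r"
  by (erule homogeneous_ratfunsE) (use ratfunsI in auto)

lemma homogeneous_0 [simp, intro]: "0 \<in> homogeneous_ratfuns r e"
  by (simp add: homogeneous_ratfuns_def)

lemma homogeneous_add [intro]:
  assumes "p \<in> homogeneous_ratfuns r e" "q \<in> homogeneous_ratfuns r e"
  shows "p + q \<in> homogeneous_ratfuns r e"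
  using assms(1)
proof (cases rule: homogeneous_ratfunsE)
  case p: (2 a b m n)
  show ?thesis
    using assms(2)
  proof (cases rule: homogeneous_ratfunsE)
    case q: (2 c d m' n')
    \<comment> \<open>Equal degrees of the fractions make the two cross products homogeneous of one
      degree.\<close>
    have "int m + int n' = int m' + int n"
      using p q by simp
    then have eq: "m + n' = m' + n"
      by linarith
    have "homogeneous_poly (m + n') (a * d)" "homogeneous_poly (m' + n) (c * b)"
      using p q by (auto intro: homogeneous_poly_mult)
    then have "homogeneous_poly (m + n') (a * d + c * b)"
      unfolding eq by (rule homogeneous_poly_add)
    moreover have "homogeneous_poly (n + n') (b * d)"
      using p q by (auto intro: homogeneous_poly_mult)
    moreover have "poly_vars (a * d + c * b) \<subseteq> {1..r}" "poly_vars (b * d) \<subseteq> {1..r}"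
      using p q poly_vars_add[of "a * d" "c * b"] poly_vars_mult[of a d] poly_vars_mult[of c b]
        poly_vars_mult[of b d]
      by blast+
    ultimately have "Fract (a * d + c * b) (b * d) \<in> homogeneous_ratfuns r e"
      using p q by (intro homogeneous_ratfunsI[where m = "m + n'" and n = "n + n'"]) auto
    then show ?thesis
      using p q by simp
  qed (use assms(1) in simp)
qed (use assms(2) in simp)

lemma homogeneous_mult:
  assumes "p \<in> homogeneous_ratfuns r e" "q \<in> homogeneous_ratfuns r e'"
  shows "p * q \<in> homogeneous_ratfuns r (e + e')"
  using assms(1)
proof (cases rule: homogeneous_ratfunsE)
  case p: (2 a b m n)
  show ?thesis
    using assms(2)
  proof (cases rule: homogeneous_ratfunsE)
    case q: (2 c d m' n')
    have "poly_vars (a * c) \<subseteq> {1..r}" "poly_vars (b * d) \<subseteq> {1..r}"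
      using p q poly_vars_mult[of a c] poly_vars_mult[of b d]
      by blast+
    then have "Fract (a * c) (b * d) \<in> homogeneous_ratfuns r (e + e')"
      using p q by (intro homogeneous_ratfunsI[where m = "m + m'" and n = "n + n'"])
        (auto intro: homogeneous_poly_mult)
    then show ?thesis
      using p q by simp
  qed simp
qed simp

lemma homogeneous_mult_eq:
  "p \<in> homogeneous_ratfuns r e \<Longrightarrow> q \<in> homogeneous_ratfuns r e' \<Longrightarrow> e + e' = e'' \<Longrightarrow>
    p * q \<in> homogeneous_ratfuns r e''"
  using homogeneous_mult by blast

lemma homogeneous_uminus [intro]:
  assumes "p \<in> homogeneous_ratfuns r e"
  shows "- p \<in> homogeneous_ratfuns r e"
  using assms
proof (cases rule: homogeneous_ratfunsE)
  case (2 a b m n)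
  then have "Fract (- a) b \<in> homogeneous_ratfuns r e"
    by (intro homogeneous_ratfunsI[of _ _ _ m n]) (auto intro: homogeneous_poly_uminus)
  with 2 show ?thesis by simp
qed auto

lemma homogeneous_diff [intro]:
  "p \<in> homogeneous_ratfuns r e \<Longrightarrow> q \<in> homogeneous_ratfuns r e \<Longrightarrow>
    p - q \<in> homogeneous_ratfuns r e"
  using homogeneous_add[of p r e "- q"] by auto

lemma homogeneous_inverse:
  assumes "p \<in> homogeneous_ratfuns r e"
  shows "inverse p \<in> homogeneous_ratfuns r (- e)"
proof (cases "p = 0")
  case False
  show ?thesis
    using assms
  proof (cases rule: homogeneous_ratfunsE)
    case (2 a b m n)
    then have "a \<noteq> 0" using False by (auto simp: fract_collapse)
    with 2 have "Fract b a \<in> homogeneous_ratfuns r (- e)"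
      by (intro homogeneous_ratfunsI[of _ _ _ n m]) auto
    with 2 show ?thesis by simp
  qed (use False in auto)
qed auto

lemma homogeneous_divide:
  "p \<in> homogeneous_ratfuns r e \<Longrightarrow> q \<in> homogeneous_ratfuns r e' \<Longrightarrow> e - e' = e'' \<Longrightarrow>
    p / q \<in> homogeneous_ratfuns r e''"
  unfolding divide_inverse by (rule homogeneous_mult_eq) (auto intro: homogeneous_inverse)

lemma homogeneous_sum [intro]:
  "(\<And>x. x \<in> A \<Longrightarrow> f x \<in> homogeneous_ratfuns r e) \<Longrightarrow> sum f A \<in> homogeneous_ratfuns r e"
  by (induction A rule: infinite_finite_induct) auto

lemma homogeneous_of_rat [simp, intro]: "of_rat c \<in> homogeneous_ratfuns r 0"
  unfolding of_rat_eq_Fract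
  by (rule homogeneous_ratfunsI[of _ _ _ 0 0]) (auto simp: poly_vars_def homogeneous_poly_def)

lemma homogeneous_of_nat [simp, intro]: "of_nat n \<in> homogeneous_ratfuns r 0"
  using homogeneous_of_rat[of "of_nat n" r] by simp

lemma homogeneous_1 [simp, intro]: "1 \<in> homogeneous_ratfuns r 0"
  using homogeneous_of_nat[of 1 r] by simp

lemma homogeneous_prod:
  "(\<And>x. x \<in> A \<Longrightarrow> f x \<in> homogeneous_ratfuns r (d x)) \<Longrightarrow>
    prod f A \<in> homogeneous_ratfuns r (\<Sum>x\<in>A. d x)"
  by (induction A rule: infinite_finite_induct) (auto intro: homogeneous_mult_eq)

lemma homogeneous_power:
  "p \<in> homogeneous_ratfuns r e \<Longrightarrow> p ^ n \<in> homogeneous_ratfuns r (int n * e)"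
  by (induction n) (auto intro: homogeneous_mult_eq simp: algebra_simps)

lemma homogeneous_scale:
  "p \<in> homogeneous_ratfuns r e \<Longrightarrow> c \<in> homogeneous_ratfuns r 0 \<Longrightarrow> c * p \<in> homogeneous_ratfuns r e"
  by (rule homogeneous_mult_eq) auto

lemma homogeneous_xvar [simp, intro]: "j \<le> r \<Longrightarrow> xvar j \<in> homogeneous_ratfuns r 1"
proof (cases "j = 0")
  case False
  moreover assume "j \<le> r"
  ultimately show ?thesis
    unfolding xvar_def using poly_vars_single[of j]
    by (auto intro!: homogeneous_ratfunsI[of _ _ _ 1 0] simp: homogeneous_poly_def)
qed auto

lemma homogeneous_poly_subst:
  assumes "homogeneous_poly m p" "\<And>j. \<sigma> j \<in> homogeneous_ratfuns n 1"
  shows "poly_subst \<sigma> p \<in> homogeneous_ratfuns n (int m)"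
  unfolding poly_subst_def
proof (intro homogeneous_sum homogeneous_scale)
  fix l assume "l \<in> Poly_Mapping.keys p"
  then have "(\<Sum>j\<in>Poly_Mapping.keys l. int (Poly_Mapping.lookup l j) * 1) = int m"
    using assms(1) by (auto simp: homogeneous_poly_def of_nat_sum[symmetric] simp del: of_nat_sum)
  then show "(\<Prod>j\<in>Poly_Mapping.keys l. \<sigma> j ^ Poly_Mapping.lookup l j) \<in> homogeneous_ratfuns n (int m)"
    using homogeneous_prod[of "Poly_Mapping.keys l" "\<lambda>j. \<sigma> j ^ Poly_Mapping.lookup l j" n
        "\<lambda>j. int (Poly_Mapping.lookup l j) * 1"] homogeneous_power[OF assms(2)] by simp
qed auto

text \<open>Putting elements of degree 1 in place of the variables preserves the degrees of
  numerator and denominator.\<close>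

lemma homogeneous_ev:
  assumes "q \<in> homogeneous_ratfuns (length ts) e" "indep ts" "set ts \<subseteq> homogeneous_ratfuns n 1"
  shows "ev q ts \<in> homogeneous_ratfuns n e"
  using assms(1)
proof (cases rule: homogeneous_ratfunsE)
  case (2 a b k l)
  have "list_subst ts j \<in> homogeneous_ratfuns n 1" for j
    using assms(3) nth_mem[of "j - 1" ts] by (auto simp: list_subst_def Suc_le_eq)
  then show ?thesis
    using 2 assms(2)
    by (auto simp: ev_Fract intro!: homogeneous_divide homogeneous_poly_subst)
qed auto

section \<open>Differences of variables\<close>

definition svar :: "bool \<Rightarrow> nat \<Rightarrow> ratfun" where
  "svar \<beta> j = (if \<beta> then xvar j else - xvar j)"

text \<open>Arguments of a mould on the Ihara side, measured from the first of the points
  \<open>ys\<close>; \<open>differences\<close> gives those on the ari side. Partial sums of the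
  latter are the former, which is the effect of \<open>sharp\<close>.\<close>

definition offsets :: "'a::ab_group_add list \<Rightarrow> 'a list" where
  "offsets ys = map (\<lambda>a. a - hd ys) (tl ys)"

definition differences :: "'a::ab_group_add list \<Rightarrow> 'a list" where
  "differences ys = map2 (\<lambda>a b. b - a) ys (tl ys)"

lemma length_offsets [simp]: "length (offsets ys) = length ys - 1"
  by (simp add: offsets_def)

lemma length_differences [simp]: "length (differences ys) = length ys - 1"
  by (simp add: differences_def)

lemma nth_offsets [simp]: "Suc k < length ys \<Longrightarrow> offsets ys ! k = ys ! Suc k - ys ! 0"
  by (cases ys) (auto simp: offsets_def)

lemma nth_differences [simp]: "Suc k < length ys \<Longrightarrow> differences ys ! k = ys ! Suc k - ys ! k"
  by (auto simp: differences_def nth_tl)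

text \<open>Reversing the points changes the sign of each difference, and negating them undoes
  this.\<close>

lemma rev_differences: "rev (differences ys) = differences (map uminus (rev ys))"
  by (rule nth_equalityI) (auto simp: rev_nth Suc_diff_Suc)

text \<open>\<open>poly_eval_rel \<tau> p q\<close>: the polynomial \<open>p\<close> evaluates to \<open>q\<close> under \<open>\<tau>\<close>, without any
  independence assumption on \<open>\<tau>\<close>.\<close>

definition poly_eval_rel :: "(nat \<Rightarrow> ratfun) \<Rightarrow> ratfun \<Rightarrow> ratfun \<Rightarrow> bool" where
  "poly_eval_rel \<tau> p q \<longleftrightarrow> (\<exists>B. p = Fract B 1 \<and> poly_subst \<tau> B = q)"

lemma poly_eval_rel_of_rat: "poly_eval_rel \<tau> (of_rat c) (of_rat c)"
  unfolding poly_eval_rel_def of_rat_eq_Fract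
  by (auto simp: poly_subst_single of_rat_eq_Fract intro!: exI[of _ "Poly_Mapping.single 0 c"])

lemma poly_eval_rel_0: "poly_eval_rel \<tau> 0 0"
  using poly_eval_rel_of_rat[of \<tau> 0] by simp

lemma poly_eval_rel_1: "poly_eval_rel \<tau> 1 1"
  using poly_eval_rel_of_rat[of \<tau> 1] by simp

lemma poly_eval_rel_add:
  "poly_eval_rel \<tau> p q \<Longrightarrow> poly_eval_rel \<tau> p' q' \<Longrightarrow> poly_eval_rel \<tau> (p + p') (q + q')"
  unfolding poly_eval_rel_def by (fastforce simp: poly_subst_add)

lemma poly_eval_rel_uminus: "poly_eval_rel \<tau> p q \<Longrightarrow> poly_eval_rel \<tau> (- p) (- q)"
  unfolding poly_eval_rel_def by (fastforce simp: poly_subst_uminus)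

lemma poly_eval_rel_diff:
  "poly_eval_rel \<tau> p q \<Longrightarrow> poly_eval_rel \<tau> p' q' \<Longrightarrow> poly_eval_rel \<tau> (p - p') (q - q')"
  using poly_eval_rel_add[of \<tau> p q "- p'" "- q'"] poly_eval_rel_uminus by auto

lemma poly_eval_rel_mult:
  "poly_eval_rel \<tau> p q \<Longrightarrow> poly_eval_rel \<tau> p' q' \<Longrightarrow> poly_eval_rel \<tau> (p * p') (q * q')"
  unfolding poly_eval_rel_def by (fastforce simp: poly_subst_mult)

lemma poly_eval_rel_sum:
  "(\<And>x. x \<in> A \<Longrightarrow> poly_eval_rel \<tau> (f x) (g x)) \<Longrightarrow> poly_eval_rel \<tau> (sum f A) (sum g A)"
  by (induction A rule: infinite_finite_induct) (auto intro: poly_eval_rel_add poly_eval_rel_0)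

lemma poly_eval_rel_prod:
  "(\<And>x. x \<in> A \<Longrightarrow> poly_eval_rel \<tau> (f x) (g x)) \<Longrightarrow> poly_eval_rel \<tau> (prod f A) (prod g A)"
  by (induction A rule: infinite_finite_induct) (auto intro: poly_eval_rel_mult poly_eval_rel_1)

lemma poly_eval_rel_power: "poly_eval_rel \<tau> p q \<Longrightarrow> poly_eval_rel \<tau> (p ^ n) (q ^ n)"
  by (induction n) (auto intro: poly_eval_rel_mult poly_eval_rel_1)

lemma poly_eval_rel_xvar:
  assumes "\<tau> 0 = 0"
  shows "poly_eval_rel \<tau> (xvar j) (\<tau> j)"
proof (cases "j = 0")
  case False
  then show ?thesis
    unfolding poly_eval_rel_def xvar_def
    by (auto intro!: exI[of _ "Poly_Mapping.single (Poly_Mapping.single j 1) 1"]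
        simp: poly_subst_single monom_subst_def)
qed (use assms in \<open>auto intro: poly_eval_rel_0\<close>)

text \<open>\<open>\<tau>\<close> undoes the substitution on each element of \<open>ts\<close>.
  Applied to a relation among the \<open>ts\<close>, it gives the same relation among the
  variables.\<close>

lemma indepI:
  assumes "\<And>k. k < length ts \<Longrightarrow> poly_eval_rel \<tau> (ts ! k) (xvar (Suc k))"
  shows "indep ts"
  unfolding indep_def
proof (intro allI impI notI, elim conjE)
  fix b assume b: "b \<noteq> 0" "poly_vars b \<subseteq> {1..length ts}" "poly_subst (list_subst ts) b = 0"
  have "poly_eval_rel \<tau> (poly_subst (list_subst ts) b) (poly_subst xvar b)"
    unfolding poly_subst_def
  proof (intro poly_eval_rel_sum poly_eval_rel_mult poly_eval_rel_prod poly_eval_rel_power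
      poly_eval_rel_of_rat)
    fix m j assume "m \<in> Poly_Mapping.keys b" "j \<in> Poly_Mapping.keys m"
    then have "j \<in> {1..length ts}" using b(2) by (auto simp: poly_vars_def)
    then show "poly_eval_rel \<tau> (list_subst ts j) (xvar j)"
      using assms[of "j - 1"] by (auto simp: list_subst_def)
  qed
  then obtain B where "Fract B 1 = 0" "poly_subst \<tau> B = Fract b 1"
    unfolding poly_eval_rel_def poly_subst_xvar[OF b(2)] b(3) by auto
  then show False
    using b(1) by (auto simp: Zero_fract_def eq_fract)
qed

text \<open>The letter 0 stands for the constant 0, so its value is forced. The shift by
  \<open>c\<close> adapts the prescribed values to this; differences of values do not see
  it.\<close>

lemma ex_affine_subst:
  fixes E :: "nat \<Rightarrow> ratfun"
  assumes "distinct w"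
  shows "\<exists>\<tau> c. \<tau> 0 = 0 \<and> (\<forall>k<length w. \<tau> (w ! k) = E k - c)"
proof -
  define idx where "idx = the_inv_into {..<length w} ((!) w)"
  have idx: "idx (w ! k) = k" if "k < length w" for k
    unfolding idx_def using assms that by (intro the_inv_into_f_f) (auto intro: inj_on_nth)
  define c where "c = (if 0 \<in> set w then E (idx 0) else 0)"
  define \<tau> where "\<tau> j = (if j \<in> set w then E (idx j) - c else 0)" for j
  have "\<tau> 0 = 0" by (simp add: \<tau>_def c_def)
  moreover have "\<forall>k<length w. \<tau> (w ! k) = E k - c" by (simp add: \<tau>_def idx)
  ultimately show ?thesis by blast
qed

lemma poly_eval_rel_svar: "\<tau> 0 = 0 \<Longrightarrow> poly_eval_rel \<tau> (svar \<beta> j) (if \<beta> then \<tau> j else - \<tau> j)"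
  by (simp add: svar_def poly_eval_rel_xvar poly_eval_rel_uminus)

lemma indep_offsets:
  assumes "distinct w"
  shows "indep (offsets (map (svar \<beta>) w))"
proof -
  obtain \<tau> c where \<tau>: "\<tau> 0 = 0" "\<forall>k<length w. \<tau> (w ! k) = (if \<beta> then xvar k else - xvar k) - c"
    using ex_affine_subst[OF assms, of "\<lambda>k. if \<beta> then xvar k else - xvar k"] by blast
  have rel: "poly_eval_rel \<tau> (svar \<beta> j) (if \<beta> then \<tau> j else - \<tau> j)" for j
    by (rule poly_eval_rel_svar) (rule \<tau>(1))
  show ?thesis
  proof (rule indepI)
    fix k assume "k < length (offsets (map (svar \<beta>) w))"
    then have k: "Suc k < length w" by simp
    have eq1: "\<tau> (w ! Suc k) = (if \<beta> then xvar (Suc k) else - xvar (Suc k)) - c"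
      using \<tau>(2) k by blast
    have eq2: "\<tau> (w ! 0) = - c"
      using \<tau>(2)[rule_format, of 0] k by (cases w; cases \<beta>) auto
    have "poly_eval_rel \<tau> (svar \<beta> (w ! Suc k) - svar \<beta> (w ! 0)) (xvar (Suc k))"
      using poly_eval_rel_diff[OF rel[of "w ! Suc k"] rel[of "w ! 0"]] eq1 eq2 by (cases \<beta>) simp_all
    then show "poly_eval_rel \<tau> (offsets (map (svar \<beta>) w) ! k) (xvar (Suc k))"
      using k by (cases w) auto
  qed
qed

definition xsum :: "nat \<Rightarrow> ratfun" where
  "xsum k = (\<Sum>j=1..k. xvar j)"

lemma xsum_0 [simp]: "xsum 0 = 0" and xsum_Suc [simp]: "xsum (Suc k) = xsum k + xvar (Suc k)"
  by (auto simp: xsum_def)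

text \<open>The letter at position \<open>k\<close> is sent to the partial sum
  \<open>xsum k\<close>, up to sign and shift, so that consecutive differences become single
  variables.\<close>

lemma indep_differences:
  assumes "distinct w"
  shows "indep (differences (map (svar \<beta>) w))"
proof -
  obtain \<tau> c where \<tau>: "\<tau> 0 = 0" "\<forall>k<length w. \<tau> (w ! k) = (if \<beta> then xsum k else - xsum k) - c"
    using ex_affine_subst[OF assms, of "\<lambda>k. if \<beta> then xsum k else - xsum k"] by blast
  have rel: "poly_eval_rel \<tau> (svar \<beta> j) (if \<beta> then \<tau> j else - \<tau> j)" for j
    by (rule poly_eval_rel_svar) (rule \<tau>(1))
  show ?thesis
  proof (rule indepI)
    fix k assume "k < length (differences (map (svar \<beta>) w))"
    then have k: "Suc k < length w" by simp
    have eq1: "\<tau> (w ! Suc k) = (if \<beta> then xsum (Suc k) else - xsum (Suc k)) - c"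
      using \<tau>(2) k by blast
    have eq2: "\<tau> (w ! k) = (if \<beta> then xsum k else - xsum k) - c"
      using \<tau>(2) k by simp
    have "poly_eval_rel \<tau> (svar \<beta> (w ! Suc k) - svar \<beta> (w ! k)) (xvar (Suc k))"
      using poly_eval_rel_diff[OF rel[of "w ! Suc k"] rel[of "w ! k"]] eq1 eq2 by (cases \<beta>) simp_all
    then show "poly_eval_rel \<tau> (differences (map (svar \<beta>) w) ! k) (xvar (Suc k))"
      using k by auto
  qed
qed

definition flat_args :: "bool \<Rightarrow> nat list \<Rightarrow> ratfun list" where
  "flat_args \<beta> w = offsets (map (svar \<beta>) w)"

definition sharp_args :: "bool \<Rightarrow> nat list \<Rightarrow> ratfun list" where
  "sharp_args \<beta> w = differences (map (svar \<beta>) w)"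

lemma length_flat_args [simp]: "length (flat_args \<beta> w) = length w - 1"
  by (simp add: flat_args_def)

lemma length_sharp_args [simp]: "length (sharp_args \<beta> w) = length w - 1"
  by (simp add: sharp_args_def)

lemma indep_flat_args: "distinct w \<Longrightarrow> indep (flat_args \<beta> w)"
  by (simp add: flat_args_def indep_offsets)

lemma indep_sharp_args: "distinct w \<Longrightarrow> indep (sharp_args \<beta> w)"
  by (simp add: sharp_args_def indep_differences)

lemma xsum_homogeneous: "k \<le> n \<Longrightarrow> xsum k \<in> homogeneous_ratfuns n 1"
  unfolding xsum_def by auto

lemma svar_homogeneous: "k \<le> n \<Longrightarrow> svar \<beta> k \<in> homogeneous_ratfuns n 1"
  unfolding svar_def by auto

lemma set_offsets_homogeneous:
  "set ys \<subseteq> homogeneous_ratfuns n e \<Longrightarrow> set (offsets ys) \<subseteq> homogeneous_ratfuns n e"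
  by (cases ys) (auto simp: offsets_def)

lemma set_differences_homogeneous:
  "set ys \<subseteq> homogeneous_ratfuns n e \<Longrightarrow> set (differences ys) \<subseteq> homogeneous_ratfuns n e"
proof -
  assume *: "set ys \<subseteq> homogeneous_ratfuns n e"
  have "b - a \<in> homogeneous_ratfuns n e" if "(a, b) \<in> set (zip ys (tl ys))" for a b
    using * set_zip_leftD[OF that] set_zip_rightD[OF that] list.set_sel(2)[of ys b]
    by (cases ys) auto
  then show ?thesis by (auto simp: differences_def)
qed

lemma ev_xvar_sharp_args:
  assumes "distinct w" "length w = Suc n" "1 \<le> j" "j \<le> n"
  shows "ev (xvar j) (sharp_args \<beta> w) = svar \<beta> (w ! j) - svar \<beta> (w ! (j - 1))"
  using assms by (subst ev_xvar[OF indep_sharp_args]) (auto simp: sharp_args_def)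

lemma ev_xsum_sharp_args:
  assumes "distinct w" "length w = Suc n" "k \<le> n"
  shows "ev (xsum k) (sharp_args \<beta> w) = svar \<beta> (w ! k) - svar \<beta> (w ! 0)"
proof -
  have "ev (xsum k) (sharp_args \<beta> w) = (\<Sum>j=1..k. ev (xvar j) (sharp_args \<beta> w))"
    unfolding xsum_def using assms by (intro ev_sum[OF indep_sharp_args]) auto
  also have "\<dots> = (\<Sum>j=1..k. svar \<beta> (w ! j) - svar \<beta> (w ! (j - 1)))"
    using assms by (intro sum.cong refl ev_xvar_sharp_args) auto
  also have "\<dots> = svar \<beta> (w ! k) - svar \<beta> (w ! 0)"
    by (induction k) auto
  finally show ?thesis .
qed

lemma ev_svar_flat_args:
  assumes "distinct w" "length w = Suc n" "k \<le> n"
  shows "ev (svar \<gamma> k) (flat_args \<beta> w) = svar (\<beta> = \<gamma>) (w ! k) - svar (\<beta> = \<gamma>) (w ! 0)"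
proof (cases "k = 0")
  case False
  have "ev (xvar k) (flat_args \<beta> w) = svar \<beta> (w ! k) - svar \<beta> (w ! 0)"
    using assms False by (subst ev_xvar[OF indep_flat_args]) (auto simp: flat_args_def)
  then show ?thesis
    using assms by (auto simp: svar_def ev_uminus[OF indep_flat_args])
qed (simp add: svar_def)

lemma ev_xsum_diff_sharp_args:
  assumes "distinct w" "length w = Suc n" "k \<le> n" "l \<le> n"
  shows "ev (xsum k - xsum l) (sharp_args \<beta> w) = svar \<beta> (w ! k) - svar \<beta> (w ! l)"
  using assms xsum_homogeneous[THEN homogeneous_imp_ratfuns]
  by (subst ev_diff[OF indep_sharp_args]) (auto simp: ev_xsum_sharp_args)

lemma ev_svar_diff_flat_args:
  assumes "distinct w" "length w = Suc n" "k \<le> n" "l \<le> n"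
  shows "ev (svar \<gamma> k - svar \<gamma> l) (flat_args \<beta> w) = svar (\<beta> = \<gamma>) (w ! k) - svar (\<beta> = \<gamma>) (w ! l)"
  using assms svar_homogeneous[THEN homogeneous_imp_ratfuns]
  by (subst ev_diff[OF indep_flat_args]) (auto simp: ev_svar_flat_args)

text \<open>The points of a flexion are partial sums, and evaluation at the word \<open>w\<close>
  turns the \<open>k\<close>-th partial sum into the letter \<open>w ! k\<close>, up to sign and a
  common shift. Composing flexions thus becomes selecting letters.\<close>

lemma map_ev_differences_xsum:
  assumes "distinct w" "length w = Suc n" "set v \<subseteq> {..n}"
  shows "map (\<lambda>t. ev t (sharp_args \<beta> w)) (differences (map xsum v)) = sharp_args \<beta> (map ((!) w) v)"
proof (rule nth_equalityI)
  fix k assume "k < length (map (\<lambda>t. ev t (sharp_args \<beta> w)) (differences (map xsum v)))"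
  then have k: "Suc k < length v" by simp
  then have k0: "0 < length v" and k1: "k < length v" by linarith+
  have "v ! j \<le> n" if "j \<le> Suc k" for j
    using assms(3) nth_mem[of j v] k that by (auto simp del: nth_mem)
  then have le: "v ! Suc k \<le> n" "v ! k \<le> n" "v ! 0 \<le> n"
    by auto
  have *: "(differences (map xsum v)) ! k = xsum (v ! Suc k) - xsum (v ! k)"
    using k k0 k1 by (simp)
  have "map (\<lambda>t. ev t (sharp_args \<beta> w)) (differences (map xsum v)) ! k = ev ((differences (map xsum v)) ! k) (sharp_args \<beta> w)"
    using k by (intro nth_map) simp
  also have "\<dots> = sharp_args \<beta> (map ((!) w) v) ! k"
    unfolding * using le k k0 k1 by (simp add: ev_xsum_diff_sharp_args[OF assms(1,2)] sharp_args_def[of _ "map _ v"])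
  finally show "map (\<lambda>t. ev t (sharp_args \<beta> w)) (differences (map xsum v)) ! k = sharp_args \<beta> (map ((!) w) v) ! k" .
qed simp

lemma map_ev_offsets_xsum:
  assumes "distinct w" "length w = Suc n" "set v \<subseteq> {..n}"
  shows "map (\<lambda>t. ev t (sharp_args \<beta> w)) (offsets (map xsum v)) = flat_args \<beta> (map ((!) w) v)"
proof (rule nth_equalityI)
  fix k assume "k < length (map (\<lambda>t. ev t (sharp_args \<beta> w)) (offsets (map xsum v)))"
  then have k: "Suc k < length v" by simp
  then have k0: "0 < length v" and k1: "k < length v" by linarith+
  have "v ! j \<le> n" if "j \<le> Suc k" for j
    using assms(3) nth_mem[of j v] k that by (auto simp del: nth_mem)
  then have le: "v ! Suc k \<le> n" "v ! k \<le> n" "v ! 0 \<le> n"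
    by auto
  have *: "(offsets (map xsum v)) ! k = xsum (v ! Suc k) - xsum (v ! 0)"
    using k k0 k1 by (simp)
  have "map (\<lambda>t. ev t (sharp_args \<beta> w)) (offsets (map xsum v)) ! k = ev ((offsets (map xsum v)) ! k) (sharp_args \<beta> w)"
    using k by (intro nth_map) simp
  also have "\<dots> = flat_args \<beta> (map ((!) w) v) ! k"
    unfolding * using le k k0 k1 by (simp add: ev_xsum_diff_sharp_args[OF assms(1,2)] flat_args_def)
  finally show "map (\<lambda>t. ev t (sharp_args \<beta> w)) (offsets (map xsum v)) ! k = flat_args \<beta> (map ((!) w) v) ! k" .
qed simp

lemma map_ev_flat_args:
  assumes "distinct w" "length w = Suc n" "set v \<subseteq> {..n}"
  shows "map (\<lambda>t. ev t (flat_args \<beta> w)) (flat_args \<gamma> v) = flat_args (\<beta> = \<gamma>) (map ((!) w) v)"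
proof (rule nth_equalityI)
  fix k assume "k < length (map (\<lambda>t. ev t (flat_args \<beta> w)) (flat_args \<gamma> v))"
  then have k: "Suc k < length v" by simp
  then have k0: "0 < length v" and k1: "k < length v" by linarith+
  have "v ! j \<le> n" if "j \<le> Suc k" for j
    using assms(3) nth_mem[of j v] k that by (auto simp del: nth_mem)
  then have le: "v ! Suc k \<le> n" "v ! k \<le> n" "v ! 0 \<le> n"
    by auto
  have *: "(flat_args \<gamma> v) ! k = svar \<gamma> (v ! Suc k) - svar \<gamma> (v ! 0)"
    using k k0 k1 by (simp add: flat_args_def)
  have "map (\<lambda>t. ev t (flat_args \<beta> w)) (flat_args \<gamma> v) ! k = ev ((flat_args \<gamma> v) ! k) (flat_args \<beta> w)"
    using k by (intro nth_map) simp
  also have "\<dots> = flat_args (\<beta> = \<gamma>) (map ((!) w) v) ! k"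
    unfolding * using le k k0 k1 by (simp add: ev_svar_diff_flat_args[OF assms(1,2)] flat_args_def[of _ "map _ v"])
  finally show "map (\<lambda>t. ev t (flat_args \<beta> w)) (flat_args \<gamma> v) ! k = flat_args (\<beta> = \<gamma>) (map ((!) w) v) ! k" .
qed simp

text \<open>Evaluation at the word 0, ..., n turns these elements into the differences of the
  letters of \<open>v\<close>, whose independence is known.\<close>

lemma indep_differences_xsum:
  assumes "distinct v" "set v \<subseteq> {..n}"
  shows "indep (differences (map xsum v))"
proof (rule indep_of_map_ev)
  let ?w = "[0..<Suc n]"
  have "map ((!) ?w) v = v"
    using assms by (intro map_idI) (auto simp: less_Suc_eq_le simp del: upt_Suc)
  then show "indep (map (\<lambda>t. ev t (sharp_args True ?w)) (differences (map xsum v)))"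
    using assms by (subst map_ev_differences_xsum[of _ n]) (auto simp: indep_sharp_args simp del: upt_Suc)
  show "indep (sharp_args True ?w)"
    by (rule indep_sharp_args) simp
  have "set (differences (map xsum v)) \<subseteq> homogeneous_ratfuns n 1"
    using assms by (intro set_differences_homogeneous) (auto intro: xsum_homogeneous)
  then show "set (differences (map xsum v)) \<subseteq> ratfuns (length (sharp_args True ?w))"
    by (auto dest: homogeneous_imp_ratfuns)
qed

lemma indep_offsets_xsum:
  assumes "distinct v" "set v \<subseteq> {..n}"
  shows "indep (offsets (map xsum v))"
proof (rule indep_of_map_ev)
  let ?w = "[0..<Suc n]"
  have "map ((!) ?w) v = v"
    using assms by (intro map_idI) (auto simp: less_Suc_eq_le simp del: upt_Suc)
  then show "indep (map (\<lambda>t. ev t (sharp_args True ?w)) (offsets (map xsum v)))"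
    using assms by (subst map_ev_offsets_xsum[of _ n]) (auto simp: indep_flat_args simp del: upt_Suc)
  show "indep (sharp_args True ?w)"
    by (rule indep_sharp_args) simp
  have "set (offsets (map xsum v)) \<subseteq> homogeneous_ratfuns n 1"
    using assms by (intro set_offsets_homogeneous) (auto intro: xsum_homogeneous)
  then show "set (offsets (map xsum v)) \<subseteq> ratfuns (length (sharp_args True ?w))"
    by (auto dest: homogeneous_imp_ratfuns)
qed

section \<open>Flexions of the two products as selections of points\<close>

lemma length_Xs [simp]: "length (Xs i j) = Suc j - i"
  by (simp add: Xs_def del: upt_Suc)

lemma nth_Xs [simp]: "k < Suc j - i \<Longrightarrow> Xs i j ! k = xvar (i + k)"
  by (simp add: Xs_def del: upt_Suc)

lemma sum_xvar_eq: "i \<le> k \<Longrightarrow> (\<Sum>j=Suc i..k. xvar j) = xsum k - xsum i"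
  by (induction k rule: dec_induct) auto

lemma Xs_eq_differences: "Xs (i + 1) (i + r) = differences (map xsum [i..<i + Suc r])"
  by (rule nth_equalityI) (auto simp: nth_append simp del: upt_Suc)

text \<open>The points i+1, ..., i+r are removed and the first point i of the block stays; the long
  sum is the step across the gap. For \<open>i = s\<close> the gap is at the end and no step crosses
  it.\<close>

lemma ari_args_first:
  assumes "i \<le> s"
  shows "(if i = s then Xs 1 s
      else Xs 1 i @ [\<Sum>j=i+1..i+r+1. xvar j] @ Xs (i + r + 2) (r + s)) =
    differences (map xsum ([0..<Suc i] @ [Suc (i + r)..<Suc (r + s)]))"
proof (rule nth_equalityI)
  fix k assume "k < length (if i = s then Xs 1 s
      else Xs 1 i @ [\<Sum>j=i+1..i+r+1. xvar j] @ Xs (i + r + 2) (r + s))"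
  then have k: "k < s" using assms by (auto split: if_splits)
  have *: "(\<Sum>j=i+1..i+r+1. xvar j) = xsum (i + r + 1) - xsum i"
    using sum_xvar_eq[of i "i + r + 1"] by simp
  show "(if i = s then Xs 1 s
      else Xs 1 i @ [\<Sum>j=i+1..i+r+1. xvar j] @ Xs (i + r + 2) (r + s)) ! k =
    differences (map xsum ([0..<Suc i] @ [Suc (i + r)..<Suc (r + s)])) ! k"
    unfolding * using k assms
    by (cases "k < i"; cases "k = i") (auto simp: nth_append nth_Cons' simp del: upt_Suc)
qed (use assms in auto)

text \<open>Here the points i, ..., i+r-1 are removed, so the block keeps its last point
  i+r.\<close>

lemma ari_args_second:
  assumes "i \<le> s" "1 \<le> i"
  shows "Xs 1 (i - 1) @ [\<Sum>j=i..i+r. xvar j] @ Xs (i + r + 1) (r + s) =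
    differences (map xsum ([0..<i] @ [i + r..<Suc (r + s)]))"
proof (rule nth_equalityI)
  fix k assume "k < length (Xs 1 (i - 1) @ [\<Sum>j=i..i+r. xvar j] @ Xs (i + r + 1) (r + s))"
  then have k: "k < s" using assms by auto
  have *: "(\<Sum>j=i..i+r. xvar j) = xsum (i + r) - xsum (i - 1)"
    using sum_xvar_eq[of "i - 1" "i + r"] assms by simp
  show "(Xs 1 (i - 1) @ [\<Sum>j=i..i+r. xvar j] @ Xs (i + r + 1) (r + s)) ! k =
    differences (map xsum ([0..<i] @ [i + r..<Suc (r + s)])) ! k"
    unfolding * using k assms
    by (cases "Suc k < i"; cases "Suc k = i") (auto simp: nth_append nth_Cons' simp del: upt_Suc)
qed (use assms in auto)

lemma ihara_args_block:
  "map (\<lambda>j. xvar (i + j) - xvar i) [1..<Suc r] = flat_args True [i..<i + Suc r]"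
  unfolding flat_args_def svar_def
  by (rule nth_equalityI) (auto simp del: upt_Suc)

text \<open>Differences from the last point of the block are offsets in the reversed block once the
  variables change sign.\<close>

lemma ihara_args_rev_block:
  "map (\<lambda>j. xvar (i + r) - xvar (i + r - j)) [1..<Suc r] = flat_args False (rev [i..<i + Suc r])"
  unfolding flat_args_def svar_def
  by (rule nth_equalityI) (auto simp: rev_nth simp del: upt_Suc)

lemma ihara_args_first:
  assumes "i \<le> s"
  shows "Xs 1 i @ Xs (i + r + 1) (r + s) =
    flat_args True ([0..<Suc i] @ [Suc (i + r)..<Suc (r + s)])"
  unfolding flat_args_def svar_def
  by (rule nth_equalityI) (use assms in \<open>auto simp: nth_append simp del: upt_Suc\<close>)

lemma ihara_args_second:
  assumes "i \<le> s" "1 \<le> i"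
  shows "Xs 1 (i - 1) @ Xs (i + r) (r + s) = flat_args True ([0..<i] @ [i + r..<Suc (r + s)])"
  unfolding flat_args_def svar_def
  by (rule nth_equalityI) (use assms in \<open>auto simp: nth_append simp del: upt_Suc\<close>)

section \<open>Brackets of functions on words\<close>

text \<open>The arguments read off a word are algebraically independent when its letters are
  distinct. Blocks and contractions of distinct words are distinct, so the restriction is compatible
  with iteration.\<close>

definition dcontract ::
  "('a list \<Rightarrow> 'b::comm_ring_1) \<Rightarrow> ('a list \<Rightarrow> 'b) \<Rightarrow> 'a list \<Rightarrow> 'b" where
  "dcontract F G w = (if distinct w then contract F G w else 0)"

definition dbracket ::
  "('a list \<Rightarrow> 'b::comm_ring_1) \<Rightarrow> ('a list \<Rightarrow> 'b) \<Rightarrow> 'a list \<Rightarrow> 'b" where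
  "dbracket F G w = dcontract F G w - dcontract G F w"

lemma contract_cong:
  assumes "\<And>a b c. a @ b @ c = w \<Longrightarrow> b \<noteq> [] \<Longrightarrow>
    F b = F' b \<and> G (a @ hd b # c) = G' (a @ hd b # c) \<and> G (a @ last b # c) = G' (a @ last b # c)"
  shows "contract F G w = contract F' G' w"
proof -
  have "F b = F' b" "G (a @ hd b # c) = G' (a @ hd b # c)" "G (a @ last b # c) = G' (a @ last b # c)"
    if "(a, b, c) \<in> splits3 w" for a b c
    using assms[of a b c] that by (auto simp: splits3_def)
  then show ?thesis
    unfolding contract_def by (intro sum.cong refl) auto
qed

lemma contract_distinct_cong:
  assumes "distinct w" "\<And>u. distinct u \<Longrightarrow> F u = F' u" "\<And>u. distinct u \<Longrightarrow> G u = G' u"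
  shows "contract F G w = contract F' G' w"
proof (rule contract_cong)
  fix a b c assume w: "a @ b @ c = w" and b: "b \<noteq> []"
  from w assms(1) have "distinct (a @ b @ c)" by simp
  moreover from b have "hd b \<in> set b" "last b \<in> set b" by auto
  ultimately have "distinct b" "distinct (a @ hd b # c)" "distinct (a @ last b # c)"
    by auto
  with assms(2,3) show
    "F b = F' b \<and> G (a @ hd b # c) = G' (a @ hd b # c) \<and> G (a @ last b # c) = G' (a @ last b # c)"
    by blast
qed

lemma dcontract_commutator:
  "dcontract F (dcontract G K) w - dcontract G (dcontract F K) w = dcontract (dbracket F G) K w"
proof (cases "distinct w")
  case True
  have "contract F (dcontract G K) w = contract F (contract G K) w"
    "contract G (dcontract F K) w = contract G (contract F K) w"
    "contract (dbracket F G) K w = contract (word_bracket F G) K w"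
    by (rule contract_distinct_cong[OF True]; simp add: dcontract_def dbracket_def word_bracket_def)+
  then show ?thesis
    using True by (simp add: dcontract_def contract_commutator)
qed (simp add: dcontract_def)

lemma contract_add_left: "contract (\<lambda>u. F u + F' u) G w = contract F G w + contract F' G w"
  by (simp add: contract_def case_prod_beta sum.distrib[symmetric] algebra_simps)

lemma contract_add_right:
  "contract F (\<lambda>u. G u + G' u) w = contract F G w + contract F G' w"
  unfolding contract_def sum.distrib[symmetric]
  by (intro sum.cong refl) (auto simp: algebra_simps)

lemma contract_scale_left: "contract (\<lambda>u. k * F u) G w = k * contract F G w"
  unfolding contract_def sum_distrib_left
  by (intro sum.cong refl) (auto simp: algebra_simps)

lemma contract_scale_right: "contract F (\<lambda>u. k * G u) w = k * contract F G w"
  unfolding contract_def sum_distrib_left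
  by (intro sum.cong refl) (auto simp: algebra_simps)

lemma dbracket_add_left: "dbracket (\<lambda>u. F u + F' u) G w = dbracket F G w + dbracket F' G w"
  by (simp add: dbracket_def dcontract_def contract_add_left contract_add_right)

lemma dbracket_scale_left: "dbracket (\<lambda>u. k * F u) G w = k * dbracket F G w"
  by (simp add: dbracket_def dcontract_def contract_scale_left contract_scale_right algebra_simps)

lemma dbracket_swap: "dbracket F G w = - dbracket G F w"
  by (simp add: dbracket_def)

lemma dbracket_add_right: "dbracket F (\<lambda>u. G u + G' u) w = dbracket F G w + dbracket F G' w"
  using dbracket_add_left[of G G' F w] by (simp add: dbracket_swap[of F])

lemma dbracket_scale_right: "dbracket F (\<lambda>u. k * G u) w = k * dbracket F G w"
  using dbracket_scale_left[of k G F w] by (simp add: dbracket_swap[of F])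

lemma dcontract_diff_right:
  "dcontract F (\<lambda>u. G u - G' u) w = dcontract F G w - dcontract F G' w"
  using contract_add_right[of F G "\<lambda>u. (- 1) * G' u" w]
  by (simp add: dcontract_def contract_scale_right[of F "- 1", simplified])

text \<open>The commutator of a left-symmetric product satisfies the Jacobi identity:
  \<open>dcontract_commutator\<close>, used for all three pairs, rewrites each term with a bracket
  as left argument. In this form bracketing is a homomorphism to commutators of operators.\<close>

lemma dbracket_jacobi:
  fixes F G K :: "'a list \<Rightarrow> 'b::comm_ring_1"
  shows "dbracket F (dbracket G K) w - dbracket G (dbracket F K) w = dbracket (dbracket F G) K w"
proof -
  have eq: "dbracket A B = (\<lambda>u. dcontract A B u - dcontract B A u)" for A B :: "'a list \<Rightarrow> 'b"
    by (simp add: dbracket_def fun_eq_iff)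
  have 1: "dbracket A (dbracket B C) w =
      dcontract A (dcontract B C) w - dcontract A (dcontract C B) w - dcontract (dbracket B C) A w"
    for A B C :: "'a list \<Rightarrow> 'b"
    unfolding dbracket_def[of A] by (simp add: eq dcontract_diff_right)
  show ?thesis
    unfolding dbracket_swap[of "dbracket F G"] 1
      dcontract_commutator[of F G, symmetric] dcontract_commutator[of G K, symmetric]
      dcontract_commutator[of F K, symmetric]
    by (simp add: algebra_simps)
qed

section \<open>Behaviour under signed reversal\<close>

lemma splits3_rev: "(a, b, c) \<in> splits3 (rev w) \<longleftrightarrow> (rev c, rev b, rev a) \<in> splits3 w"
proof -
  have "a @ b @ c = rev w \<longleftrightarrow> rev (a @ b @ c) = w"
    by (metis rev_rev_ident)
  then show ?thesis
    by (simp add: splits3_def)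
qed

text \<open>Reversal exchanges the first and the last letter of the block. A block and the
  contracted word have \<open>length w + 1\<close> letters together; the extra sign undoes that
  exchange.\<close>

lemma contract_diff_rev:
  assumes "\<And>u. F' (rev u) = (- 1) ^ length u * F u" "\<And>u. G' (rev u) = (- 1) ^ length u * G u"
  shows "contract_diff F' G' (rev w) = (- 1) ^ length w * contract_diff F G w"
proof -
  have "contract_diff F' G' (rev w) = (\<Sum>(a, b, c)\<in>splits3 w.
      F' (rev b) * (G' (rev (a @ last b # c)) - G' (rev (a @ hd b # c))))"
    unfolding contract_diff_def
    by (rule sum.reindex_bij_witness[of _ "\<lambda>(a, b, c). (rev c, rev b, rev a)"
          "\<lambda>(a, b, c). (rev c, rev b, rev a)"])
       (auto simp: splits3_rev hd_rev last_rev)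
  also have "\<dots> = (\<Sum>(a, b, c)\<in>splits3 w.
      (- 1) ^ length w * (F b * (G (a @ hd b # c) - G (a @ last b # c))))"
    by (intro sum.cong refl)
       (auto simp: assms splits3_def power_add algebra_simps simp del: rev_append)
  also have "\<dots> = (- 1) ^ length w * contract_diff F G w"
    by (simp add: contract_diff_def sum_distrib_left case_prod_beta)
  finally show ?thesis .
qed

lemma overlap_letter:
  "overlap F G w = (\<Sum>(p, x, q)\<in>{(p, x, q). p @ x # q = w}. F (p @ [x]) * G (x # q))"
  unfolding overlap_def
  by (rule sum.reindex_bij_witness[of _ "\<lambda>(p, x, q). (p @ [x], q)"
        "\<lambda>(u, v). (butlast u, last u, v)"]) auto

text \<open>A prefix becomes a suffix, so the two functions trade places; the minus sign comes from
  the shared letter, which is counted twice.\<close>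

lemma overlap_rev:
  assumes "\<And>u. F' (rev u) = (- 1) ^ length u * F u" "\<And>u. G' (rev u) = (- 1) ^ length u * G u"
  shows "overlap F' G' (rev w) = - ((- 1) ^ length w * overlap G F w)"
proof -
  have rev_iff: "p @ x # q = rev w \<longleftrightarrow> rev (p @ x # q) = w" for p x q
    by (metis rev_rev_ident)
  have "overlap F' G' (rev w) = (\<Sum>(p, x, q)\<in>{(p, x, q). p @ x # q = w}.
      F' (rev (x # q)) * G' (rev (p @ [x])))"
    unfolding overlap_letter
    by (rule sum.reindex_bij_witness[of _ "\<lambda>(p, x, q). (rev q, x, rev p)"
          "\<lambda>(p, x, q). (rev q, x, rev p)"])
       (auto simp: rev_iff)
  also have "\<dots> = (\<Sum>(p, x, q)\<in>{(p, x, q). p @ x # q = w}.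
      - ((- 1) ^ length w * (G (p @ [x]) * F (x # q))))"
    by (intro sum.cong refl)
       (auto simp: assms power_add algebra_simps simp del: rev.simps rev_append)
  also have "\<dots> = - ((- 1) ^ length w * overlap G F w)"
    by (simp add: overlap_letter sum_distrib_left case_prod_beta sum_negf)
  finally show ?thesis .
qed

text \<open>The two overlap parts are exchanged with a minus sign, and the antisymmetry of the
  bracket absorbs both changes.\<close>

lemma dbracket_rev:
  assumes "\<And>u. F' (rev u) = (- 1) ^ length u * F u" "\<And>u. G' (rev u) = (- 1) ^ length u * G u"
  shows "dbracket F' G' (rev w) = (- 1) ^ length w * dbracket F G w"
  by (simp add: dbracket_def dcontract_def contract_eq_diff_overlap contract_diff_rev[OF assms]
      contract_diff_rev[OF assms(2,1)] overlap_rev[OF assms] overlap_rev[OF assms(2,1)] algebra_simps)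

text \<open>Depth \<open>r\<close> corresponds to \<open>r + 1\<close> letters; a block of depth
  \<open>r\<close> starting at position \<open>i\<close> then matches the summation indices of
  \<open>ari_comp\<close> and \<open>ihara_comp\<close>.\<close>

lemma contract_index:
  assumes "length w = Suc n"
  shows "contract F G w = (\<Sum>r\<le>n. \<Sum>i=0..n - r.
    F (map ((!) w) [i..<i + Suc r]) * (G (map ((!) w) ([0..<Suc i] @ [Suc (i + r)..<Suc n])) -
      (if i = 0 then 0 else G (map ((!) w) ([0..<i] @ [i + r..<Suc n])))))"
proof -
  have map_eq: "map ((!) w) [i..<j] = take (j - i) (drop i w)" if "i \<le> j" "j \<le> length w" for i j
    using that by (intro nth_equalityI) auto
  have "contract F G w = (\<Sum>(r, i)\<in>(SIGMA r:{..n}. {0..n - r}).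
    F (map ((!) w) [i..<i + Suc r]) * (G (map ((!) w) ([0..<Suc i] @ [Suc (i + r)..<Suc n])) -
      (if i = 0 then 0 else G (map ((!) w) ([0..<i] @ [i + r..<Suc n])))))"
    unfolding contract_def
  proof (rule sum.reindex_bij_witness[of _
      "\<lambda>(r, i). (take i w, take (Suc r) (drop i w), drop (Suc (i + r)) w)"
      "\<lambda>(a, b, c). (length b - 1, length a)"])
    fix s assume "s \<in> splits3 w"
    then obtain a b c where s: "s = (a, b, c)" and w: "w = a @ b @ c" and b: "b \<noteq> []"
      by (auto simp: splits3_def)
    obtain x b' where b': "b = x # b'" using b by (cases b) auto
    show "(case (case s of (a, b, c) \<Rightarrow> (length b - 1, length a)) of
        (r, i) \<Rightarrow> (take i w, take (Suc r) (drop i w), drop (Suc (i + r)) w)) = s"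
      using s w b' by simp
    show "(case s of (a, b, c) \<Rightarrow> (length b - 1, length a)) \<in> (SIGMA r:{..n}. {0..n - r})"
      using s w b' assms by auto
    have n: "n = length a + length b' + length c"
      using assms w b' by simp
    have 1: "map ((!) w) [length a..<length a + Suc (length b')] = b"
      using assms w b' by (subst map_eq) auto
    have 2: "map ((!) w) [0..<Suc (length a)] = a @ [x]"
      using assms w b' by (subst map_eq) auto
    have 3: "map ((!) w) [Suc (length a + length b')..<Suc n] = c"
      using assms w b' n by (subst map_eq) auto
    have 4: "map ((!) w) [0..<length a] = a"
      using assms w b' by (subst map_eq) auto
    have 5: "map ((!) w) [length a + length b'..<Suc n] = last b # c"
    proof -
      have "drop (length a + length b') (a @ (butlast b @ [last b]) @ c) = last b # c"
        using b' by (simp del: append_butlast_last_id)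
      then have "drop (length a + length b') w = last b # c"
        using b w by simp
      then show ?thesis
        using assms n by (subst map_eq) auto
    qed
    show "(case case s of (a, b, c) \<Rightarrow> (length b - 1, length a) of (r, i) \<Rightarrow>
      F (map ((!) w) [i..<i + Suc r]) * (G (map ((!) w) ([0..<Suc i] @ [Suc (i + r)..<Suc n])) -
      (if i = 0 then 0 else G (map ((!) w) ([0..<i] @ [i + r..<Suc n]))))) =
      (case s of (a, b, c) \<Rightarrow> F b * (G (a @ hd b # c) - (if a = [] then 0 else G (a @ last b # c))))"
      unfolding s using 1 2 3 4 5 by (simp add: b' del: upt_Suc)
  next
    fix t assume "t \<in> (SIGMA r:{..n}. {0..n - r})"
    then obtain r i where t: "t = (r, i)" "i + r \<le> n" by force
    then show "(case (case t of (r, i) \<Rightarrow> (take i w, take (Suc r) (drop i w), drop (Suc (i + r)) w)) of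
        (a, b, c) \<Rightarrow> (length b - 1, length a)) = t"
      using assms by auto
    have "take i w @ take (Suc r) (drop i w) @ drop (Suc (i + r)) w = w"
      by (metis add.commute add_Suc append_take_drop_id drop_drop)
    then show "(case t of (r, i) \<Rightarrow> (take i w, take (Suc r) (drop i w), drop (Suc (i + r)) w)) \<in> splits3 w"
      using t assms by (auto simp: splits3_def)
  qed
  then show ?thesis
    by (subst (asm) sum.Sigma[symmetric]) auto
qed

section \<open>Moulds as functions on words\<close>

definition ratmoulds :: "mould set" where
  "ratmoulds = {f. \<forall>r. f r \<in> ratfuns r}"

lemma ratmouldsD: "f \<in> ratmoulds \<Longrightarrow> f r \<in> ratfuns r"
  by (simp add: ratmoulds_def)

text \<open>The flag \<open>\<beta>\<close> is the sign of the variables: the reversed blocks in the Ihara product are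
  evaluated at negated variables.\<close>

definition flat_word :: "bool \<Rightarrow> mould \<Rightarrow> nat list \<Rightarrow> ratfun" where
  "flat_word \<beta> f w = (if distinct w then ev (f (length w - 1)) (flat_args \<beta> w) else 0)"

definition sharp_word :: "bool \<Rightarrow> mould \<Rightarrow> nat list \<Rightarrow> ratfun" where
  "sharp_word \<beta> f w = (if distinct w then ev (f (length w - 1)) (sharp_args \<beta> w) else 0)"

lemma flexion_homogeneous:
  assumes "q \<in> homogeneous_ratfuns (length v - 1) e" "distinct v" "set v \<subseteq> {..n}"
  shows "ev q (differences (map xsum v)) \<in> homogeneous_ratfuns n e"
    "ev q (flat_args \<beta> v) \<in> homogeneous_ratfuns n e"
proof -
  have "set (map xsum v) \<subseteq> homogeneous_ratfuns n 1" "set (map (svar \<beta>) v) \<subseteq> homogeneous_ratfuns n 1"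
    using assms(3) by (auto intro: xsum_homogeneous svar_homogeneous)
  then have "set (differences (map xsum v)) \<subseteq> homogeneous_ratfuns n 1"
      "set (flat_args \<beta> v) \<subseteq> homogeneous_ratfuns n 1"
    by (simp_all add: flat_args_def set_differences_homogeneous set_offsets_homogeneous)
  then show "ev q (differences (map xsum v)) \<in> homogeneous_ratfuns n e"
      "ev q (flat_args \<beta> v) \<in> homogeneous_ratfuns n e"
    using assms indep_differences_xsum[of v n] indep_flat_args[of v \<beta>]
    by (auto intro!: homogeneous_ev)
qed

lemma set_flexion_ratfuns:
  assumes "set v \<subseteq> {..n}"
  shows "set (differences (map xsum v)) \<subseteq> ratfuns n" "set (flat_args \<beta> v) \<subseteq> ratfuns n"
    "set (offsets (map xsum v)) \<subseteq> ratfuns n"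
proof -
  have "set (map xsum v) \<subseteq> homogeneous_ratfuns n 1" "set (map (svar \<beta>) v) \<subseteq> homogeneous_ratfuns n 1"
    using assms by (auto intro: xsum_homogeneous svar_homogeneous)
  then have "set (differences (map xsum v)) \<subseteq> homogeneous_ratfuns n 1"
      "set (flat_args \<beta> v) \<subseteq> homogeneous_ratfuns n 1"
      "set (offsets (map xsum v)) \<subseteq> homogeneous_ratfuns n 1"
    by (simp_all add: flat_args_def set_differences_homogeneous set_offsets_homogeneous)
  then show "set (differences (map xsum v)) \<subseteq> ratfuns n" "set (flat_args \<beta> v) \<subseteq> ratfuns n"
    "set (offsets (map xsum v)) \<subseteq> ratfuns n"
    using homogeneous_imp_ratfuns by blast+
qed

lemma flexion_ratfuns:
  assumes "q \<in> ratfuns (length v - 1)" "distinct v" "set v \<subseteq> {..n}"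
  shows "ev q (differences (map xsum v)) \<in> ratfuns n" "ev q (flat_args \<beta> v) \<in> ratfuns n"
  using assms indep_differences_xsum[of v n] indep_flat_args[of v \<beta>] set_flexion_ratfuns[OF assms(3)]
  by (auto intro!: ev_ratfuns)

lemma distinct_map_nth: "distinct w \<Longrightarrow> distinct v \<Longrightarrow> set v \<subseteq> {..<length w} \<Longrightarrow> distinct (map ((!) w) v)"
  by (auto simp: distinct_map inj_on_nth subset_iff)

lemma ev_flexion_sharp:
  assumes "q \<in> ratfuns (length v - 1)" "distinct v" "set v \<subseteq> {..n}" "distinct w" "length w = Suc n"
  shows "ev (ev q (differences (map xsum v))) (sharp_args \<beta> w) = ev q (sharp_args \<beta> (map ((!) w) v))"
proof -
  have "ev (ev q (differences (map xsum v))) (sharp_args \<beta> w) =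
      ev q (map (\<lambda>t. ev t (sharp_args \<beta> w)) (differences (map xsum v)))"
    using assms indep_differences_xsum[of v n] set_flexion_ratfuns[OF assms(3)]
    by (intro ev_ev) (auto simp: indep_sharp_args)
  then show ?thesis
    using assms by (simp add: map_ev_differences_xsum)
qed

lemma ev_flexion_flat:
  assumes "q \<in> ratfuns (length v - 1)" "distinct v" "set v \<subseteq> {..n}" "distinct w" "length w = Suc n"
  shows "ev (ev q (flat_args \<gamma> v)) (flat_args \<beta> w) = ev q (flat_args (\<beta> = \<gamma>) (map ((!) w) v))"
proof -
  have "ev (ev q (flat_args \<gamma> v)) (flat_args \<beta> w) =
      ev q (map (\<lambda>t. ev t (flat_args \<beta> w)) (flat_args \<gamma> v))"
    using assms set_flexion_ratfuns[OF assms(3)]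
    by (intro ev_ev) (auto simp: indep_flat_args)
  then show ?thesis
    using assms by (simp add: map_ev_flat_args)
qed

abbreviation flex_block :: "nat \<Rightarrow> nat \<Rightarrow> nat list" where
  "flex_block i r \<equiv> [i..<i + Suc r]"

abbreviation flex_first :: "nat \<Rightarrow> nat \<Rightarrow> nat \<Rightarrow> nat list" where
  "flex_first i r n \<equiv> [0..<Suc i] @ [Suc (i + r)..<Suc n]"

abbreviation flex_last :: "nat \<Rightarrow> nat \<Rightarrow> nat \<Rightarrow> nat list" where
  "flex_last i r n \<equiv> [0..<i] @ [i + r..<Suc n]"

lemma ari_comp_flex:
  "ari_comp r s a b =
     (\<Sum>i=0..s. ev a (differences (map xsum (flex_block i r))) * ev b (differences (map xsum (flex_first i r (r + s)))))
     - (\<Sum>i=1..s. ev a (differences (map xsum (flex_block i r))) * ev b (differences (map xsum (flex_last i r (r + s)))))"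
  unfolding ari_comp_def
  by (intro arg_cong2[of _ _ _ _ "(-)"] sum.cong refl arg_cong2[of _ _ _ _ "(*)"]
      arg_cong2[of _ _ _ _ ev] Xs_eq_differences ari_args_first ari_args_second) auto

lemma ihara_comp_flex:
  "ihara_comp r s a b =
     (\<Sum>i=0..s. ev a (flat_args True (flex_block i r)) * ev b (flat_args True (flex_first i r (r + s))))
     + (- 1) ^ r *
     (\<Sum>i=1..s. ev a (flat_args False (rev (flex_block i r))) * ev b (flat_args True (flex_last i r (r + s))))"
  unfolding ihara_comp_def
  by (intro arg_cong2[of _ _ _ _ "(+)"] sum.cong refl arg_cong2[of _ _ _ _ "(*)"]
      arg_cong2[of _ _ _ _ ev] ihara_args_block ihara_args_rev_block ihara_args_first
      ihara_args_second) auto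

lemma flex_props:
  assumes "i \<le> s"
  shows "set (flex_block i r) \<subseteq> {..r + s}" "set (flex_first i r (r + s)) \<subseteq> {..r + s}"
    "set (flex_last i r (r + s)) \<subseteq> {..r + s}"
    "length (flex_block i r) - 1 = r" "length (flex_first i r (r + s)) - 1 = s"
    "length (flex_last i r (r + s)) - 1 = s"
    "distinct (flex_block i r)" "distinct (flex_first i r (r + s))" "distinct (flex_last i r (r + s))"
    "set (rev (flex_block i r)) \<subseteq> {..r + s}" "length (rev (flex_block i r)) - 1 = r"
    "distinct (rev (flex_block i r))"
  using assms by auto

lemma flex_homogeneous:
  assumes "i \<le> s"
  shows "a \<in> homogeneous_ratfuns r e \<Longrightarrow> ev a (differences (map xsum (flex_block i r))) \<in> homogeneous_ratfuns (r + s) e"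
    "b \<in> homogeneous_ratfuns s e \<Longrightarrow> ev b (differences (map xsum (flex_first i r (r + s)))) \<in> homogeneous_ratfuns (r + s) e"
    "b \<in> homogeneous_ratfuns s e \<Longrightarrow> ev b (differences (map xsum (flex_last i r (r + s)))) \<in> homogeneous_ratfuns (r + s) e"
    "a \<in> homogeneous_ratfuns r e \<Longrightarrow> ev a (flat_args \<gamma> (flex_block i r)) \<in> homogeneous_ratfuns (r + s) e"
    "a \<in> homogeneous_ratfuns r e \<Longrightarrow> ev a (flat_args \<gamma> (rev (flex_block i r))) \<in> homogeneous_ratfuns (r + s) e"
    "b \<in> homogeneous_ratfuns s e \<Longrightarrow> ev b (flat_args \<gamma> (flex_first i r (r + s))) \<in> homogeneous_ratfuns (r + s) e"
    "b \<in> homogeneous_ratfuns s e \<Longrightarrow> ev b (flat_args \<gamma> (flex_last i r (r + s))) \<in> homogeneous_ratfuns (r + s) e"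
  using flex_props[OF assms, of r] by (intro flexion_homogeneous; simp only:)+

lemma flex_ratfuns:
  assumes "i \<le> s"
  shows "a \<in> ratfuns r \<Longrightarrow> ev a (differences (map xsum (flex_block i r))) \<in> ratfuns (r + s)"
    "b \<in> ratfuns s \<Longrightarrow> ev b (differences (map xsum (flex_first i r (r + s)))) \<in> ratfuns (r + s)"
    "b \<in> ratfuns s \<Longrightarrow> ev b (differences (map xsum (flex_last i r (r + s)))) \<in> ratfuns (r + s)"
    "a \<in> ratfuns r \<Longrightarrow> ev a (flat_args \<gamma> (flex_block i r)) \<in> ratfuns (r + s)"
    "a \<in> ratfuns r \<Longrightarrow> ev a (flat_args \<gamma> (rev (flex_block i r))) \<in> ratfuns (r + s)"
    "b \<in> ratfuns s \<Longrightarrow> ev b (flat_args \<gamma> (flex_first i r (r + s))) \<in> ratfuns (r + s)"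
    "b \<in> ratfuns s \<Longrightarrow> ev b (flat_args \<gamma> (flex_last i r (r + s))) \<in> ratfuns (r + s)"
  using flex_props[OF assms, of r] by (intro flexion_ratfuns; simp only:)+

lemma sign_homogeneous: "(- 1) ^ r \<in> homogeneous_ratfuns n 0"
  using homogeneous_of_rat[of "(- 1) ^ r" n] by (simp add: of_rat_power)

lemma sign_ratfuns: "(- 1) ^ r \<in> ratfuns n"
  using sign_homogeneous homogeneous_imp_ratfuns by blast

lemma ari_comp_homogeneous:
  assumes "a \<in> homogeneous_ratfuns r e" "b \<in> homogeneous_ratfuns s e'"
  shows "ari_comp r s a b \<in> homogeneous_ratfuns (r + s) (e + e')"
  unfolding ari_comp_flex
  by (intro homogeneous_diff homogeneous_sum homogeneous_mult flex_homogeneous assms; simp)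

lemma ihara_comp_homogeneous:
  assumes "a \<in> homogeneous_ratfuns r e" "b \<in> homogeneous_ratfuns s e'"
  shows "ihara_comp r s a b \<in> homogeneous_ratfuns (r + s) (e + e')"
  unfolding ihara_comp_flex
  by (intro homogeneous_add homogeneous_scale[OF _ sign_homogeneous] homogeneous_sum homogeneous_mult
      flex_homogeneous assms; simp)

lemma ari_comp_ratfuns:
  assumes "a \<in> ratfuns r" "b \<in> ratfuns s"
  shows "ari_comp r s a b \<in> ratfuns (r + s)"
  unfolding ari_comp_flex
  by (intro ratfuns_diff ratfuns_sum ratfuns_mult flex_ratfuns assms; simp)

lemma ihara_comp_ratfuns:
  assumes "a \<in> ratfuns r" "b \<in> ratfuns s"
  shows "ihara_comp r s a b \<in> ratfuns (r + s)"
  unfolding ihara_comp_flex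
  by (intro ratfuns_add ratfuns_mult sign_ratfuns ratfuns_sum flex_ratfuns assms; simp)

lemma ari_prod_ratmoulds: "f \<in> ratmoulds \<Longrightarrow> g \<in> ratmoulds \<Longrightarrow> ari_prod f g \<in> ratmoulds"
  unfolding ratmoulds_def ari_prod_def
  using ari_comp_ratfuns[of "f r" r "g (n - r)" "n - r" for n r]
  by (auto intro!: ratfuns_sum) (metis le_add_diff_inverse)

lemma ihara_prod_ratmoulds: "f \<in> ratmoulds \<Longrightarrow> g \<in> ratmoulds \<Longrightarrow> ihara_prod f g \<in> ratmoulds"
  unfolding ratmoulds_def ihara_prod_def
  using ihara_comp_ratfuns[of "f r" r "g (n - r)" "n - r" for n r]
  by (auto intro!: ratfuns_sum) (metis le_add_diff_inverse)

lemma ari_bracket_ratmoulds: "f \<in> ratmoulds \<Longrightarrow> g \<in> ratmoulds \<Longrightarrow> ari_bracket f g \<in> ratmoulds"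
  using ari_prod_ratmoulds[of f g] ari_prod_ratmoulds[of g f]
  by (auto simp: ratmoulds_def ari_bracket_def)

lemma ihara_bracket_ratmoulds:
  "f \<in> ratmoulds \<Longrightarrow> g \<in> ratmoulds \<Longrightarrow> ihara_bracket f g \<in> ratmoulds"
  using ihara_prod_ratmoulds[of f g] ihara_prod_ratmoulds[of g f]
  by (auto simp: ratmoulds_def ihara_bracket_def)

lemma ev_sum_mult:
  assumes "indep ts" "length ts = n"
    and "\<And>i. i \<in> A \<Longrightarrow> f i \<in> ratfuns n" "\<And>i. i \<in> A \<Longrightarrow> g i \<in> ratfuns n"
  shows "ev (\<Sum>i\<in>A. f i * g i) ts = (\<Sum>i\<in>A. ev (f i) ts * ev (g i) ts)"
proof -
  have "ev (\<Sum>i\<in>A. f i * g i) ts = (\<Sum>i\<in>A. ev (f i * g i) ts)"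
    by (intro ev_sum[OF assms(1,2)] ratfuns_mult assms(3,4))
  then show ?thesis
    by (simp add: ev_mult[OF assms(1,2) assms(3,4)])
qed

lemma ev_ari_comp:
  assumes "a \<in> ratfuns r" "b \<in> ratfuns s" "distinct w" "length w = Suc (r + s)"
  shows "ev (ari_comp r s a b) (sharp_args \<beta> w) =
    (\<Sum>i=0..s. ev a (sharp_args \<beta> (map ((!) w) (flex_block i r))) *
      (ev b (sharp_args \<beta> (map ((!) w) (flex_first i r (r + s)))) -
       (if i = 0 then 0 else ev b (sharp_args \<beta> (map ((!) w) (flex_last i r (r + s)))))))"
    (is "_ = (\<Sum>i=0..s. ?A i * (?B i - (if i = 0 then 0 else ?C i)))")
proof -
  let ?a = "\<lambda>i. ev a (differences (map xsum (flex_block i r)))"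
  let ?b = "\<lambda>i. ev b (differences (map xsum (flex_first i r (r + s))))"
  let ?c = "\<lambda>i. ev b (differences (map xsum (flex_last i r (r + s))))"
  have mem: "?a i \<in> ratfuns (r + s)" "?b i \<in> ratfuns (r + s)" "?c i \<in> ratfuns (r + s)" if "i \<le> s" for i
    by (rule flex_ratfuns[OF that]; rule assms)+
  have ev: "ev (?a i) (sharp_args \<beta> w) = ?A i" "ev (?b i) (sharp_args \<beta> w) = ?B i"
    "ev (?c i) (sharp_args \<beta> w) = ?C i" if "i \<le> s" for i
    using that assms flex_props[OF that, of r] by (intro ev_flexion_sharp; simp only:)+
  have ind: "indep (sharp_args \<beta> w)" "length (sharp_args \<beta> w) = r + s"
    using assms by (auto intro: indep_sharp_args)
  have "ev (ari_comp r s a b) (sharp_args \<beta> w) =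
      ev (\<Sum>i=0..s. ?a i * ?b i) (sharp_args \<beta> w) - ev (\<Sum>i=1..s. ?a i * ?c i) (sharp_args \<beta> w)"
    unfolding ari_comp_flex by (intro ev_diff[OF ind] ratfuns_sum ratfuns_mult mem) simp_all
  also have "ev (\<Sum>i=0..s. ?a i * ?b i) (sharp_args \<beta> w) = (\<Sum>i=0..s. ?A i * ?B i)"
    using ev by (subst ev_sum_mult[OF ind mem(1,2)]) (simp_all del: upt_Suc)
  also have "ev (\<Sum>i=1..s. ?a i * ?c i) (sharp_args \<beta> w) = (\<Sum>i=1..s. ?A i * ?C i)"
    using ev by (subst ev_sum_mult[OF ind mem(1,3)]) (simp_all del: upt_Suc)
  \<comment> \<open>The zero summand at \<open>i = 0\<close> reproduces the case distinction of
    \<open>contract\<close>.\<close>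
  also have "(\<Sum>i=1..s. ?A i * ?C i) = (\<Sum>i=0..s. if i = 0 then 0 else ?A i * ?C i)"
    by (simp add: sum.atLeast_Suc_atMost)
  also have "(\<Sum>i=0..s. ?A i * ?B i) - (\<Sum>i=0..s. if i = 0 then 0 else ?A i * ?C i) =
      (\<Sum>i=0..s. ?A i * (?B i - (if i = 0 then 0 else ?C i)))"
    unfolding sum_subtractf[symmetric] by (intro sum.cong refl) (simp add: right_diff_distrib)
  finally show ?thesis .
qed

lemma ev_ihara_comp:
  assumes "a \<in> ratfuns r" "b \<in> ratfuns s" "distinct w" "length w = Suc (r + s)"
  shows "ev (ihara_comp r s a b) (flat_args \<beta> w) =
    (\<Sum>i=0..s. ev a (flat_args \<beta> (map ((!) w) (flex_block i r))) *
      ev b (flat_args \<beta> (map ((!) w) (flex_first i r (r + s)))) +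
       (if i = 0 then 0 else (- 1) ^ r * ev a (flat_args (\<not> \<beta>) (rev (map ((!) w) (flex_block i r)))) *
         ev b (flat_args \<beta> (map ((!) w) (flex_last i r (r + s))))))"
    (is "_ = (\<Sum>i=0..s. ?A i * ?B i + (if i = 0 then 0 else (- 1) ^ r * ?A' i * ?C i))")
proof -
  let ?a = "\<lambda>i. ev a (flat_args True (flex_block i r))"
  let ?a' = "\<lambda>i. ev a (flat_args False (rev (flex_block i r)))"
  let ?b = "\<lambda>i. ev b (flat_args True (flex_first i r (r + s)))"
  let ?c = "\<lambda>i. ev b (flat_args True (flex_last i r (r + s)))"
  have mem: "?a i \<in> ratfuns (r + s)" "?a' i \<in> ratfuns (r + s)" "?b i \<in> ratfuns (r + s)"
    "?c i \<in> ratfuns (r + s)" if "i \<le> s" for i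
    by (rule flex_ratfuns[OF that]; rule assms)+
  have "ev (?a i) (flat_args \<beta> w) = ev a (flat_args (\<beta> = True) (map ((!) w) (flex_block i r)))"
    "ev (?a' i) (flat_args \<beta> w) = ev a (flat_args (\<beta> = False) (map ((!) w) (rev (flex_block i r))))"
    "ev (?b i) (flat_args \<beta> w) = ev b (flat_args (\<beta> = True) (map ((!) w) (flex_first i r (r + s))))"
    "ev (?c i) (flat_args \<beta> w) = ev b (flat_args (\<beta> = True) (map ((!) w) (flex_last i r (r + s))))"
    if "i \<le> s" for i
    using that assms flex_props[OF that, of r] by (intro ev_flexion_flat; simp only:)+
  then have ev: "ev (?a i) (flat_args \<beta> w) = ?A i" "ev (?a' i) (flat_args \<beta> w) = ?A' i"
    "ev (?b i) (flat_args \<beta> w) = ?B i" "ev (?c i) (flat_args \<beta> w) = ?C i" if "i \<le> s" for i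
    using that by (simp_all add: rev_map del: upt_Suc)
  have ind: "indep (flat_args \<beta> w)" "length (flat_args \<beta> w) = r + s"
    using assms by (auto intro: indep_flat_args)
  have "ev (- 1) (flat_args \<beta> w) = - 1"
    by (subst ev_uminus[OF ind]) auto
  then have sgn: "ev ((- 1) ^ r) (flat_args \<beta> w) = (- 1) ^ r"
    by (subst ev_power[OF ind]) auto
  have "(\<Sum>i=1..s. ?a' i * ?c i) \<in> ratfuns (r + s)"
    by (intro ratfuns_sum ratfuns_mult mem) simp_all
  note scaled = ev_mult[OF ind sign_ratfuns this, of r, unfolded sgn]
  have "ev (ihara_comp r s a b) (flat_args \<beta> w) =
      ev (\<Sum>i=0..s. ?a i * ?b i) (flat_args \<beta> w) +
      ev ((- 1) ^ r * (\<Sum>i=1..s. ?a' i * ?c i)) (flat_args \<beta> w)"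
    unfolding ihara_comp_flex by (intro ev_add[OF ind] ratfuns_sum ratfuns_mult mem sign_ratfuns) simp_all
  also have "ev (\<Sum>i=0..s. ?a i * ?b i) (flat_args \<beta> w) = (\<Sum>i=0..s. ?A i * ?B i)"
    using ev by (subst ev_sum_mult[OF ind mem(1,3)]) (simp_all del: upt_Suc)
  also have "ev ((- 1) ^ r * (\<Sum>i=1..s. ?a' i * ?c i)) (flat_args \<beta> w) =
      (- 1) ^ r * ev (\<Sum>i=1..s. ?a' i * ?c i) (flat_args \<beta> w)"
    by (rule scaled)
  also have "ev (\<Sum>i=1..s. ?a' i * ?c i) (flat_args \<beta> w) = (\<Sum>i=1..s. ?A' i * ?C i)"
    using ev by (subst ev_sum_mult[OF ind mem(2,4)]) (simp_all del: upt_Suc)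
  also have "(\<Sum>i=1..s. ?A' i * ?C i) = (\<Sum>i=0..s. if i = 0 then 0 else ?A' i * ?C i)"
    by (simp add: sum.atLeast_Suc_atMost)
  also have "(\<Sum>i=0..s. ?A i * ?B i) + (- 1) ^ r * (\<Sum>i=0..s. if i = 0 then 0 else ?A' i * ?C i) =
      (\<Sum>i=0..s. ?A i * ?B i + (if i = 0 then 0 else (- 1) ^ r * ?A' i * ?C i))"
    unfolding sum_distrib_left sum.distrib[symmetric] by (intro sum.cong refl) (simp add: mult.assoc)
  finally show ?thesis .
qed

text \<open>Evaluated at a word, each flexion selects letters, which gives the summands of
  \<open>contract_index\<close>. At the empty word the truncated \<open>length w - 1\<close> reads
  depth 0, where the vanishing components make both sides 0.\<close>

lemma sharp_word_ari_prod:
  assumes "f \<in> ratmoulds" "g \<in> ratmoulds" "f 0 = 0" "g 0 = 0"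
  shows "sharp_word \<beta> (ari_prod f g) = dcontract (sharp_word \<beta> f) (sharp_word \<beta> g)"
proof
  fix w :: "nat list"
  consider "\<not> distinct w" | "w = []" | "distinct w" "w \<noteq> []" by blast
  then show "sharp_word \<beta> (ari_prod f g) w = dcontract (sharp_word \<beta> f) (sharp_word \<beta> g) w"
  proof cases
    case 3
    define n where "n = length w - 1"
    have n: "length w = Suc n" using 3 by (cases w) (auto simp: n_def)
    have mem: "f r \<in> ratfuns r" "g r \<in> ratfuns r" for r
      using assms by (auto dest: ratmouldsD)
    have comp: "ari_comp r (n - r) (f r) (g (n - r)) \<in> ratfuns n" if "r \<le> n" for r
      using ari_comp_ratfuns[OF mem, of r "n - r"] that by simp
    have "sharp_word \<beta> (ari_prod f g) w = (\<Sum>r\<le>n. ev (ari_comp r (n - r) (f r) (g (n - r))) (sharp_args \<beta> w))"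
      unfolding sharp_word_def ari_prod_def using 3 n comp
      by (simp, intro ev_sum[OF indep_sharp_args[OF 3(1)]]) auto
    also have "\<dots> = contract (sharp_word \<beta> f) (sharp_word \<beta> g) w"
      unfolding contract_index[OF n]
    proof (intro sum.cong refl)
      fix r assume "r \<in> {..n}"
      then have r: "r \<le> n" by simp
      show "ev (ari_comp r (n - r) (f r) (g (n - r))) (sharp_args \<beta> w) =
        (\<Sum>i = 0..n - r. sharp_word \<beta> f (map ((!) w) (flex_block i r)) *
          (sharp_word \<beta> g (map ((!) w) (flex_first i r n)) -
            (if i = 0 then 0 else sharp_word \<beta> g (map ((!) w) (flex_last i r n)))))"
      proof (subst ev_ari_comp)
        have d: "distinct (map ((!) w) (flex_block i r))" "distinct (map ((!) w) (flex_first i r n))"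
          "distinct (map ((!) w) (flex_last i r n))" if "i \<le> n - r" for i
          by (intro distinct_map_nth 3; use r n that in auto)+
        have l: "length (flex_first i r n) = Suc (n - r)" "length (flex_last i r n) = Suc (n - r)"
          if "i \<le> n - r" for i using that r by auto
        show "(\<Sum>i = 0..n - r. ev (f r) (sharp_args \<beta> (map ((!) w) (flex_block i r))) *
          (ev (g (n - r)) (sharp_args \<beta> (map ((!) w) (flex_first i r (r + (n - r))))) -
            (if i = 0 then 0 else ev (g (n - r)) (sharp_args \<beta> (map ((!) w) (flex_last i r (r + (n - r)))))))) =
          (\<Sum>i = 0..n - r. sharp_word \<beta> f (map ((!) w) (flex_block i r)) *
          (sharp_word \<beta> g (map ((!) w) (flex_first i r n)) -
            (if i = 0 then 0 else sharp_word \<beta> g (map ((!) w) (flex_last i r n)))))"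
          unfolding sharp_word_def length_map using r d l
          by (intro sum.cong refl) (auto simp del: upt_Suc map_append length_append)
      qed (use mem 3 n r in auto)
    qed
    finally show ?thesis using 3 by (simp add: dcontract_def)
  qed (auto simp: sharp_word_def dcontract_def ari_prod_def ari_comp_def assms)
qed

text \<open>This is what makes the reversed terms of the Ihara product agree with the corresponding terms of
  the ari product.\<close>

definition mantar_invariant :: "mould \<Rightarrow> bool" where
  "mantar_invariant f \<longleftrightarrow> (\<forall>\<beta> w. flat_word (\<not> \<beta>) f (rev w) = (- 1) ^ length w * flat_word \<beta> f w)"

lemma flat_word_ihara_prod:
  assumes "f \<in> ratmoulds" "g \<in> ratmoulds" "f 0 = 0" "g 0 = 0" "mantar_invariant f"
  shows "flat_word \<beta> (ihara_prod f g) = dcontract (flat_word \<beta> f) (flat_word \<beta> g)"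
proof
  fix w :: "nat list"
  consider "\<not> distinct w" | "w = []" | "distinct w" "w \<noteq> []" by blast
  then show "flat_word \<beta> (ihara_prod f g) w = dcontract (flat_word \<beta> f) (flat_word \<beta> g) w"
  proof cases
    case 3
    define n where "n = length w - 1"
    have n: "length w = Suc n" using 3 by (cases w) (auto simp: n_def)
    have mem: "f r \<in> ratfuns r" "g r \<in> ratfuns r" for r
      using assms by (auto dest: ratmouldsD)
    have comp: "ihara_comp r (n - r) (f r) (g (n - r)) \<in> ratfuns n" if "r \<le> n" for r
      using ihara_comp_ratfuns[OF mem, of r "n - r"] that by simp
    have "flat_word \<beta> (ihara_prod f g) w = (\<Sum>r\<le>n. ev (ihara_comp r (n - r) (f r) (g (n - r))) (flat_args \<beta> w))"
      unfolding flat_word_def ihara_prod_def using 3 n comp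
      by (simp, intro ev_sum[OF indep_flat_args[OF 3(1)]]) auto
    also have "\<dots> = contract (flat_word \<beta> f) (flat_word \<beta> g) w"
      unfolding contract_index[OF n]
    proof (intro sum.cong refl)
      fix r assume "r \<in> {..n}"
      then have r: "r \<le> n" by simp
      show "ev (ihara_comp r (n - r) (f r) (g (n - r))) (flat_args \<beta> w) =
        (\<Sum>i = 0..n - r. flat_word \<beta> f (map ((!) w) (flex_block i r)) *
          (flat_word \<beta> g (map ((!) w) (flex_first i r n)) -
            (if i = 0 then 0 else flat_word \<beta> g (map ((!) w) (flex_last i r n)))))"
      proof (subst ev_ihara_comp)
        have d: "distinct (map ((!) w) (flex_block i r))" "distinct (map ((!) w) (flex_first i r n))"
          "distinct (map ((!) w) (flex_last i r n))" if "i \<le> n - r" for i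
          by (intro distinct_map_nth 3; use r n that in auto)+
        have l: "length (flex_first i r n) = Suc (n - r)" "length (flex_last i r n) = Suc (n - r)"
          if "i \<le> n - r" for i using that r by auto
        \<comment> \<open>The block has \<open>r + 1\<close> letters, so reversal costs the sign
          \<open>(- 1) ^ (r + 1)\<close>; with the \<open>(- 1) ^ r\<close> of the product there
          remains the minus sign of a contraction to the last letter.\<close>
        have "ev (f r) (flat_args (\<not> \<beta>) (rev (map ((!) w) (flex_block i r)))) =
          - ((- 1) ^ r * ev (f r) (flat_args \<beta> (map ((!) w) (flex_block i r))))" if "i \<le> n - r" for i
          using assms(5)[unfolded mantar_invariant_def, rule_format, of \<beta> "map ((!) w) (flex_block i r)"]
            d(1)[OF that] by (simp add: flat_word_def del: upt_Suc)
        then have rev: "(- 1) ^ r * ev (f r) (flat_args (\<not> \<beta>) (rev (map ((!) w) (flex_block i r)))) =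
          - ev (f r) (flat_args \<beta> (map ((!) w) (flex_block i r)))" if "i \<le> n - r" for i
          using that by (simp flip: mult.assoc power_add del: upt_Suc)
        show "(\<Sum>i=0..n - r. ev (f r) (flat_args \<beta> (map ((!) w) (flex_block i r))) *
            ev (g (n - r)) (flat_args \<beta> (map ((!) w) (flex_first i r (r + (n - r))))) +
            (if i = 0 then 0 else (- 1) ^ r * ev (f r) (flat_args (\<not> \<beta>) (rev (map ((!) w) (flex_block i r)))) *
              ev (g (n - r)) (flat_args \<beta> (map ((!) w) (flex_last i r (r + (n - r))))))) =
          (\<Sum>i = 0..n - r. flat_word \<beta> f (map ((!) w) (flex_block i r)) *
          (flat_word \<beta> g (map ((!) w) (flex_first i r n)) -
            (if i = 0 then 0 else flat_word \<beta> g (map ((!) w) (flex_last i r n)))))"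
          unfolding flat_word_def length_map using r d l rev
          by (intro sum.cong refl) (auto simp: right_diff_distrib simp del: upt_Suc map_append length_append)
      qed (use mem 3 n r in auto)
    qed
    finally show ?thesis using 3 by (simp add: dcontract_def)
  qed (auto simp: flat_word_def dcontract_def ihara_prod_def ihara_comp_def assms)
qed

lemma flat_word_diff:
  assumes "f \<in> ratmoulds" "g \<in> ratmoulds"
  shows "flat_word \<beta> (\<lambda>n. f n - g n) w = flat_word \<beta> f w - flat_word \<beta> g w"
proof (cases "distinct w")
  case True
  show ?thesis
    using ev_diff[OF indep_flat_args[OF True] refl] assms True ratmouldsD
    by (simp add: flat_word_def)
qed (simp add: flat_word_def)

lemma sharp_word_diff:
  assumes "f \<in> ratmoulds" "g \<in> ratmoulds"
  shows "sharp_word \<beta> (\<lambda>n. f n - g n) w = sharp_word \<beta> f w - sharp_word \<beta> g w"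
proof (cases "distinct w")
  case True
  show ?thesis
    using ev_diff[OF indep_sharp_args[OF True] refl] assms True ratmouldsD
    by (simp add: sharp_word_def)
qed (simp add: sharp_word_def)

lemma sharp_word_ari_bracket:
  assumes "f \<in> ratmoulds" "g \<in> ratmoulds" "f 0 = 0" "g 0 = 0"
  shows "sharp_word \<beta> (ari_bracket f g) = dbracket (sharp_word \<beta> f) (sharp_word \<beta> g)"
proof -
  have eq: "ari_bracket f g = (\<lambda>n. ari_prod f g n - ari_prod g f n)"
    by (simp add: ari_bracket_def fun_eq_iff)
  have "sharp_word \<beta> (ari_bracket f g) = (\<lambda>w. sharp_word \<beta> (ari_prod f g) w - sharp_word \<beta> (ari_prod g f) w)"
    unfolding eq by (rule ext, rule sharp_word_diff) (intro ari_prod_ratmoulds assms)+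
  then show ?thesis
    using assms by (simp add: fun_eq_iff sharp_word_ari_prod dbracket_def)
qed

lemma flat_word_ihara_bracket:
  assumes "f \<in> ratmoulds" "g \<in> ratmoulds" "f 0 = 0" "g 0 = 0" "mantar_invariant f" "mantar_invariant g"
  shows "flat_word \<beta> (ihara_bracket f g) = dbracket (flat_word \<beta> f) (flat_word \<beta> g)"
proof -
  have eq: "ihara_bracket f g = (\<lambda>n. ihara_prod f g n - ihara_prod g f n)"
    by (simp add: ihara_bracket_def fun_eq_iff)
  have "flat_word \<beta> (ihara_bracket f g) = (\<lambda>w. flat_word \<beta> (ihara_prod f g) w - flat_word \<beta> (ihara_prod g f) w)"
    unfolding eq by (rule ext, rule flat_word_diff) (intro ihara_prod_ratmoulds assms)+
  then show ?thesis
    using assms by (simp add: fun_eq_iff flat_word_ihara_prod dbracket_def)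
qed

text \<open>The word 0, ..., n stands for the points x_0 = 0, x_1, ..., x_n, so the value there is
  the component of depth n in the original variables.\<close>

lemma flat_eq_sharp_word: "flat g n = sharp_word True g [0..<Suc n]"
proof -
  have "map (\<lambda>j. xvar j - xvar (j - 1)) [1..<Suc n] = sharp_args True [0..<Suc n]"
    by (rule nth_equalityI) (auto simp: sharp_args_def svar_def simp del: upt_Suc)
  then show ?thesis
    by (simp add: flat_def sharp_word_def del: upt_Suc)
qed

lemma flat_word_upt:
  assumes "f \<in> ratmoulds"
  shows "flat_word True f [0..<Suc n] = f n"
proof -
  have "flat_args True [0..<Suc n] = map xvar [1..<Suc n]"
    by (rule nth_equalityI) (auto simp: flat_args_def svar_def simp del: upt_Suc)
  then show ?thesis
    using ev_xvars[OF ratmouldsD[OF assms, of n]] by (simp add: flat_word_def del: upt_Suc)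
qed

lemma sharp_args_xsum: "map (\<lambda>j. \<Sum>k=1..j. xvar k) [1..<Suc r] = offsets (map xsum [0..<Suc r])"
  by (rule nth_equalityI) (auto simp: xsum_def simp del: upt_Suc)

lemma sharp_ratmoulds: "f \<in> ratmoulds \<Longrightarrow> sharp f \<in> ratmoulds"
  unfolding ratmoulds_def sharp_def sharp_args_xsum
proof (intro CollectI allI ev_ratfuns)
  fix r
  show "indep (offsets (map xsum [0..<Suc r]))"
    by (rule indep_offsets_xsum[of _ r]) auto
  show "set (offsets (map xsum [0..<Suc r])) \<subseteq> ratfuns r"
    by (rule set_flexion_ratfuns) auto
qed simp

text \<open>Partial sums of consecutive differences are distances from the first point. So
  \<open>sharp f\<close> for the ari bracket and \<open>f\<close> for the Ihara bracket give one
  function on words.\<close>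

lemma sharp_word_sharp:
  assumes "f \<in> ratmoulds"
  shows "sharp_word \<beta> (sharp f) = flat_word \<beta> f"
proof
  fix w :: "nat list"
  consider "\<not> distinct w" | "w = []" | "distinct w" "w \<noteq> []" by blast
  then show "sharp_word \<beta> (sharp f) w = flat_word \<beta> f w"
  proof cases
    case 3
    define n where "n = length w - 1"
    have n: "length w = Suc n" using 3 by (cases w) (auto simp: n_def)
    have "ev (sharp f n) (sharp_args \<beta> w) =
        ev (f n) (map (\<lambda>t. ev t (sharp_args \<beta> w)) (offsets (map xsum [0..<Suc n])))"
      unfolding sharp_def sharp_args_xsum
    proof (rule ev_ev)
      show "indep (offsets (map xsum [0..<Suc n]))"
        by (rule indep_offsets_xsum[of _ n]) auto
      show "set (offsets (map xsum [0..<Suc n])) \<subseteq> ratfuns (length (sharp_args \<beta> w))"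
        unfolding length_sharp_args n diff_Suc_1 by (rule set_flexion_ratfuns) auto
    qed (use 3 assms in \<open>auto intro: indep_sharp_args dest: ratmouldsD simp del: upt_Suc\<close>)
    also have "\<dots> = ev (f n) (flat_args \<beta> (map ((!) w) [0..<Suc n]))"
      using 3 n by (subst map_ev_offsets_xsum[of _ n]) auto
    also have "map ((!) w) [0..<Suc n] = w"
      using n by (metis map_nth)
    finally show ?thesis
      using 3 n by (simp add: flat_word_def sharp_word_def)
  next
    case 2
    then show ?thesis
      using ev_xvars[OF ratmouldsD[OF assms, of 0]]
      by (simp add: flat_word_def sharp_word_def sharp_def flat_args_def sharp_args_def offsets_def differences_def)
  qed (auto simp: flat_word_def sharp_word_def)
qed

section \<open>Alternality and reversal\<close>

lemma mset_shuffle_product: "w \<in># shuffle_product u v \<Longrightarrow> mset w = mset u + mset v"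
  by (induction u v arbitrary: w rule: shuffle_product.induct) auto

lemma shuffle_product_map:
  "shuffle_product (map h u) (map h v) = image_mset (map h) (shuffle_product u v)"
  by (induction u v rule: shuffle_product.induct) (auto simp: multiset.map_comp comp_def)

lemma shuffle_product_Nil2 [simp]: "shuffle_product u [] = {#u#}"
  by (cases u) auto

text \<open>The antipode identity \<open>\<Sum>\<^sub>i (-1)\<^sup>i rev(x\<^sub>1\<dots>x\<^sub>i) \<squnion> x\<^sub>i\<^sub>+\<^sub>1\<dots>x\<^sub>r = 0\<close> of the shuffle algebra, in
  telescoped form.\<close>

lemma shuffle_antipode:
  fixes A :: "nat list \<Rightarrow> 'b::comm_ring_1"
  assumes "x \<noteq> []"
    and "\<And>i. 1 \<le> i \<Longrightarrow> i < length x \<Longrightarrow> (\<Sum>w\<in>#shuffle_product (rev (take i x)) (drop i x). A w) = 0"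
  shows "A (rev x) = (- 1) ^ (length x - 1) * A x"
proof -
  define P where "P k = (\<Sum>w\<in>#shuffle_product (rev (take k x)) (drop (Suc k) x). A (x ! k # w))" for k
  have "P k = (- 1) ^ k * A x" if "k < length x" for k
    using that
  proof (induction k)
    case 0
    then show ?case
      using assms(1) by (cases x) (auto simp: P_def)
  next
    case (Suc k)
    have rev: "rev (take (Suc k) x) = x ! k # rev (take k x)"
      using Suc.prems by (simp add: take_Suc_conv_app_nth)
    have drop: "drop (Suc k) x = x ! Suc k # drop (Suc (Suc k)) x"
      using Suc.prems by (simp add: Cons_nth_drop_Suc)
    have "0 = (\<Sum>w\<in>#shuffle_product (rev (take (Suc k) x)) (drop (Suc k) x). A w)"
      using Suc.prems by (intro assms(2)[symmetric]) auto
    \<comment> \<open>A shuffle of the two words starts with \<open>x ! k\<close> or with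
      \<open>x ! Suc k\<close>; the two cases are \<open>P k\<close> and
      \<open>P (Suc k)\<close>.\<close>
    also have "\<dots> = P k + P (Suc k)"
      unfolding P_def rev drop by (simp add: multiset.map_comp comp_def)
    finally have "P (Suc k) = - P k"
      by (simp add: add_eq_0_iff2)
    then show ?case
      using Suc by simp
  qed
  from this[of "length x - 1"] have "P (length x - 1) = (- 1) ^ (length x - 1) * A x"
    using assms(1) by simp
  moreover have "P (length x - 1) = A (rev x)"
  proof -
    obtain y a where "x = y @ [a]"
      using assms(1) by (cases x rule: rev_exhaust) auto
    then show ?thesis
      by (simp add: P_def)
  qed
  ultimately show ?thesis by simp
qed

lemma Q_ratmoulds: "f \<in> \<Q> \<Longrightarrow> f \<in> ratmoulds"
  unfolding \<Q>_def \<Q>_weight_def ratmoulds_def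
  by (auto intro!: ratfuns_sum) (blast intro: homogeneous_imp_ratfuns)

lemma indep_xvars:
  assumes "distinct v" "0 \<notin> set v"
  shows "indep (map xvar v)"
proof -
  have "map xvar v = flat_args True (0 # v)"
    by (simp add: flat_args_def offsets_def svar_def)
  then show ?thesis
    using assms indep_flat_args[of "0 # v"] by simp
qed

text \<open>The relation is an identity of rational functions and may be evaluated at the permuted
  variables \<open>v\<close>. The antipode argument calls for this because the words it shuffles
  include a reversed prefix.\<close>

lemma alternal_relation:
  assumes g: "g \<in> ratfuns r"
    and rel: "(\<Sum>w\<in>#shuffle_product [1..<Suc i] [Suc i..<Suc r]. ev g (map xvar w)) = 0"
    and v: "distinct v" "set v = {1..r}" "1 \<le> i" "i < r"
  shows "(\<Sum>w\<in>#shuffle_product (take i v) (drop i v). ev g (map xvar w)) = 0"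
proof -
  define h where "h j = v ! (j - 1)" for j
  have len: "length v = r"
    using v distinct_card[of v] by simp
  have ind: "indep (map xvar v)"
    using v by (intro indep_xvars) auto
  have take: "take i v = map h [1..<Suc i]" and drop: "drop i v = map h [Suc i..<Suc r]"
    using v len by (auto intro!: nth_equalityI simp: h_def simp del: upt_Suc)
  have w: "distinct w \<and> set w = {1..r} \<and> length w = r"
    if "w \<in># shuffle_product [1..<Suc i] [Suc i..<Suc r]" for w
  proof -
    have "mset w = mset ([1..<Suc i] @ [Suc i..<Suc r])"
      using mset_shuffle_product[OF that] by simp
    also have "[1..<Suc i] @ [Suc i..<Suc r] = [1..<Suc r]"
      using v upt_add_eq_append[of 1 "Suc i" "r - i"] by (simp del: upt_Suc)
    finally have *: "mset w = mset [1..<Suc r]" .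
    have "set w = {1..<Suc r}"
      using mset_eq_setD[OF *] by (simp only: set_upt)
    moreover have "distinct w"
      using mset_eq_imp_distinct_iff[OF *] by (simp only: distinct_upt)
    moreover have "length w = r"
      using mset_eq_length[OF *] by (simp only: length_upt diff_Suc_1)
    ultimately show ?thesis
      unfolding atLeastLessThanSuc_atLeastAtMost by blast
  qed
  have tm: "ev g (map xvar w) \<in> ratfuns r"
    "ev (ev g (map xvar w)) (map xvar v) = ev g (map xvar (map h w))"
    if "w \<in># shuffle_product [1..<Suc i] [Suc i..<Suc r]" for w
  proof -
    have sub: "set (map xvar w) \<subseteq> ratfuns r" using w[OF that] by auto
    have indw: "indep (map xvar w)" using w[OF that] by (intro indep_xvars) auto
    show "ev g (map xvar w) \<in> ratfuns r"
      using g sub indw w[OF that] by (intro ev_ratfuns) auto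
    have "ev (ev g (map xvar w)) (map xvar v) = ev g (map (\<lambda>t. ev t (map xvar v)) (map xvar w))"
      using g sub indw ind len w[OF that] by (intro ev_ev) auto
    also have "map (\<lambda>t. ev t (map xvar v)) (map xvar w) = map xvar (map h w)"
      using w[OF that] len by (auto simp: h_def ev_xvar[OF ind])
    finally show "ev (ev g (map xvar w)) (map xvar v) = ev g (map xvar (map h w))" .
  qed
  have ev_msum: "ev (\<Sum>w\<in>#M. F w) (map xvar v) = (\<Sum>w\<in>#M. ev (F w) (map xvar v)) \<and> (\<Sum>w\<in>#M. F w) \<in> ratfuns r"
    if "\<And>w. w \<in># M \<Longrightarrow> F w \<in> ratfuns r" for F :: "nat list \<Rightarrow> ratfun" and M
    using that by (induction M) (auto simp: ev_add[OF ind] len)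
  let ?M = "shuffle_product [1..<Suc i] [Suc i..<Suc r]"
  have "(\<Sum>w\<in>#shuffle_product (take i v) (drop i v). ev g (map xvar w)) =
      (\<Sum>w\<in>#?M. ev g (map xvar (map h w)))"
    unfolding take drop shuffle_product_map by (simp add: multiset.map_comp comp_def)
  also have "\<dots> = (\<Sum>w\<in>#?M. ev (ev g (map xvar w)) (map xvar v))"
    using tm(2) by (intro arg_cong[of _ _ sum_mset] image_mset_cong) simp
  also have "\<dots> = ev (\<Sum>w\<in>#?M. ev g (map xvar w)) (map xvar v)"
    using ev_msum[of ?M "\<lambda>w. ev g (map xvar w)"] tm(1) by simp
  also have "\<dots> = 0"
    unfolding rel by simp
  finally show ?thesis .
qed

text \<open>The antipode identity for the word 1, ..., r; each relation it uses is a permuted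
  alternality relation.\<close>

lemma alternal_rev:
  assumes g: "g \<in> ratfuns r" and "r \<ge> 1"
    and rel: "\<And>i. 1 \<le> i \<Longrightarrow> i < r \<Longrightarrow>
      (\<Sum>w\<in>#shuffle_product [1..<Suc i] [Suc i..<Suc r]. ev g (map xvar w)) = 0"
  shows "ev g (map xvar (rev [1..<Suc r])) = (- 1) ^ (r - 1) * g"
proof -
  let ?x = "[1..<Suc r]"
  have "ev g (map xvar (rev ?x)) = (- 1) ^ (length ?x - 1) * ev g (map xvar ?x)"
  proof (rule shuffle_antipode)
    fix i assume i: "1 \<le> i" "i < length ?x"
    let ?v = "rev (take i ?x) @ drop i ?x"
    have "set ?v = set (take i ?x) \<union> set (drop i ?x)" by (simp only: set_append set_rev)
    also have "\<dots> = set (take i ?x @ drop i ?x)" by (rule set_append[symmetric])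
    also have "\<dots> = {1..r}"
      unfolding append_take_drop_id set_upt by (rule atLeastLessThanSuc_atLeastAtMost)
    finally have set: "set ?v = {1..r}" .
    have "distinct (take i ?x @ drop i ?x)"
      unfolding append_take_drop_id by (rule distinct_upt)
    then have dist: "distinct ?v"
      by (simp only: distinct_append distinct_rev set_rev)
    have i': "i < r" using i by (simp del: upt_Suc)
    have "length (rev (take i ?x)) = i" using i by (simp del: upt_Suc)
    then have td: "take i ?v = rev (take i ?x)" "drop i ?v = drop i ?x"
      by (simp_all del: length_rev length_take upt_Suc)
    show "(\<Sum>w\<in>#shuffle_product (rev (take i ?x)) (drop i ?x). ev g (map xvar w)) = 0"
      using alternal_relation[OF g rel[OF i(1) i'] dist set i(1) i'] unfolding td .
  qed (use assms(2) in auto)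
  then show ?thesis
    using ev_xvars[OF g] by (simp del: upt_Suc)
qed

text \<open>Negating the variables and reversing the word reverses the list of differences. The word
  has \<open>r + 1\<close> letters, and \<open>r + 1\<close> and \<open>r - 1\<close> have equal
  parity.\<close>

lemma mantar_invariantI:
  assumes f: "f \<in> ratmoulds" "f 0 = 0"
    and rev: "\<And>r. r \<ge> 1 \<Longrightarrow> ev (sharp f r) (map xvar (rev [1..<Suc r])) = (- 1) ^ (r - 1) * sharp f r"
  shows "mantar_invariant f"
  unfolding mantar_invariant_def sharp_word_sharp[OF f(1), symmetric]
proof (intro allI)
  fix \<beta> and w :: "nat list"
  have g: "sharp f r \<in> ratfuns r" for r
    using sharp_ratmoulds[OF f(1)] by (rule ratmouldsD)
  consider "\<not> distinct w" | "length w \<le> 1" | "distinct w" "length w \<ge> 2" by linarith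
  then show "sharp_word (\<not> \<beta>) (sharp f) (rev w) = (- 1) ^ length w * sharp_word \<beta> (sharp f) w"
  proof cases
    case 2
    then have "sharp f (length w - 1) = 0"
      using f(2) by (simp add: sharp_def)
    then show ?thesis by (simp add: sharp_word_def)
  next
    case 3
    define r where "r = length w - 1"
    have r: "length w = Suc r" "r \<ge> 1" using 3 by (auto simp: r_def)
    let ?ts = "map xvar (rev [1..<Suc r])"
    have ind: "indep (sharp_args \<beta> w)" "length (sharp_args \<beta> w) = r"
      using 3 r by (auto intro: indep_sharp_args)
    have "(- 1) ^ (r - 1) * ev (sharp f r) (sharp_args \<beta> w) = ev ((- 1) ^ (r - 1) * sharp f r) (sharp_args \<beta> w)"
    proof -
      have "ev (- 1) (sharp_args \<beta> w) = - 1"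
        by (subst ev_uminus[OF ind]) auto
      then have "ev ((- 1) ^ (r - 1)) (sharp_args \<beta> w) = (- 1) ^ (r - 1)"
        by (subst ev_power[OF ind]) auto
      then show ?thesis
        using ev_mult[OF ind sign_ratfuns g, of "r - 1"] by simp
    qed
    also have "\<dots> = ev (ev (sharp f r) ?ts) (sharp_args \<beta> w)"
      using rev[OF r(2)] by (simp only:)
    also have "\<dots> = ev (sharp f r) (map (\<lambda>t. ev t (sharp_args \<beta> w)) ?ts)"
      by (intro ev_ev ind indep_xvars) (use g r in auto)
    also have "map (\<lambda>t. ev t (sharp_args \<beta> w)) ?ts = rev (sharp_args \<beta> w)"
    proof -
      have "map (\<lambda>j. ev (xvar j) (sharp_args \<beta> w)) [1..<Suc r] = sharp_args \<beta> w"
        using ind by (intro nth_equalityI) (auto simp: ev_xvar[OF ind] simp del: upt_Suc)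
      then show ?thesis
        by (simp add: rev_map[symmetric] comp_def del: upt_Suc)
    qed
    also have "rev (sharp_args \<beta> w) = sharp_args (\<not> \<beta>) (rev w)"
    proof -
      have "(\<lambda>j. - svar \<beta> j) = svar (\<not> \<beta>)"
        by (auto simp: svar_def)
      then show ?thesis
        by (simp add: sharp_args_def rev_differences rev_map[symmetric] comp_def)
    qed
    finally have "ev (sharp f r) (sharp_args (\<not> \<beta>) (rev w)) = (- 1) ^ (r - 1) * ev (sharp f r) (sharp_args \<beta> w)"
      by simp
    moreover have "(- 1 :: ratfun) ^ (r - 1) = (- 1) ^ length w"
      using r by (cases r) auto
    ultimately show ?thesis
      using 3 r by (simp add: sharp_word_def)
  qed (simp add: sharp_word_def)
qed

lemma ls_Q_mantar_invariant:
  assumes "f \<in> ls_Q"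
  shows "mantar_invariant f"
proof (rule mantar_invariantI)
  have Q: "f \<in> \<Q>" and f0: "f 0 = 0"
    and rel: "\<And>r i. 2 \<le> r \<Longrightarrow> 1 \<le> i \<Longrightarrow> i < r \<Longrightarrow>
      word_ev (sharp f) (shuffle_product [1..<Suc i] [Suc i..<Suc r]) = 0"
    using assms by (auto simp: ls_Q_def)
  show "f \<in> ratmoulds" using Q by (rule Q_ratmoulds)
  show "f 0 = 0" by (rule f0)
  fix r :: nat assume r: "r \<ge> 1"
  show "ev (sharp f r) (map xvar (rev [1..<Suc r])) = (- 1) ^ (r - 1) * sharp f r"
  proof (rule alternal_rev)
    fix i assume i: "1 \<le> i" "i < r"
    have "length w = r" if "w \<in># shuffle_product [1..<Suc i] [Suc i..<Suc r]" for w
    proof -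
      have "length w = length [1..<Suc i] + length [Suc i..<Suc r]"
        using arg_cong[OF mset_shuffle_product[OF that], of size]
        by (simp only: size_mset size_union)
      then show ?thesis
        using i by (simp del: upt_Suc)
    qed
    then have "word_ev (sharp f) (shuffle_product [1..<Suc i] [Suc i..<Suc r]) =
       (\<Sum>w\<in>#shuffle_product [1..<Suc i] [Suc i..<Suc r]. ev (sharp f r) (map xvar w))"
      unfolding word_ev_def by (intro arg_cong[of _ _ sum_mset] image_mset_cong) simp
    then show "(\<Sum>w\<in>#shuffle_product [1..<Suc i] [Suc i..<Suc r]. ev (sharp f r) (map xvar w)) = 0"
      using rel[of r i] i by simp
  qed (use r sharp_ratmoulds[OF \<open>f \<in> ratmoulds\<close>] in \<open>auto dest: ratmouldsD\<close>)
qed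

section \<open>Low depth components\<close>

lemma xvar_eq_iff: "xvar i = xvar j \<longleftrightarrow> i = j"
proof -
  have ne: "Poly_Mapping.single (Poly_Mapping.single i 1) 1 \<noteq> (0 :: ratpoly)" for i :: nat
    by (metis lookup_single_eq lookup_zero one_neq_zero)
  have inj: "i = j" if "Poly_Mapping.single (Poly_Mapping.single i 1) 1 =
      (Poly_Mapping.single (Poly_Mapping.single j 1) 1 :: ratpoly)" for i j :: nat
  proof -
    have "Poly_Mapping.single i (1::nat) = Poly_Mapping.single j 1"
      using arg_cong[OF that, of Poly_Mapping.keys] by simp
    from arg_cong[OF this, of Poly_Mapping.keys] show ?thesis
      by simp
  qed
  show ?thesis
    using ne inj by (auto simp: xvar_def Zero_fract_def eq_fract split: if_splits)
qed

lemma svar_eq_iff: "svar \<beta> i = svar \<beta> j \<longleftrightarrow> i = j"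
  by (auto simp: svar_def xvar_eq_iff)

lemma psi_0_homogeneous: "psi_0 r \<in> homogeneous_ratfuns r (- int r)"
proof -
  have "(\<Prod>j\<in>{0..r} - {i}. 1 / (xvar j - xvar i)) \<in> homogeneous_ratfuns r (- int r)" if "i < r" for i
  proof -
    have "(\<Prod>j\<in>{0..r} - {i}. 1 / (xvar j - xvar i)) \<in> homogeneous_ratfuns r (\<Sum>j\<in>{0..r} - {i}. - 1)"
      using that by (intro homogeneous_prod homogeneous_divide[of _ _ 0 _ 1] homogeneous_diff) auto
    then show ?thesis
      using that by simp
  qed
  then have "s_brown r \<in> homogeneous_ratfuns r (- int r)"
    unfolding s_brown_def by (intro homogeneous_sum homogeneous_scale) auto
  then show ?thesis
    unfolding psi_0_def by (intro homogeneous_divide[of _ _ "- int r" _ 0]) auto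
qed

lemma psi_0_0: "psi_0 0 = 0"
  by (simp add: psi_0_def s_brown_def)

text \<open>The formula for \<open>psi_0\<close> involves the points only through differences, so
  the letter \<open>w ! 0\<close> takes the place of x_0 = 0 and the formula keeps its
  shape.\<close>

lemma flat_word_psi_0:
  assumes "distinct w" "length w = Suc r"
  shows "flat_word \<beta> psi_0 w = (\<Sum>i<r. of_nat (r - i) *
    (\<Prod>j\<in>{0..r} - {i}. 1 / (svar \<beta> (w ! j) - svar \<beta> (w ! i)))) / of_nat (Suc r choose 2)"
proof -
  have ind: "indep (flat_args \<beta> w)" "length (flat_args \<beta> w) = r"
    using assms by (auto intro: indep_flat_args)
  note hom = ev_divide[OF ind] ev_sum[OF ind] ev_mult[OF ind] ev_prod[OF ind]
  have dif: "ev (xvar j - xvar i) (flat_args \<beta> w) = svar \<beta> (w ! j) - svar \<beta> (w ! i)"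
    if "i \<le> r" "j \<le> r" for i j
    using ev_svar_diff_flat_args[OF assms that(2,1), of True \<beta>] by (simp add: svar_def)
  have "ev (\<Prod>j\<in>{0..r} - {i}. 1 / (xvar j - xvar i)) (flat_args \<beta> w) =
      (\<Prod>j\<in>{0..r} - {i}. 1 / (svar \<beta> (w ! j) - svar \<beta> (w ! i)))" if "i < r" for i
  proof (subst hom(4))
    show "(\<Prod>j\<in>{0..r} - {i}. ev (1 / (xvar j - xvar i)) (flat_args \<beta> w)) =
      (\<Prod>j\<in>{0..r} - {i}. 1 / (svar \<beta> (w ! j) - svar \<beta> (w ! i)))"
      using that by (intro prod.cong refl, subst hom(1)) (auto simp: dif ratfuns_diff)
  qed (use that in \<open>auto intro!: ratfuns_divide ratfuns_diff\<close>)
  moreover have mem: "(\<Prod>j\<in>{0..r} - {i}. 1 / (xvar j - xvar i)) \<in> ratfuns r" if "i < r" for i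
    using that by (auto intro!: ratfuns_prod ratfuns_divide ratfuns_diff)
  ultimately have "ev (s_brown r) (flat_args \<beta> w) =
     (\<Sum>i<r. of_nat (r - i) * (\<Prod>j\<in>{0..r} - {i}. 1 / (svar \<beta> (w ! j) - svar \<beta> (w ! i))))"
    unfolding s_brown_def
    by (subst hom(2)) (auto intro!: sum.cong ratfuns_mult simp: hom(3) ev_of_nat[OF ind] simp del: of_nat_diff)
  moreover have "s_brown r \<in> ratfuns r"
    unfolding s_brown_def by (auto intro!: ratfuns_sum ratfuns_mult mem simp del: of_nat_diff)
  ultimately show ?thesis
    using assms by (simp add: flat_word_def psi_0_def hom(1) ev_of_nat[OF ind])
qed

lemma flat_word_psi_0_1:
  fixes \<beta> :: bool
  assumes "distinct [a, b]"
  defines "y \<equiv> svar \<beta>"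
  shows "flat_word \<beta> psi_0 [a, b] = 1 / (y b - y a)"
proof -
  have *: "{0..1} - {0} = {1::nat}" "{..<1} = {0::nat}" by auto
  show ?thesis
    unfolding y_def using assms(1)
    by (subst flat_word_psi_0[of _ 1], simp, simp, unfold *) (simp add: choose_two)
qed

text \<open>Every denominator is oriented as later minus earlier point. The inverses are then the
  quantities between which the partial fraction relations hold.\<close>

lemma flat_word_psi_0_2:
  fixes \<beta> :: bool
  assumes "distinct [a, b, c]"
  defines "y \<equiv> svar \<beta>"
  shows "flat_word \<beta> psi_0 [a, b, c] =
    (2 * (1 / (y b - y a)) * (1 / (y c - y a)) - 1 / (y b - y a) * (1 / (y c - y b))) / 3"
proof -
  have *: "{0..2} - {0} = {1,2::nat}" "{0..2} - {1} = {0,2::nat}" "{..<2} = {0,1::nat}" by auto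
  have m: "1 / (y a - y b) = - (1 / (y b - y a))"
    by (metis minus_diff_eq minus_divide_right)
  have "1 / ((y a - y b) * (y c - y b)) = 1 / (y a - y b) * (1 / (y c - y b))"
    "2 / ((y b - y a) * (y c - y a)) = 2 * (1 / (y b - y a)) * (1 / (y c - y a))"
    by simp_all
  note eqs = this[unfolded m]
  show ?thesis
  proof -
    have "flat_word \<beta> psi_0 [a, b, c] =
        (2 / ((y b - y a) * (y c - y a)) + 1 / ((y a - y b) * (y c - y b))) / 3"
      unfolding y_def using assms(1)
      by (subst flat_word_psi_0[of _ 2], simp, simp, unfold *) (simp add: choose_two *[simplified])
    then show ?thesis
      unfolding eqs by simp
  qed
qed

lemma flat_word_psi_0_3:
  fixes \<beta> :: bool
  assumes "distinct [a, b, c, d]"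
  defines "y \<equiv> svar \<beta>"
  shows "flat_word \<beta> psi_0 [a, b, c, d] =
    (3 * (1 / (y b - y a)) * (1 / (y c - y a)) * (1 / (y d - y a)) -
     2 * (1 / (y b - y a)) * (1 / (y c - y b)) * (1 / (y d - y b)) +
     1 / (y c - y a) * (1 / (y c - y b)) * (1 / (y d - y c))) / 6"
proof -
  have *: "{0..3} - {0} = {1,2,3::nat}" "{0..3} - {1} = {0,2,3::nat}" "{0..3} - {2} = {0,1,3::nat}"
    "{..<3} = {0,1,2::nat}" by auto
  have m: "1 / (y i - y j) = - (1 / (y j - y i))" for i j
    by (metis minus_diff_eq minus_divide_right)
  have "2 / ((y a - y b) * (y c - y b) * (y d - y b)) = 2 * (1 / (y a - y b)) * (1 / (y c - y b)) * (1 / (y d - y b))"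
    "1 / ((y a - y c) * (y b - y c) * (y d - y c)) = 1 / (y a - y c) * (1 / (y b - y c)) * (1 / (y d - y c))"
    "3 / ((y b - y a) * (y c - y a) * (y d - y a)) = 3 * (1 / (y b - y a)) * (1 / (y c - y a)) * (1 / (y d - y a))"
    by simp_all
  note eqs = this[unfolded m[of a b] m[of a c] m[of b c]]
  have "flat_word \<beta> psi_0 [a, b, c, d] =
    (3 / ((y b - y a) * (y c - y a) * (y d - y a)) + 2 / ((y a - y b) * (y c - y b) * (y d - y b)) +
     1 / ((y a - y c) * (y b - y c) * (y d - y c))) / 6"
    unfolding y_def using assms(1)
    by (subst flat_word_psi_0[of _ 3], simp, simp, unfold *) (simp add: choose_two *[simplified] mult.assoc)
  then show ?thesis
    unfolding eqs by simp
qed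

section \<open>Ecalle's mould \<open>pal\<close> in depth at most three\<close>

lemma dupal_homogeneous: "dupal r \<in> homogeneous_ratfuns r (1 - int r)"
proof -
  have "xvar (i + 1) / (\<Prod>j=1..r. xvar j) \<in> homogeneous_ratfuns r (1 - int r)" if "i < r" for i
  proof -
    have "(\<Prod>j=1..r. xvar j) \<in> homogeneous_ratfuns r (\<Sum>j=1..r. 1)"
      by (intro homogeneous_prod) auto
    then show ?thesis
      using that by (intro homogeneous_divide[of _ _ 1 _ "int r"]) auto
  qed
  then show ?thesis
    unfolding dupal_def
    by (intro homogeneous_scale homogeneous_sum homogeneous_of_rat homogeneous_mult_eq[OF sign_homogeneous]
        homogeneous_mult_eq[of _ _ 0 _ "1 - int r"]) auto
qed

lemma homogeneous_ratfuns_mono: "r \<le> n \<Longrightarrow> p \<in> homogeneous_ratfuns r e \<Longrightarrow> p \<in> homogeneous_ratfuns n e"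
  unfolding homogeneous_ratfuns_def by fastforce

lemma pal_homogeneous: "pal r \<in> homogeneous_ratfuns r (- int r)"
proof (induction r rule: less_induct)
  case (less r)
  show ?case
  proof (cases r)
    case 0
    then show ?thesis by simp
  next
    case (Suc n)
    have dupal_i: "ev (dupal (Suc n - i)) (Xs (i + 1) (Suc n)) \<in> homogeneous_ratfuns (Suc n) (1 - int (Suc n - i))"
      if "i \<le> n" for i
    proof -
      have "Xs (i + 1) (Suc n) = differences (map xsum [i..<Suc (Suc n)])"
        using Xs_eq_differences[of i "Suc n - i"] that by simp
      moreover have "{i..<Suc (Suc n)} \<subseteq> {..Suc n}" by auto
      ultimately show ?thesis
        using that flexion_homogeneous(1)[of "dupal (Suc n - i)" "[i..<Suc (Suc n)]" "1 - int (Suc n - i)" "Suc n"]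
          dupal_homogeneous[of "Suc n - i"]
        by (auto simp del: upt_Suc)
    qed
    have pal_i: "pal i \<in> homogeneous_ratfuns (Suc n) (- int i)" if "i \<le> n" for i
      using less[of i] Suc that by (intro homogeneous_ratfuns_mono[of i "Suc n"]) auto
    have "(\<Sum>i\<le>n. pal i * ev (dupal (Suc n - i)) (Xs (i + 1) (Suc n))) \<in> homogeneous_ratfuns (Suc n) (- int n)"
    proof (intro homogeneous_sum)
      fix i assume "i \<in> {..n}"
      then show "pal i * ev (dupal (Suc n - i)) (Xs (i + 1) (Suc n)) \<in> homogeneous_ratfuns (Suc n) (- int n)"
        by (intro homogeneous_mult_eq[of _ _ "- int i" _ "1 - int (Suc n - i)"] pal_i dupal_i) auto
    qed
    moreover have "(\<Sum>j=1..Suc n. xvar j) \<in> homogeneous_ratfuns (Suc n) 1"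
      by (intro homogeneous_sum homogeneous_xvar) simp
    ultimately show ?thesis
      unfolding Suc pal.simps
      by (intro homogeneous_mult_eq[OF homogeneous_divide[of 1 _ 0 _ 1 "- 1"]]) auto
  qed
qed

lemma pal_ratmoulds: "pal \<in> ratmoulds"
  using pal_homogeneous homogeneous_imp_ratfuns by (auto simp: ratmoulds_def)

lemma dupal_ratmoulds: "dupal \<in> ratmoulds"
  using dupal_homogeneous homogeneous_imp_ratfuns by (auto simp: ratmoulds_def)

text \<open>The sum of all variables telescopes to the distance between the end points, and the two
  factors are evaluated on a prefix and a suffix that share the letter \<open>w ! i\<close>.\<close>

lemma sharp_word_pal:
  assumes "distinct w" "length w = Suc (Suc n)"
  shows "sharp_word \<beta> pal w = 1 / (svar \<beta> (w ! Suc n) - svar \<beta> (w ! 0)) *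
    (\<Sum>i\<le>n. sharp_word \<beta> pal (map ((!) w) [0..<Suc i]) *
      sharp_word \<beta> dupal (map ((!) w) [i..<Suc (Suc n)]))"
proof -
  have ind: "indep (sharp_args \<beta> w)" "length (sharp_args \<beta> w) = Suc n"
    using assms by (auto intro: indep_sharp_args)
  note hom = ev_divide[OF ind] ev_sum[OF ind] ev_mult[OF ind]
  have p: "pal i = ev (pal i) (differences (map xsum [0..<Suc i]))" if "i \<le> n" for i
    using Xs_eq_differences[of 0 i] ev_xvars[OF ratmouldsD[OF pal_ratmoulds], of i]
    by (simp add: Xs_def del: upt_Suc)
  have d: "Xs (i + 1) (Suc n) = differences (map xsum [i..<Suc (Suc n)])" if "i \<le> n" for i
    using Xs_eq_differences[of i "Suc n - i"] that by simp
  have mem: "pal i \<in> ratfuns (Suc n)"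
      "ev (dupal (Suc n - i)) (differences (map xsum [i..<Suc (Suc n)])) \<in> ratfuns (Suc n)" if "i \<le> n" for i
    using that atLeastLessThanSuc_atLeastAtMost[of i "Suc n"] flexion_ratfuns(1)[of "dupal (Suc n - i)" "[i..<Suc (Suc n)]" "Suc n"]
      ratmouldsD[OF dupal_ratmoulds] homogeneous_ratfuns_mono[OF _ pal_homogeneous, of i "Suc n"]
    by (auto simp del: upt_Suc intro: homogeneous_imp_ratfuns)
  have ev: "ev (pal i) (sharp_args \<beta> w) = sharp_word \<beta> pal (map ((!) w) [0..<Suc i])"
    "ev (ev (dupal (Suc n - i)) (differences (map xsum [i..<Suc (Suc n)]))) (sharp_args \<beta> w) =
      sharp_word \<beta> dupal (map ((!) w) [i..<Suc (Suc n)])" if "i \<le> n" for i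
  proof -
    have dist: "distinct (map ((!) w) [0..<Suc i])" "distinct (map ((!) w) [i..<Suc (Suc n)])"
      using assms that by (intro distinct_map_nth; auto)+
    show "ev (pal i) (sharp_args \<beta> w) = sharp_word \<beta> pal (map ((!) w) [0..<Suc i])"
      using that assms dist ratmouldsD[OF pal_ratmoulds, of i]
      by (subst p[OF that], subst ev_flexion_sharp[of _ _ "Suc n"]) (auto simp: sharp_word_def simp del: upt_Suc)
    show "ev (ev (dupal (Suc n - i)) (differences (map xsum [i..<Suc (Suc n)]))) (sharp_args \<beta> w) =
      sharp_word \<beta> dupal (map ((!) w) [i..<Suc (Suc n)])"
      using that assms dist ratmouldsD[OF dupal_ratmoulds, of "Suc n - i"]
      by (subst ev_flexion_sharp[of _ _ "Suc n"]) (auto simp: sharp_word_def Suc_diff_le simp del: upt_Suc)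
  qed
  have "sharp_word \<beta> pal w = ev (1 / xsum (Suc n) *
     (\<Sum>i\<le>n. pal i * ev (dupal (Suc n - i)) (differences (map xsum [i..<Suc (Suc n)])))) (sharp_args \<beta> w)"
    using assms d by (simp add: sharp_word_def xsum_def del: upt_Suc)
  also have "\<dots> = ev (1 / xsum (Suc n)) (sharp_args \<beta> w) *
     ev (\<Sum>i\<le>n. pal i * ev (dupal (Suc n - i)) (differences (map xsum [i..<Suc (Suc n)]))) (sharp_args \<beta> w)"
    by (intro hom(3) ratfuns_divide ratfuns_sum ratfuns_mult mem)
       (use xsum_homogeneous[of "Suc n" "Suc n", THEN homogeneous_imp_ratfuns] in auto)
  also have "ev (1 / xsum (Suc n)) (sharp_args \<beta> w) = 1 / (svar \<beta> (w ! Suc n) - svar \<beta> (w ! 0))"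
    using assms xsum_homogeneous[of "Suc n" "Suc n", THEN homogeneous_imp_ratfuns]
    by (subst hom(1)) (auto simp: ev_xsum_sharp_args simp del: xsum_Suc)
  also have "ev (\<Sum>i\<le>n. pal i * ev (dupal (Suc n - i)) (differences (map xsum [i..<Suc (Suc n)]))) (sharp_args \<beta> w) =
      (\<Sum>i\<le>n. ev (pal i * ev (dupal (Suc n - i)) (differences (map xsum [i..<Suc (Suc n)]))) (sharp_args \<beta> w))"
    by (intro hom(2) ratfuns_mult mem) auto
  also have "\<dots> = (\<Sum>i\<le>n. sharp_word \<beta> pal (map ((!) w) [0..<Suc i]) *
      sharp_word \<beta> dupal (map ((!) w) [i..<Suc (Suc n)]))"
    using mem ev by (intro sum.cong refl, subst hom(3)) (auto simp del: upt_Suc)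
  finally show ?thesis .
qed

lemma bernoulli_number_values:
  "bernoulli_number (Suc 0) = - 1 / 2" "bernoulli_number 2 = 1 / 6" "bernoulli_number 3 = 0"
  by (simp_all add: numeral_2_eq_2 numeral_3_eq_3)

lemma sharp_word_dupal_1:
  assumes "distinct [a, b]"
  shows "sharp_word \<beta> dupal [a, b] = - 1 / 2"
proof -
  have "dupal 1 = of_rat (- 1 / 2)"
    using xvar_eq_iff[of 1 0] by (simp add: dupal_def bernoulli_number_values)
  then have "sharp_word \<beta> dupal [a, b] = ev (of_rat (- 1 / 2)) (sharp_args \<beta> [a, b])"
    using assms by (simp add: sharp_word_def)
  also have "\<dots> = of_rat (- 1 / 2)"
    by (rule ev_of_rat) (use assms indep_sharp_args in auto)
  finally show ?thesis
    by (simp add: of_rat_divide of_rat_minus)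
qed

lemma sharp_word_dupal_2:
  fixes \<beta> :: bool
  assumes "distinct [a, b, c]"
  defines "y \<equiv> svar \<beta>"
  shows "sharp_word \<beta> dupal [a, b, c] = (1 / (y c - y b) - 1 / (y b - y a)) / 12"
proof -
  have ind: "indep (sharp_args \<beta> [a, b, c])" "length (sharp_args \<beta> [a, b, c]) = 2"
    using assms(1) indep_sharp_args by auto
  have "sharp_word \<beta> dupal [a, b, c] = ev (dupal 2) (sharp_args \<beta> [a, b, c])"
    using assms(1) by (simp add: sharp_word_def numeral_2_eq_2)
  \<comment> \<open>The factor 1/12 is B_2 / 2!.\<close>
  also have "dupal 2 = (1 / xvar 2 - 1 / xvar 1) / 12"
    using xvar_eq_iff[of 1 0] xvar_eq_iff[of 2 0]
    by (simp add: dupal_def bernoulli_number_values numeral_2_eq_2 of_rat_divide)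
  also have "ev ((1 / xvar 2 - 1 / xvar 1) / 12) (sharp_args \<beta> [a, b, c]) =
      (1 / (y c - y b) - 1 / (y b - y a)) / 12"
  proof -
    have "ev (xvar 1) (sharp_args \<beta> [a, b, c]) = y b - y a" "ev (xvar 2) (sharp_args \<beta> [a, b, c]) = y c - y b"
      using ev_xvar[OF ind, of 1] ev_xvar[OF ind, of 2] by (simp_all add: sharp_args_def differences_def y_def)
    then show ?thesis
      by (simp add: ev_divide[OF ind] ev_diff[OF ind] ev_numeral[OF ind] ratfuns_divide ratfuns_diff)
  qed
  finally show ?thesis .
qed

text \<open>The Bernoulli number of index 3 vanishes.\<close>

lemma sharp_word_dupal_3:
  assumes "length w = 4"
  shows "sharp_word \<beta> dupal w = 0"
  using assms by (simp add: sharp_word_def dupal_def bernoulli_number_values)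

lemma sharp_word_pal_0: "sharp_word \<beta> pal [a] = 1"
  by (simp add: sharp_word_def)

lemma sharp_word_pal_1:
  fixes \<beta> :: bool
  assumes "distinct [a, b]"
  defines "y \<equiv> svar \<beta>"
  shows "sharp_word \<beta> pal [a, b] = - 1 / (2 * (y b - y a))"
  using assms(1) sharp_word_dupal_1[OF assms(1), of \<beta>]
  by (subst sharp_word_pal[of _ 0]) (auto simp: sharp_word_pal_0 y_def)

lemma sharp_word_pal_2:
  fixes \<beta> :: bool
  assumes "distinct [a, b, c]"
  defines "y \<equiv> svar \<beta>"
  shows "sharp_word \<beta> pal [a, b, c] = 1 / (y c - y a) *
    ((1 / (y c - y b) - 1 / (y b - y a)) / 12 + 1 / (4 * (y b - y a)))"
  using assms(1) sharp_word_dupal_1[of b c \<beta>] sharp_word_dupal_2[OF assms(1), of \<beta>]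
    sharp_word_pal_1[of a b \<beta>]
  by (subst sharp_word_pal[of _ 1]) (auto simp: sharp_word_pal_0 y_def)

lemma sharp_word_pal_3:
  fixes \<beta> :: bool
  assumes "distinct [a, b, c, d]"
  defines "y \<equiv> svar \<beta>"
  shows "sharp_word \<beta> pal [a, b, c, d] = 1 / (y d - y a) *
    (- 1 / (2 * (y b - y a)) * ((1 / (y d - y c) - 1 / (y c - y b)) / 12) +
     1 / (y c - y a) * ((1 / (y c - y b) - 1 / (y b - y a)) / 12 + 1 / (4 * (y b - y a))) * (- 1 / 2))"
proof -
  have "sharp_word \<beta> pal [a, b, c, d] = 1 / (y d - y a) *
      (sharp_word \<beta> pal [a, b] * sharp_word \<beta> dupal [b, c, d] +
       sharp_word \<beta> pal [a, b, c] * sharp_word \<beta> dupal [c, d])"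
    using assms(1)
    by (subst sharp_word_pal[of _ 2])
       (auto simp: sharp_word_pal_0 sharp_word_dupal_3 y_def numeral_2_eq_2 numeral_3_eq_3)
  moreover have "sharp_word \<beta> dupal [c, d] = - 1 / 2"
    by (rule sharp_word_dupal_1) (use assms(1) in simp)
  moreover have "sharp_word \<beta> dupal [b, c, d] = (1 / (y d - y c) - 1 / (y c - y b)) / 12"
    unfolding y_def by (rule sharp_word_dupal_2) (use assms(1) in simp)
  moreover have "sharp_word \<beta> pal [a, b] = - 1 / (2 * (y b - y a))"
    unfolding y_def by (rule sharp_word_pal_1) (use assms(1) in simp)
  moreover have "sharp_word \<beta> pal [a, b, c] = 1 / (y c - y a) *
      ((1 / (y c - y b) - 1 / (y b - y a)) / 12 + 1 / (4 * (y b - y a)))"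
    unfolding y_def by (rule sharp_word_pal_2) (use assms(1) in simp)
  ultimately show ?thesis
    by (simp only:)
qed

section \<open>Explicit contractions and partial fraction identities\<close>

lemma contract_diff_Cons:
  "contract_diff F K (x # w) =
     deconcat (\<lambda>u v. F (x # u) * (K (x # v) - K (last (x # u) # v))) w +
     contract_diff F (\<lambda>v. K (x # v)) w"
  by (simp add: contract_diff_def deconcat_def sum_splits3_Cons case_prod_beta)

text \<open>A component of depth \<open>k - 1\<close> cut out as a function on all words, the form
  in which brackets accept it.\<close>

definition letters :: "nat \<Rightarrow> ('a list \<Rightarrow> 'b::zero) \<Rightarrow> 'a list \<Rightarrow> 'b" where
  "letters k F w = (if length w = k then F w else 0)"

lemma contract_2: "(\<And>x. F [x] = 0) \<Longrightarrow> (\<And>x. G [x] = 0) \<Longrightarrow> contract F G [a, b] = 0"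
  by (simp add: contract_Cons contract_diff_Cons deconcat_Cons)

lemma contract_3:
  assumes "\<And>x. F [x] = 0" "\<And>x. G [x] = 0"
  shows "contract F G [a, b, c] = F [a, b] * G [a, c] + F [b, c] * (G [a, b] - G [a, c])"
  by (simp add: assms contract_Cons contract_diff_Cons deconcat_Cons)

lemma contract_4:
  assumes "\<And>x. F [x] = 0" "\<And>x. G [x] = 0"
  shows "contract F G [a, b, c, d] =
    F [a, b] * G [a, c, d] + F [b, c] * (G [a, b, d] - G [a, c, d]) +
    F [c, d] * (G [a, b, c] - G [a, b, d]) +
    F [a, b, c] * G [a, d] + F [b, c, d] * (G [a, b] - G [a, d])"
  by (simp add: assms contract_Cons contract_diff_Cons deconcat_Cons algebra_simps)

lemma inverse_difference:
  fixes a b c :: "'a::field"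
  assumes "a \<noteq> b" "b \<noteq> c" "a \<noteq> c"
  shows "1 / (b - a) * (1 / (c - b)) = 1 / (c - a) * (1 / (b - a) + 1 / (c - b))"
  using assms by (simp add: divide_simps)

text \<open>Depth 2 of the logarithm, with \<open>A\<close>, \<open>B\<close>, \<open>AB\<close> the
  inverses of the differences of three points: \<open>pal\<close> minus half the square of p_1 =
  -psi_1/2 is -psi_2/4.\<close>

lemma log_pal_identity_2:
  fixes A B AB :: "'a::field_char_0"
  assumes "A * B = AB * (A + B)"
  shows "AB * ((B - A) / 12 + A / 4) - 1/2 * (1/4 * (A * AB + B * (A - AB))) = - 1/4 * ((2 * A * AB - A * B) / 3)"
  using assms by (simp add: field_simps)

text \<open>\<open>A\<close>, \<open>B\<close>, \<open>C\<close>, \<open>AB\<close>, \<open>BC\<close>, \<open>ABC\<close> stand for the inverses of the differences of four points; the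
  assumptions are the partial fraction relations, and the coefficients in the proof come from solving
  a linear system.\<close>

lemma log_pal_identity_3:
  fixes A B C AB BC ABC :: "'a::field_char_0"
  assumes rel: "A * B = AB * (A + B)" "B * C = BC * (B + C)"
     "A * BC = ABC * (A + BC)" "AB * C = ABC * (AB + C)"
  defines "q2 \<equiv> \<lambda>x y z. (2 * x * z - x * y) / 3"
   and "R \<equiv> \<lambda>x y z. x * z + y * (x - z)"
  shows "ABC * (- A/2 * ((C - B) / 12) + AB * ((B - A) / 12 + A / 4) * (-1/2)) =
    - 1/6 * ((3 * A * AB * ABC - 2 * A * B * BC + AB * B * C) / 6) +
    1/48 * ((A * q2 AB C ABC + B * (q2 A BC ABC - q2 AB C ABC) + C * (q2 A B AB - q2 A BC ABC)) -
            (q2 A B AB * ABC + q2 B C BC * (A - ABC))) +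
    1/16 * ((A * q2 AB C ABC + B * (q2 A BC ABC - q2 AB C ABC) + C * (q2 A B AB - q2 A BC ABC)) +
            (q2 A B AB * ABC + q2 B C BC * (A - ABC))) -
    1/48 * (A * R AB C ABC + B * (R A BC ABC - R AB C ABC) + C * (R A B AB - R A BC ABC))" (is "?L = ?R")
proof -
  have "(?L) -
      (?R) =
    (C / 24 + ABC / 144) * (A * B - AB * (A + B)) + (A / 48 + ABC / 144) * (B * C - BC * (B + C)) -
    (B / 72 + C / 36) * (A * BC - ABC * (A + BC)) + A / 18 * (AB * C - ABC * (AB + C))"
    unfolding q2_def R_def by (simp add: field_simps)
  also have "\<dots> = 0"
    using rel by simp
  finally show ?thesis by simp
qed

text \<open>Contracting a block of \<open>i\<close> letters can leave \<open>j\<close> letters only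
  in a word of \<open>i + j - 1\<close> letters.\<close>

lemma contract_length_eq_0:
  assumes "length w + 1 \<noteq> i + j"
  shows "contract (letters i F) (letters j G) w = 0"
  unfolding contract_def
proof (intro sum.neutral ballI)
  fix s assume "s \<in> splits3 w"
  then obtain a b c where s: "s = (a, b, c)" "w = a @ b @ c" "b \<noteq> []"
    by (auto simp: splits3_def)
  then show "(case s of (a, b, c) \<Rightarrow> letters i F b * (letters j G (a @ hd b # c) -
      (if a = [] then 0 else letters j G (a @ last b # c)))) = 0"
    using assms by (auto simp: letters_def)
qed

lemma dbracket_length_eq_0:
  "length w + 1 \<noteq> i + j \<Longrightarrow> dbracket (letters i F) (letters j G) w = 0"
  by (simp add: dbracket_def dcontract_def contract_length_eq_0)

lemma svar_rel:
  fixes \<beta> :: bool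
  assumes "distinct [a, b, c]"
  defines "y \<equiv> svar \<beta>"
  shows "1 / (y b - y a) * (1 / (y c - y b)) = 1 / (y c - y a) * (1 / (y b - y a) + 1 / (y c - y b))"
  by (rule inverse_difference) (use assms in \<open>auto simp: svar_eq_iff\<close>)

lemma svar_not: "svar (\<not> \<beta>) j = - svar \<beta> j"
  by (simp add: svar_def)

text \<open>Reversal with a change of sign exchanges \<open>A\<close> with \<open>C\<close> and
  \<open>AB\<close> with \<open>BC\<close>. The two sides differ by a combination of the partial
  fraction relations.\<close>

lemma psi_0_rev_identity:
  fixes A B C AB BC ABC :: "'a::field_char_0"
  assumes rel: "A * B = AB * (A + B)" "B * C = BC * (B + C)"
     "A * BC = ABC * (A + BC)" "AB * C = ABC * (AB + C)"
  shows "3 * C * BC * ABC - 2 * C * B * AB + BC * B * A = 3 * A * AB * ABC - 2 * A * B * BC + AB * B * C"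
    (is "?L = ?R")
proof -
  have "?L - ?R = 3 * (B * (A * BC - ABC * (A + BC)) - B * (AB * C - ABC * (AB + C)) +
    ABC * ((A * B - AB * (A + B)) - (B * C - BC * (B + C))))"
    by (simp add: algebra_simps)
  also have "\<dots> = 0"
    using rel by simp
  finally show ?thesis by (simp only: right_minus_eq)
qed

lemma psi_0_rev_identity_2:
  fixes A B AB :: "'a::field_char_0"
  assumes "A * B = AB * (A + B)"
  shows "(2 * B * AB - B * A) / 3 = - ((2 * A * AB - A * B) / 3)"
  using assms by (simp add: field_simps)

text \<open>Depth 0 is left out because truncated subtraction places the empty word there
  too.\<close>

lemma flat_word_in_depth:
  assumes "1 \<le> i"
  shows "flat_word \<beta> (in_depth i (f i)) = letters (Suc i) (flat_word \<beta> f)"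
proof
  fix w :: "nat list"
  show "flat_word \<beta> (in_depth i (f i)) w = letters (Suc i) (flat_word \<beta> f) w"
    using assms by (cases w) (auto simp: flat_word_def in_depth_def letters_def)
qed

lemma letters_cases:
  assumes "length w = n" "n \<in> {2, 3, 4}"
  obtains a b where "w = [a, b]" "n = 2" | a b c where "w = [a, b, c]" "n = 3" | a b c d where "w = [a, b, c, d]" "n = 4"
  using assms that by (auto simp: numeral_eq_Suc length_Suc_conv)

text \<open>Components up to depth \<open>d + 3\<close> involve \<open>psi_0 i\<close> only for
  these \<open>i\<close>, so the explicit formulas suffice.\<close>

lemma mantar_invariant_psi_0:
  assumes "i \<in> {1, 2, 3}"
  shows "mantar_invariant (in_depth i (psi_0 i))"
proof -
  have "flat_word (\<not> \<beta>) psi_0 (rev w) = (- 1) ^ length w * flat_word \<beta> psi_0 w"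
    if "distinct w" "length w = Suc i" for \<beta> w
  proof -
    have "length w = Suc i" "Suc i \<in> {2, 3, 4}" using that assms by auto
    then show ?thesis
    proof (cases rule: letters_cases)
      case (1 a b)
      with that show ?thesis
        by (simp add: flat_word_psi_0_1 svar_not)
    next
      case (2 a b c)
      with that have d: "distinct [a, b, c]" "distinct [c, b, a]" by auto
      have m: "svar (\<not> \<beta>) i - svar (\<not> \<beta>) j = svar \<beta> j - svar \<beta> i" for i j
        by (simp add: svar_not)
      have "flat_word (\<not> \<beta>) psi_0 [c, b, a] = - flat_word \<beta> psi_0 [a, b, c]"
        unfolding flat_word_psi_0_2[OF d(1)] flat_word_psi_0_2[OF d(2)] m
        by (rule psi_0_rev_identity_2) (rule svar_rel[OF d(1)])
      then show ?thesis
        unfolding 2(1) by simp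
    next
      case (3 a b c d)
      with that have d: "distinct [a, b, c, d]" "distinct [d, c, b, a]" by auto
      then have r: "distinct [a, b, c]" "distinct [b, c, d]" "distinct [a, b, d]" "distinct [a, c, d]"
        by auto
      have m: "svar (\<not> \<beta>) i - svar (\<not> \<beta>) j = svar \<beta> j - svar \<beta> i" for i j
        by (simp add: svar_not)
      have "flat_word (\<not> \<beta>) psi_0 [d, c, b, a] = flat_word \<beta> psi_0 [a, b, c, d]"
        unfolding flat_word_psi_0_3[OF d(1)] flat_word_psi_0_3[OF d(2)] m
        by (rule arg_cong[of _ _ "\<lambda>x. x / 6"], rule psi_0_rev_identity)
          (rule svar_rel, rule r)+
      then show ?thesis
        unfolding 3(1) by simp
    qed
  qed
  then have main: "flat_word (\<not> \<beta>) psi_0 (rev w) = (- 1) ^ length w * flat_word \<beta> psi_0 w"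
    if "length w = Suc i" for \<beta> w
    using that by (cases "distinct w") (auto simp: flat_word_def)
  have i: "1 \<le> i" using assms by auto
  show ?thesis
    unfolding mantar_invariant_def flat_word_in_depth[OF i, of _ psi_0]
  proof (intro allI)
    fix \<beta> and w :: "nat list"
    show "letters (Suc i) (flat_word (\<not> \<beta>) psi_0) (rev w) =
        (- 1) ^ length w * letters (Suc i) (flat_word \<beta> psi_0) w"
      unfolding letters_def length_rev using main[of w \<beta>] by (cases "length w = Suc i") simp_all
  qed
qed

text \<open>The equations assumed are the components of \<open>exp_ari p = pal\<close> in depths 1,
  2 and 3, on words of 2, 3 and 4 letters. Each gives the next component of \<open>p\<close> in
  terms of \<open>pal\<close> and the earlier ones.\<close>

lemma letters_log_pal:
  fixes p :: "nat list \<Rightarrow> ratfun"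
  assumes p1: "\<And>x. p [x] = 0" and p0: "\<And>w. \<not> distinct w \<Longrightarrow> p w = 0"
    and e2: "\<And>w. distinct w \<Longrightarrow> length w = 2 \<Longrightarrow> p w = sharp_word True pal w"
    and e3: "\<And>w. distinct w \<Longrightarrow> length w = 3 \<Longrightarrow>
      p w + 1/2 * dcontract p p w = sharp_word True pal w"
    and e4: "\<And>w. distinct w \<Longrightarrow> length w = 4 \<Longrightarrow>
      p w + 1/2 * dcontract p p w + 1/6 * dcontract p (dcontract p p) w = sharp_word True pal w"
  defines "q \<equiv> flat_word True psi_0"
  shows "letters 2 p = (\<lambda>w. - 1/2 * letters 2 q w)"
    and "letters 3 p = (\<lambda>w. - 1/4 * letters 3 q w)"
    and "letters 4 p = (\<lambda>w. - 1/6 * letters 4 q w + 1/48 * dbracket (letters 2 q) (letters 3 q) w)"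
proof -
  let ?i = "\<lambda>a b. 1 / (svar True b - svar True a)"
  have q0: "q w = 0" if "\<not> distinct w" for w
    using that by (simp add: q_def flat_word_def)
  have q2: "q [a, b] = ?i a b" if "distinct [a, b]" for a b
    unfolding q_def by (rule flat_word_psi_0_1[OF that])
  have q3: "q [a, b, c] = (2 * ?i a b * ?i a c - ?i a b * ?i b c) / 3" if "distinct [a, b, c]" for a b c
    unfolding q_def by (rule flat_word_psi_0_2[OF that])
  have q4: "q [a, b, c, d] = (3 * ?i a b * ?i a c * ?i a d - 2 * ?i a b * ?i b c * ?i b d +
      ?i a c * ?i b c * ?i c d) / 6" if "distinct [a, b, c, d]" for a b c d
    unfolding q_def by (rule flat_word_psi_0_3[OF that])
  have contract_p3: "contract p p [a, b, c] = p [a, b] * p [a, c] + p [b, c] * (p [a, b] - p [a, c])" for a b c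
    by (rule contract_3) (rule p1)+
  have contract_p4: "contract p G [a, b, c, d] =
      p [a, b] * G [a, c, d] + p [b, c] * (G [a, b, d] - G [a, c, d]) +
      p [c, d] * (G [a, b, c] - G [a, b, d]) +
      p [a, b, c] * G [a, d] + p [b, c, d] * (G [a, b] - G [a, d])"
    if "\<And>x. G [x] = 0" for G a b c d
    by (rule contract_4) (rule p1 that)+
  have quarter: "- 1/2 * x * (- 1/2 * y) + - 1/2 * z * (- 1/2 * x - - 1/2 * y) =
      1/4 * (x * y + z * (x - y))" for x y z :: ratfun
    by (simp add: field_simps)
  have half: "- 1 / (2 * x) = - 1/2 * (1 / x)" "1 / (4 * x) = 1 / x / 4" for x :: ratfun
    by simp_all
  have p2: "p [a, b] = - 1/2 * q [a, b]" if "distinct [a, b]" for a b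
    using e2[OF that] unfolding sharp_word_pal_1[OF that] q2[OF that] half by simp
  have p3: "p [a, b, c] = - 1/4 * q [a, b, c]" if d: "distinct [a, b, c]" for a b c
  proof -
    have d': "distinct [a, b]" "distinct [b, c]" "distinct [a, c]" using d by auto
    have "contract p p [a, b, c] = 1/4 * (?i a b * ?i a c + ?i b c * (?i a b - ?i a c))"
      unfolding contract_p3 p2[OF d'(1)] p2[OF d'(2)] p2[OF d'(3)]
        q2[OF d'(1)] q2[OF d'(2)] q2[OF d'(3)]
      by (rule quarter)
    then have "p [a, b, c] = sharp_word True pal [a, b, c] -
        1/2 * (1/4 * (?i a b * ?i a c + ?i b c * (?i a b - ?i a c)))"
      using e3[OF d] d by (simp only: dcontract_def if_True) (simp add: eq_diff_eq)
    also have "\<dots> = - 1/4 * ((2 * ?i a b * ?i a c - ?i a b * ?i b c) / 3)"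
      unfolding sharp_word_pal_2[OF d] half
      by (rule log_pal_identity_2) (rule svar_rel[OF d])
    finally show ?thesis
      unfolding q3[OF d] .
  qed
  show "letters 2 p = (\<lambda>w. - 1/2 * letters 2 q w)"
  proof
    fix w show "letters 2 p w = - 1/2 * letters 2 q w"
      using p2 p0 by (cases "distinct w")
       (auto simp: letters_def q0 numeral_2_eq_2 length_Suc_conv)
  qed
  show "letters 3 p = (\<lambda>w. - 1/4 * letters 3 q w)"
  proof
    fix w show "letters 3 p w = - 1/4 * letters 3 q w"
      using p3 p0 by (cases "distinct w")
       (auto simp: letters_def q0 numeral_3_eq_3 length_Suc_conv)
  qed
  have p4: "p [a, b, c, d] = - 1/6 * q [a, b, c, d] + 1/48 * dbracket (letters 2 q) (letters 3 q) [a, b, c, d]"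
    if d: "distinct [a, b, c, d]" for a b c d
  proof -
    have r: "distinct [a, b, c]" "distinct [b, c, d]" "distinct [a, b, d]" "distinct [a, c, d]"
      using d by auto
    have t: "distinct [a, b]" "distinct [a, c]" "distinct [a, d]" "distinct [b, c]" "distinct [b, d]" "distinct [c, d]"
      using d by auto
    define A B C AB BC ABC where abbr: "A = ?i a b" "B = ?i b c" "C = ?i c d" "AB = ?i a c" "BC = ?i b d" "ABC = ?i a d"
    define Q where "Q x y z = (2 * x * z - x * y) / 3" for x y z :: ratfun
    define R where "R x y z = x * z + y * (x - z)" for x y z :: ratfun
    have qs: "q [a, b] = A" "q [b, c] = B" "q [c, d] = C" "q [a, c] = AB" "q [b, d] = BC" "q [a, d] = ABC"
      "q [a, b, c] = Q A B AB" "q [b, c, d] = Q B C BC" "q [a, b, d] = Q A BC ABC" "q [a, c, d] = Q AB C ABC"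
      using q2[OF t(1)] q2[OF t(2)] q2[OF t(3)] q2[OF t(4)] q2[OF t(5)] q2[OF t(6)]
        q3[OF r(1)] q3[OF r(2)] q3[OF r(3)] q3[OF r(4)] unfolding abbr Q_def by simp_all
    have ps: "p [a, b] = - 1/2 * A" "p [b, c] = - 1/2 * B" "p [c, d] = - 1/2 * C" "p [a, c] = - 1/2 * AB"
      "p [b, d] = - 1/2 * BC" "p [a, d] = - 1/2 * ABC"
      "p [a, b, c] = - 1/4 * Q A B AB" "p [b, c, d] = - 1/4 * Q B C BC" "p [a, b, d] = - 1/4 * Q A BC ABC"
      "p [a, c, d] = - 1/4 * Q AB C ABC"
      using p2[OF t(1)] p2[OF t(2)] p2[OF t(3)] p2[OF t(4)] p2[OF t(5)] p2[OF t(6)]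
        p3[OF r(1)] p3[OF r(2)] p3[OF r(3)] p3[OF r(4)] unfolding qs by simp_all
    \<comment> \<open>\<open>?X\<close> and \<open>?Y\<close> are the products of psi_1 and psi_2 in
      the two orders; \<open>?Z\<close> is the product of psi_1 with its own square, whose values
      are given by \<open>R\<close>.\<close>
    let ?X = "A * Q AB C ABC + B * (Q A BC ABC - Q AB C ABC) + C * (Q A B AB - Q A BC ABC)"
    let ?Y = "Q A B AB * ABC + Q B C BC * (A - ABC)"
    let ?Z = "A * R AB C ABC + B * (R A BC ABC - R AB C ABC) + C * (R A B AB - R A BC ABC)"
    have c1: "dcontract p p [a, b, c, d] = 1/8 * (?X + ?Y)"
      using d unfolding dcontract_def contract_p4[of p, OF p1] ps
      by (simp add: algebra_simps)
    have sub: "dcontract p p [x, y, z] = 1/4 * (q [x, y] * q [x, z] + q [y, z] * (q [x, y] - q [x, z]))"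
      if "distinct [x, y, z]" for x y z
    proof -
      have "distinct [x, y]" "distinct [y, z]" "distinct [x, z]" using that by auto
      note * = this[THEN p2]
      show ?thesis
        using that unfolding dcontract_def contract_p3 * by (simp add: algebra_simps)
    qed
    have subs: "dcontract p p [a, b, c] = 1/4 * R A B AB" "dcontract p p [a, b, d] = 1/4 * R A BC ABC"
      "dcontract p p [a, c, d] = 1/4 * R AB C ABC"
      using sub[OF r(1)] sub[OF r(3)] sub[OF r(4)] unfolding qs R_def by simp_all
    have s1: "dcontract p p [x] = 0" for x
      using p1 by (simp add: dcontract_def contract_Cons)
    have s2: "dcontract p p [x, y] = 0" for x y
      using p1 by (simp add: dcontract_def contract_2)
    have c2: "dcontract p (dcontract p p) [a, b, c, d] = - 1/8 * ?Z"
      using d unfolding dcontract_def[of p "dcontract p p"] contract_p4[of "dcontract p p", OF s1] ps subs s2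
      by (simp add: algebra_simps)
    have c3: "dbracket (letters 2 q) (letters 3 q) [a, b, c, d] = ?X - ?Y"
      using d unfolding dbracket_def dcontract_def
      by (subst (1 2) contract_4) (simp_all add: letters_def qs)
    have "p [a, b, c, d] = sharp_word True pal [a, b, c, d] - 1/16 * (?X + ?Y) + 1/48 * ?Z"
      using e4[OF d] unfolding c1 c2 by (simp add: algebra_simps)
    also have "sharp_word True pal [a, b, c, d] =
        ABC * (- A/2 * ((C - B) / 12) + AB * ((B - A) / 12 + A / 4) * (-1/2))"
      unfolding sharp_word_pal_3[OF d] abbr half by simp
    also have "\<dots> = - 1/6 * ((3 * A * AB * ABC - 2 * A * B * BC + AB * B * C) / 6) + 1/48 * (?X - ?Y) +
        1/16 * (?X + ?Y) - 1/48 * ?Z"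
      unfolding Q_def R_def
      by (rule log_pal_identity_3; unfold abbr; rule svar_rel; rule r)
    finally show ?thesis
      unfolding c3 q4[OF d] abbr[symmetric] by simp
  qed
  show "letters 4 p = (\<lambda>w. - 1/6 * letters 4 q w + 1/48 * dbracket (letters 2 q) (letters 3 q) w)"
  proof
    fix w :: "nat list"
    consider "\<not> distinct w" | "distinct w" "length w = 4" | "length w \<noteq> 4" by blast
    then show "letters 4 p w = - 1/6 * letters 4 q w + 1/48 * dbracket (letters 2 q) (letters 3 q) w"
    proof cases
      case 1
      then show ?thesis
        using p0 by (simp add: letters_def q0 dbracket_def dcontract_def)
    next
      case 2
      then obtain a b c d where "w = [a, b, c, d]"
        by (auto simp: numeral_eq_Suc length_Suc_conv)
      with 2 p4 show ?thesis
        by (simp add: letters_def)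
    next
      case 3
      then show ?thesis
        by (simp add: letters_def[of 4] dbracket_length_eq_0)
    qed
  qed
qed

section \<open>The ari logarithm and weights\<close>

text \<open>The \<open>n\<close>-th term starts in depth \<open>n\<close>, so the partial sums are
  eventually constant in each depth; this fixes the limit uniquely.\<close>

lemma depth_suminf_eq:
  assumes "\<And>n r. r < n \<Longrightarrow> a n r = 0" and "r < N"
  shows "depth_suminf a r = (\<Sum>n<N. a n r)"
proof -
  define s where "s = (\<lambda>r. \<Sum>n<Suc r. a n r)"
  have eq: "(\<Sum>n<N. a n r) = s r" if "r < N" for r N
    unfolding s_def using that assms(1) by (intro sum.mono_neutral_right) auto
  have s: "depth_sums a s"
    unfolding depth_sums_def
  proof (intro allI exI impI)
    fix d n r :: nat assume "d \<le> n" "r < d"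
    then show "(\<Sum>i<n. a i r) = s r" by (intro eq) simp
  qed
  have "s' = s" if "depth_sums a s'" for s'
  proof
    fix r
    obtain N where N: "\<forall>n\<ge>N. \<forall>k<Suc r. (\<Sum>i<n. a i k) = s' k"
      using \<open>depth_sums a s'\<close> unfolding depth_sums_def by blast
    have "s' r = (\<Sum>i<max N (Suc r). a i r)" using N by simp
    also have "\<dots> = s r" by (intro eq) simp
    finally show "s' r = s r" .
  qed
  then have "depth_suminf a = s"
    unfolding depth_suminf_def using s by blast
  then show ?thesis using eq assms(2) by simp
qed

lemma ari_comp_0 [simp]: "ari_comp r s 0 b = 0" "ari_comp r s a 0 = 0"
  by (simp_all add: ari_comp_def)

lemma ihara_comp_0 [simp]: "ihara_comp r s 0 b = 0" "ihara_comp r s a 0 = 0"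
  by (simp_all add: ihara_comp_def)

lemma ari_prod_eq_0:
  assumes "\<And>i. i < a \<Longrightarrow> f i = 0" "\<And>i. i < b \<Longrightarrow> g i = 0" "r < a + b"
  shows "ari_prod f g r = 0"
  unfolding ari_prod_def
proof (intro sum.neutral ballI)
  fix k assume "k \<in> {..r}"
  then have "k < a \<or> r - k < b" using assms(3) by auto
  then show "ari_comp k (r - k) (f k) (g (r - k)) = 0"
    using assms(1,2) by auto
qed

lemma ari_bracket_eq_0:
  assumes "\<And>i. i < a \<Longrightarrow> f i = 0" "\<And>i. i < b \<Longrightarrow> g i = 0" "r < a + b"
  shows "ari_bracket f g r = 0"
  using ari_prod_eq_0[of a f b g r] ari_prod_eq_0[of b g a f r] assms by (simp add: ari_bracket_def)

lemma ari_power_eq_0: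
  assumes "f 0 = 0" "r < Suc n"
  shows "(ari_prod f ^^ n) f r = 0"
  using assms(2)
proof (induction n arbitrary: r)
  case (Suc n)
  show ?case
    unfolding funpow.simps comp_def
    by (rule ari_prod_eq_0[of 1 _ "Suc n"]) (use Suc assms(1) in auto)
qed (use assms(1) in auto)

lemma exp_ari_eq:
  assumes "f 0 = 0"
  shows "exp_ari f r = unit_mould r + (\<Sum>n<Suc r. (ari_prod f ^^ n) f r / fact (Suc n))"
  unfolding exp_ari_def using ari_power_eq_0[of f, OF assms]
  by (subst depth_suminf_eq[where N = "Suc r"]) auto

text \<open>The linear term is left out, so for \<open>f 0 = 0\<close> the tail in depth
  \<open>r\<close> involves only components below \<open>r\<close>.\<close>

definition exp_tail :: "mould \<Rightarrow> nat \<Rightarrow> ratfun" where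
  "exp_tail f r = (\<Sum>n=1..r. (ari_prod f ^^ n) f r / fact (Suc n))"

lemma exp_ari_tail:
  assumes "f 0 = 0" "r \<ge> 1"
  shows "exp_ari f r = f r + exp_tail f r"
proof -
  have "(\<Sum>n<Suc r. (ari_prod f ^^ n) f r / fact (Suc n)) = f r + exp_tail f r"
    by (simp add: exp_tail_def lessThan_Suc_atMost atMost_atLeast0 sum.atLeast_Suc_atMost)
  then show ?thesis
    using assms by (simp add: exp_ari_eq unit_mould_def in_depth_def)
qed

text \<open>With vanishing components in depth 0, a nonzero summand has both factors in positive
  depth and hence both below \<open>r\<close>.\<close>

lemma ari_prod_cong:
  assumes "f 0 = 0" "g 0 = 0" "f' 0 = 0" "g' 0 = 0" "\<And>k. k < r \<Longrightarrow> f k = f' k" "\<And>k. k < r \<Longrightarrow> g k = g' k"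
  shows "ari_prod f g r = ari_prod f' g' r"
  unfolding ari_prod_def
proof (intro sum.cong refl)
  fix k assume "k \<in> {..r}"
  then consider "k = 0" | "r - k = 0" | "k < r" "r - k < r" by fastforce
  then show "ari_comp k (r - k) (f k) (g (r - k)) = ari_comp k (r - k) (f' k) (g' (r - k))"
    using assms by cases simp_all
qed

lemma ari_power_cong:
  assumes "f 0 = 0" "f' 0 = 0" "\<And>k. k < r \<Longrightarrow> f k = f' k" "n \<ge> 1 \<and> k \<le> r \<or> k < r"
  shows "(ari_prod f ^^ n) f k = (ari_prod f' ^^ n) f' k"
  using assms(4)
proof (induction n arbitrary: k)
  case (Suc n)
  show ?case
    unfolding funpow.simps comp_def
  proof (rule ari_prod_cong)
    show "(ari_prod f ^^ n) f 0 = 0" "(ari_prod f' ^^ n) f' 0 = 0"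
      using assms by (auto intro: ari_power_eq_0)
  qed (use Suc assms in auto)
qed (use assms in auto)

lemma exp_tail_cong:
  assumes "f 0 = 0" "f' 0 = 0" "\<And>k. k < r \<Longrightarrow> f k = f' k"
  shows "exp_tail f r = exp_tail f' r"
  unfolding exp_tail_def
  by (intro sum.cong refl arg_cong2[of _ _ _ _ "(/)"] ari_power_cong[of f f' r]) (use assms in auto)

text \<open>Once the components below \<open>r\<close> agree, so do the tails in depth
  \<open>r\<close>, and the linear terms have to agree as well.\<close>

lemma exp_ari_inj:
  assumes "exp_ari f = exp_ari f'" "f 0 = 0" "f' 0 = 0"
  shows "f = f'"
proof
  fix r show "f r = f' r"
  proof (induction r rule: less_induct)
    case (less r)
    show ?case
    proof (cases "r = 0")
      case False
      then have "f r + exp_tail f r = f' r + exp_tail f' r"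
        using assms exp_ari_tail[of f r] exp_ari_tail[of f' r] by simp
      then show ?thesis
        using exp_tail_cong[of f f' r] less assms by simp
    qed (use assms in auto)
  qed
qed

text \<open>In depth \<open>r\<close> the exponential is \<open>f\<^sup>(\<^sup>r\<^sup>)\<close> plus terms in the components of lower depth, so the
  equation \<open>exp_ari f = pal\<close> can be solved depth by depth.\<close>

function log_pal :: mould where
  "log_pal r = (if r = 0 then 0 else pal r - exp_tail (\<lambda>k. if k < r then log_pal k else 0) r)"
  by auto
termination by (relation "measure id") auto

declare log_pal.simps [simp del]

lemma log_pal_0 [simp]: "log_pal 0 = 0"
  by (simp add: log_pal.simps)

lemma exp_ari_log_pal: "exp_ari log_pal = pal"
proof
  fix r
  show "exp_ari log_pal r = pal r"
  proof (cases "r = 0")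
    case True
    then show ?thesis
      by (simp add: exp_ari_eq unit_mould_def in_depth_def)
  next
    case False
    have "exp_tail (\<lambda>k. if k < r then log_pal k else 0) r = exp_tail log_pal r"
      by (rule exp_tail_cong) auto
    then show ?thesis
      using False by (simp add: exp_ari_tail log_pal.simps[of r])
  qed
qed

lemma homogeneous_fact: "1 / fact n \<in> homogeneous_ratfuns r 0"
  using homogeneous_of_nat[of "fact n" r] by (intro homogeneous_divide[of _ _ 0 _ 0]) auto

lemma Q_weight_ari_prod:
  assumes "f \<in> \<Q>_weight 0" "g \<in> \<Q>_weight 0"
  shows "ari_prod f g \<in> \<Q>_weight 0"
proof -
  have "ari_comp k (r - k) (f k) (g (r - k)) \<in> homogeneous_ratfuns r (0 - int r)" if "k \<le> r" for k r
  proof -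
    have "f k \<in> homogeneous_ratfuns k (- int k)" "g (r - k) \<in> homogeneous_ratfuns (r - k) (- int (r - k))"
      using assms by (simp_all add: \<Q>_weight_def del: of_nat_diff)
    from ari_comp_homogeneous[OF this] show ?thesis
      using that by simp
  qed
  then show ?thesis
    unfolding \<Q>_weight_def ari_prod_def by auto
qed

lemma exp_tail_homogeneous:
  assumes "f \<in> \<Q>_weight 0"
  shows "exp_tail f r \<in> homogeneous_ratfuns r (- int r)"
proof -
  have "(ari_prod f ^^ n) f \<in> \<Q>_weight 0" for n
    by (induction n) (auto intro: assms Q_weight_ari_prod)
  then have "1 / fact (Suc n) * (ari_prod f ^^ n) f r \<in> homogeneous_ratfuns r (- int r)" for n
    by (intro homogeneous_scale homogeneous_fact) (auto simp: \<Q>_weight_def)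
  then show ?thesis
    unfolding exp_tail_def by (intro homogeneous_sum) simp
qed

lemma log_pal_homogeneous: "log_pal r \<in> homogeneous_ratfuns r (- int r)"
proof (induction r rule: less_induct)
  case (less r)
  then have "(\<lambda>k. if k < r then log_pal k else 0) \<in> \<Q>_weight 0"
    by (auto simp: \<Q>_weight_def)
  then show ?case
    using exp_tail_homogeneous[of "\<lambda>k. if k < r then log_pal k else 0" r] pal_homogeneous[of r]
    by (subst log_pal.simps) auto
qed

lemma log_pal_weight: "log_pal \<in> \<Q>_weight 0"
  using log_pal_homogeneous by (simp add: \<Q>_weight_def)

text \<open>\<open>inv_into\<close> picks some preimage in \<open>\<L>\<close>, so one has to exist
  there: \<open>log_pal\<close> qualifies because weight 0 puts it in \<open>\<Q>\<close>.
  Injectivity then identifies the two.\<close>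

lemma log_ari_pal: "log_ari pal = log_pal"
proof -
  have "log_pal \<in> \<Q>"
    unfolding \<Q>_def using log_pal_weight
    by (intro CollectI exI[of _ "{0}"] exI[of _ "\<lambda>_. log_pal"]) auto
  then have "log_pal \<in> \<L>"
    by (simp add: \<L>_def)
  then have "pal \<in> exp_ari ` \<L>"
    using exp_ari_log_pal by (metis imageI)
  then have e: "exp_ari (log_ari pal) = pal" and "log_ari pal \<in> \<L>"
    unfolding log_ari_def by (rule f_inv_into_f, rule inv_into_into)
  then have z: "log_ari pal 0 = 0"
    unfolding \<L>_def by blast
  show ?thesis
    by (rule exp_ari_inj[of "log_ari pal" log_pal]) (simp_all only: e exp_ari_log_pal z log_pal_0)
qed

text \<open>Since \<open>p 0 = 0\<close>, each bracket with \<open>p\<close> raises the depth by at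
  least one.\<close>

lemma ad_ari_eq_0:
  assumes "\<And>i. i < d \<Longrightarrow> f i = 0" "p 0 = 0" "r < d + n"
  shows "((\<lambda>h. ari_bracket h p) ^^ n) f r = 0"
  using assms(3)
proof (induction n arbitrary: r)
  case (Suc n)
  show ?case
    unfolding funpow.simps comp_def
    by (rule ari_bracket_eq_0[of "d + n" _ 1]) (use Suc assms(2) in auto)
qed (use assms(1) in auto)

lemma Ad_ari_pal_eq:
  assumes "f 0 = 0" "r < N"
  shows "Ad_ari pal f r = (\<Sum>n<N. ((\<lambda>h. ari_bracket h log_pal) ^^ n) f r / fact n)"
  unfolding Ad_ari_def log_ari_pal
  by (subst depth_suminf_eq[where N = N]) (use ad_ari_eq_0[of 1 f log_pal] assms in auto)

section \<open>Finite sets of weights are preserved by both maps\<close>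

definition weight_sums :: "int set \<Rightarrow> nat \<Rightarrow> ratfun set" where
  "weight_sums K r = {\<Sum>k\<in>K. h k | h. \<forall>k\<in>K. h k \<in> homogeneous_ratfuns r (k - int r)}"

lemma weight_sumsI:
  "(\<And>k. k \<in> K \<Longrightarrow> h k \<in> homogeneous_ratfuns r (k - int r)) \<Longrightarrow> (\<Sum>k\<in>K. h k) \<in> weight_sums K r"
  unfolding weight_sums_def by blast

lemma weight_sumsE:
  assumes "q \<in> weight_sums K r"
  obtains h where "q = (\<Sum>k\<in>K. h k)" "\<And>k. k \<in> K \<Longrightarrow> h k \<in> homogeneous_ratfuns r (k - int r)"
  using assms unfolding weight_sums_def by blast

lemma weight_sums_0 [simp]: "0 \<in> weight_sums K r"
  using weight_sumsI[of K "\<lambda>_. 0" r] by simp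

lemma weight_sums_add: "p \<in> weight_sums K r \<Longrightarrow> q \<in> weight_sums K r \<Longrightarrow> p + q \<in> weight_sums K r"
  by (elim weight_sumsE) (auto simp: sum.distrib[symmetric] intro!: weight_sumsI)

lemma weight_sums_diff: "p \<in> weight_sums K r \<Longrightarrow> q \<in> weight_sums K r \<Longrightarrow> p - q \<in> weight_sums K r"
  by (elim weight_sumsE) (auto simp: sum_subtractf[symmetric] intro!: weight_sumsI)

lemma weight_sums_scale:
  "c \<in> homogeneous_ratfuns r 0 \<Longrightarrow> q \<in> weight_sums K r \<Longrightarrow> c * q \<in> weight_sums K r"
  by (elim weight_sumsE) (auto simp: sum_distrib_left intro!: weight_sumsI homogeneous_scale)

lemma weight_sums_sum: "(\<And>x. x \<in> A \<Longrightarrow> f x \<in> weight_sums K r) \<Longrightarrow> sum f A \<in> weight_sums K r"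
  by (induction A rule: infinite_finite_induct) (auto intro: weight_sums_add)

lemma weight_sums_ev:
  assumes "q \<in> weight_sums K (length ts)" "indep ts" "set ts \<subseteq> homogeneous_ratfuns n 1" "length ts = n"
  shows "ev q ts \<in> weight_sums K n"
proof -
  obtain h where h: "q = (\<Sum>k\<in>K. h k)" "\<And>k. k \<in> K \<Longrightarrow> h k \<in> homogeneous_ratfuns n (k - int n)"
    using assms(1,4) by (auto elim: weight_sumsE)
  have "ev q ts = (\<Sum>k\<in>K. ev (h k) ts)"
    unfolding h(1) using h(2) assms by (intro ev_sum) (auto intro: homogeneous_imp_ratfuns)
  then show ?thesis
    using h assms by (auto intro!: weight_sumsI homogeneous_ev)
qed

lemma indep_flex:
  "indep (differences (map xsum (flex_block i r)))" "indep (differences (map xsum (flex_first i r n)))"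
  "indep (differences (map xsum (flex_last i r n)))"
  by (rule indep_differences_xsum[of _ "i + r + n"]; auto)+

lemma ari_comp_add_left:
  assumes "a \<in> ratfuns r" "a' \<in> ratfuns r"
  shows "ari_comp r s (a + a') b = ari_comp r s a b + ari_comp r s a' b"
proof -
  have "ev (a + a') (differences (map xsum (flex_block i r))) =
      ev a (differences (map xsum (flex_block i r))) + ev a' (differences (map xsum (flex_block i r)))" for i
    using assms by (intro ev_add indep_flex) auto
  then show ?thesis
    unfolding ari_comp_flex by (simp only: distrib_right sum.distrib) simp
qed

lemma ari_comp_add_right:
  assumes "b \<in> ratfuns s" "b' \<in> ratfuns s"
  shows "ari_comp r s a (b + b') = ari_comp r s a b + ari_comp r s a b'"
proof -
  have "ev (b + b') (differences (map xsum (flex_first i r (r + s)))) =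
      ev b (differences (map xsum (flex_first i r (r + s)))) + ev b' (differences (map xsum (flex_first i r (r + s))))"
    "ev (b + b') (differences (map xsum (flex_last i r (r + s)))) =
      ev b (differences (map xsum (flex_last i r (r + s)))) + ev b' (differences (map xsum (flex_last i r (r + s))))"
    if "i \<le> s" for i
    using assms flex_props[OF that, of r] by (intro ev_add indep_flex; simp only: length_differences length_map)+
  then show ?thesis
    unfolding ari_comp_flex add_diff_add[symmetric] sum.distrib[symmetric] distrib_left[symmetric]
    by (intro arg_cong2[of _ _ _ _ "(-)"] sum.cong refl arg_cong2[of _ _ _ _ "(*)"]) auto
qed

lemma ihara_comp_add_left:
  assumes "a \<in> ratfuns r" "a' \<in> ratfuns r"
  shows "ihara_comp r s (a + a') b = ihara_comp r s a b + ihara_comp r s a' b"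
proof -
  have "ev (a + a') (flat_args True (flex_block i r)) =
      ev a (flat_args True (flex_block i r)) + ev a' (flat_args True (flex_block i r))"
    "ev (a + a') (flat_args False (rev (flex_block i r))) =
      ev a (flat_args False (rev (flex_block i r))) + ev a' (flat_args False (rev (flex_block i r)))" for i
    using assms by (intro ev_add indep_flat_args; auto)+
  then show ?thesis
    unfolding ihara_comp_flex by (simp only: distrib_right distrib_left sum.distrib) simp
qed

lemma ihara_comp_add_right:
  assumes "b \<in> ratfuns s" "b' \<in> ratfuns s"
  shows "ihara_comp r s a (b + b') = ihara_comp r s a b + ihara_comp r s a b'"
proof -
  have ev: "ev (b + b') (flat_args True (flex_first i r (r + s))) =
      ev b (flat_args True (flex_first i r (r + s))) + ev b' (flat_args True (flex_first i r (r + s)))"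
    "ev (b + b') (flat_args True (flex_last i r (r + s))) =
      ev b (flat_args True (flex_last i r (r + s))) + ev b' (flat_args True (flex_last i r (r + s)))"
    if "i \<le> s" for i
    using assms flex_props[OF that, of r] indep_flat_args
    by (intro ev_add; simp only: length_flat_args)+
  have "(\<Sum>i=0..s. ev a (flat_args True (flex_block i r)) * ev (b + b') (flat_args True (flex_first i r (r + s)))) =
     (\<Sum>i=0..s. ev a (flat_args True (flex_block i r)) * ev b (flat_args True (flex_first i r (r + s)))) +
     (\<Sum>i=0..s. ev a (flat_args True (flex_block i r)) * ev b' (flat_args True (flex_first i r (r + s))))"
    unfolding sum.distrib[symmetric] distrib_left[symmetric]
    by (intro sum.cong refl arg_cong2[of _ _ _ _ "(*)"] ev) auto
  moreover have "(\<Sum>i=1..s. ev a (flat_args False (rev (flex_block i r))) * ev (b + b') (flat_args True (flex_last i r (r + s)))) =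
     (\<Sum>i=1..s. ev a (flat_args False (rev (flex_block i r))) * ev b (flat_args True (flex_last i r (r + s)))) +
     (\<Sum>i=1..s. ev a (flat_args False (rev (flex_block i r))) * ev b' (flat_args True (flex_last i r (r + s))))"
    unfolding sum.distrib[symmetric] distrib_left[symmetric]
    by (intro sum.cong refl arg_cong2[of _ _ _ _ "(*)"] ev) auto
  ultimately show ?thesis
    unfolding ihara_comp_flex by (simp only: distrib_left) simp
qed

text \<open>\<open>T\<close> stands for a product with one argument fixed, which is additive on
  \<open>ratfuns\<close> because \<open>ev\<close> is; it carries a decomposition by weights to the
  image summand by summand.\<close>

lemma additive_weight_sums:
  assumes add: "\<And>a a'. a \<in> ratfuns r \<Longrightarrow> a' \<in> ratfuns r \<Longrightarrow> T (a + a') = T a + T a'"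
    and zero: "T 0 = 0"
    and hom: "\<And>k a. a \<in> homogeneous_ratfuns r (k - int r) \<Longrightarrow> T a \<in> homogeneous_ratfuns n (k - int n)"
    and q: "q \<in> weight_sums K r"
  shows "T q \<in> weight_sums K n"
proof -
  obtain h where h: "q = (\<Sum>k\<in>K. h k)" "\<And>k. k \<in> K \<Longrightarrow> h k \<in> homogeneous_ratfuns r (k - int r)"
    using q by (auto elim: weight_sumsE)
  have "T (\<Sum>k\<in>A. h k) = (\<Sum>k\<in>A. T (h k))" if "A \<subseteq> K" for A
    using that
    by (induction A rule: infinite_finite_induct)
      (auto simp: zero add ratfuns_sum homogeneous_imp_ratfuns[OF h(2)] subset_iff)
  then show ?thesis
    using h hom by (auto intro!: weight_sumsI)
qed

lemma weight_sums_comp: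
  assumes "a \<in> weight_sums K r" "b \<in> homogeneous_ratfuns s (- int s)" "r + s = n"
  shows "ari_comp r s a b \<in> weight_sums K n" "ari_comp s r b a \<in> weight_sums K n"
    "ihara_comp r s a b \<in> weight_sums K n" "ihara_comp s r b a \<in> weight_sums K n"
proof -
  have b: "b \<in> ratfuns s" using assms(2) by (rule homogeneous_imp_ratfuns)
  have e: "k - int r + - int s = k - int n" "- int s + (k - int r) = k - int n" "s + r = n" for k
    using assms(3) by auto
  have "ari_comp r s a b \<in> homogeneous_ratfuns n (k - int n)" if "a \<in> homogeneous_ratfuns r (k - int r)" for a k
    using ari_comp_homogeneous[OF that assms(2)] unfolding e(1) assms(3) .
  then show "ari_comp r s a b \<in> weight_sums K n"
    by (intro additive_weight_sums[of r "\<lambda>a. ari_comp r s a b", OF _ _ _ assms(1)])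
      (auto intro: ari_comp_add_left)
  have "ari_comp s r b a \<in> homogeneous_ratfuns n (k - int n)" if "a \<in> homogeneous_ratfuns r (k - int r)" for a k
    using ari_comp_homogeneous[OF assms(2) that] unfolding e(2) e(3) .
  then show "ari_comp s r b a \<in> weight_sums K n"
    by (intro additive_weight_sums[of r "\<lambda>a. ari_comp s r b a", OF _ _ _ assms(1)])
      (auto intro: ari_comp_add_right)
  have "ihara_comp r s a b \<in> homogeneous_ratfuns n (k - int n)" if "a \<in> homogeneous_ratfuns r (k - int r)" for a k
    using ihara_comp_homogeneous[OF that assms(2)] unfolding e(1) assms(3) .
  then show "ihara_comp r s a b \<in> weight_sums K n"
    by (intro additive_weight_sums[of r "\<lambda>a. ihara_comp r s a b", OF _ _ _ assms(1)])
      (auto intro: ihara_comp_add_left)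
  have "ihara_comp s r b a \<in> homogeneous_ratfuns n (k - int n)" if "a \<in> homogeneous_ratfuns r (k - int r)" for a k
    using ihara_comp_homogeneous[OF assms(2) that] unfolding e(2) e(3) .
  then show "ihara_comp s r b a \<in> weight_sums K n"
    by (intro additive_weight_sums[of r "\<lambda>a. ihara_comp s r b a", OF _ _ _ assms(1)])
      (auto intro: ihara_comp_add_right)
qed

text \<open>One \<open>K\<close> serves all depths, as membership in \<open>\<Q>\<close> demands.
  The decomposition itself stays existential in each depth, so an operator can be treated depth by
  depth.\<close>

definition weight_moulds :: "int set \<Rightarrow> mould set" where
  "weight_moulds K = {f. \<forall>r. f r \<in> weight_sums K r}"

lemma weight_mouldsD: "f \<in> weight_moulds K \<Longrightarrow> f r \<in> weight_sums K r"
  by (simp add: weight_moulds_def)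

lemma weight_moulds_ari_bracket:
  assumes "f \<in> weight_moulds K" "p \<in> \<Q>_weight 0"
  shows "ari_bracket f p \<in> weight_moulds K"
proof -
  have "ari_comp k (r - k) (f k) (p (r - k)) \<in> weight_sums K r"
    "ari_comp k (r - k) (p k) (f (r - k)) \<in> weight_sums K r" if "k \<le> r" for k r
    by (rule weight_sums_comp(1) weight_sums_comp(2);
        use assms that in \<open>simp add: weight_moulds_def \<Q>_weight_def del: of_nat_diff\<close>)+
  then show ?thesis
    unfolding weight_moulds_def ari_bracket_def ari_prod_def
    by (auto intro!: weight_sums_diff weight_sums_sum)
qed

lemma weight_moulds_ihara_bracket:
  assumes "f \<in> weight_moulds K" "p \<in> \<Q>_weight 0"
  shows "ihara_bracket p f \<in> weight_moulds K"
proof -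
  have "ihara_comp k (r - k) (f k) (p (r - k)) \<in> weight_sums K r"
    "ihara_comp k (r - k) (p k) (f (r - k)) \<in> weight_sums K r" if "k \<le> r" for k r
    by (rule weight_sums_comp(3) weight_sums_comp(4);
        use assms that in \<open>simp add: weight_moulds_def \<Q>_weight_def del: of_nat_diff\<close>)+
  then show ?thesis
    unfolding weight_moulds_def ihara_bracket_def ihara_prod_def
    by (auto intro!: weight_sums_diff weight_sums_sum)
qed

lemma weight_moulds_sharp:
  assumes "f \<in> weight_moulds K"
  shows "sharp f \<in> weight_moulds K"
  unfolding weight_moulds_def sharp_def sharp_args_xsum
proof (intro CollectI allI)
  fix r
  have "set (offsets (map xsum [0..<Suc r])) \<subseteq> homogeneous_ratfuns r 1"
    by (rule set_offsets_homogeneous) (auto intro: xsum_homogeneous)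
  moreover have "indep (offsets (map xsum [0..<Suc r]))"
    by (rule indep_offsets_xsum[of _ r]) auto
  ultimately show "ev (f r) (offsets (map xsum [0..<Suc r])) \<in> weight_sums K r"
    using weight_mouldsD[OF assms, of r] by (intro weight_sums_ev) (auto simp del: upt_Suc)
qed

lemma weight_moulds_flat:
  assumes "f \<in> weight_moulds K"
  shows "flat f \<in> weight_moulds K"
  unfolding weight_moulds_def flat_eq_sharp_word
proof (intro CollectI allI)
  fix r
  have "set (sharp_args True [0..<Suc r]) \<subseteq> homogeneous_ratfuns r 1"
    unfolding sharp_args_def by (rule set_differences_homogeneous) (auto intro: svar_homogeneous)
  moreover have "indep (sharp_args True [0..<Suc r])"
    by (rule indep_sharp_args) auto
  ultimately have "ev (f r) (sharp_args True [0..<Suc r]) \<in> weight_sums K r"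
    using weight_mouldsD[OF assms, of r] by (intro weight_sums_ev) (auto simp del: upt_Suc)
  then show "sharp_word True f [0..<Suc r] \<in> weight_sums K r"
    by (simp add: sharp_word_def del: upt_Suc)
qed

lemma weight_moulds_Ad_ari_pal:
  assumes "f \<in> weight_moulds K" "f 0 = 0"
  shows "Ad_ari pal f \<in> weight_moulds K"
  unfolding weight_moulds_def
proof (intro CollectI allI)
  fix r
  have "((\<lambda>h. ari_bracket h log_pal) ^^ n) f \<in> weight_moulds K" for n
    by (induction n) (auto intro: assms weight_moulds_ari_bracket log_pal_weight)
  then have "1 / fact n * ((\<lambda>h. ari_bracket h log_pal) ^^ n) f r \<in> weight_sums K r" for n
    by (intro weight_sums_scale homogeneous_fact) (rule weight_mouldsD)
  moreover have "Ad_ari pal f r = (\<Sum>n<Suc r. ((\<lambda>h. ari_bracket h log_pal) ^^ n) f r / fact n)"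
    by (rule Ad_ari_pal_eq) (simp_all add: assms(2))
  ultimately show "Ad_ari pal f r \<in> weight_sums K r"
    by (auto intro!: weight_sums_sum weight_sums_add simp del: sum.lessThan_Suc)
qed

lemma weight_moulds_chi_E:
  assumes "f \<in> weight_moulds K" "f 0 = 0"
  shows "chi_E f \<in> weight_moulds K"
  unfolding chi_E_def
  by (intro weight_moulds_flat weight_moulds_Ad_ari_pal weight_moulds_sharp assms) (simp add: sharp_def assms)

lemma in_depth_psi_0_weight: "in_depth i (psi_0 i) \<in> \<Q>_weight 0"
  using psi_0_homogeneous[of i] by (auto simp: \<Q>_weight_def in_depth_def)

lemma weight_moulds_in_depth: "h \<in> weight_sums K d \<Longrightarrow> in_depth d h \<in> weight_moulds K"
  by (auto simp: weight_moulds_def in_depth_def)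

lemma chi_B_comp_weight:
  assumes "h \<in> weight_sums K d"
  shows "chi_B_comp d h r \<in> weight_sums K (d + r)"
proof (induction r rule: less_induct)
  case (less r)
  show ?case
  proof (cases r)
    case 0
    then show ?thesis using assms by simp
  next
    case (Suc n)
    have c: "1 / (2 * of_nat (Suc n)) \<in> homogeneous_ratfuns (d + r) 0"
      using homogeneous_of_nat[of "2 * Suc n" "d + r"] by (intro homogeneous_divide[of _ _ 0 _ 0]) auto
    show ?thesis
      unfolding Suc chi_B_comp.simps
      by (rule weight_sums_scale[OF c[unfolded Suc]], intro weight_sums_sum weight_mouldsD
          weight_moulds_ihara_bracket weight_moulds_in_depth in_depth_psi_0_weight less) (use Suc in auto)
  qed
qed

lemma chi_B_eq:
  assumes "r < N"
  shows "chi_B f r = (\<Sum>d<N. chi_B_single d (f d) r)"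
  unfolding chi_B_def by (rule depth_suminf_eq) (use assms in \<open>auto simp: chi_B_single_def\<close>)

lemma weight_moulds_chi_B:
  assumes "f \<in> weight_moulds K"
  shows "chi_B f \<in> weight_moulds K"
  unfolding weight_moulds_def chi_B_eq[OF lessI]
proof (intro CollectI allI weight_sums_sum)
  fix r d :: nat assume "d \<in> {..<Suc r}"
  then show "chi_B_single d (f d) r \<in> weight_sums K r"
    using chi_B_comp_weight[OF weight_mouldsD[OF assms], of d "r - d"] by (simp add: chi_B_single_def)
qed

lemma Q_iff_weight_moulds: "f \<in> \<Q> \<longleftrightarrow> (\<exists>K. finite K \<and> f \<in> weight_moulds K)"
proof
  assume "f \<in> \<Q>"
  then obtain K g where "finite K" "\<forall>k\<in>K. g k \<in> \<Q>_weight k" "f = (\<lambda>r. \<Sum>k\<in>K. g k r)"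
    unfolding \<Q>_def by blast
  then have "finite K \<and> f \<in> weight_moulds K"
    by (auto simp: weight_moulds_def \<Q>_weight_def intro!: weight_sumsI)
  then show "\<exists>K. finite K \<and> f \<in> weight_moulds K" ..
next
  assume "\<exists>K. finite K \<and> f \<in> weight_moulds K"
  then obtain K where K: "finite K" "f \<in> weight_moulds K" by blast
  \<comment> \<open>The summands are chosen for each depth separately; a mould of weight
    \<open>k\<close> carries no condition linking its depths.\<close>
  have "\<forall>r. \<exists>h. f r = (\<Sum>k\<in>K. h k) \<and> (\<forall>k\<in>K. h k \<in> homogeneous_ratfuns r (k - int r))"
    using weight_mouldsD[OF K(2)] by (meson weight_sumsE)
  then obtain h where "\<And>r. f r = (\<Sum>k\<in>K. h r k)"
      "\<And>r k. k \<in> K \<Longrightarrow> h r k \<in> homogeneous_ratfuns r (k - int r)"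
    by metis
  then show "f \<in> \<Q>"
    unfolding \<Q>_def \<Q>_weight_def using K(1)
    by (intro CollectI exI[of _ K] exI[of _ "\<lambda>k r. h r k"]) auto
qed

text \<open>Both maps are built from \<open>sharp\<close>, \<open>flat\<close> and brackets with
  moulds of weight 0, so they keep the weights of \<open>f\<close>.\<close>

lemma chi_difference_in_Q:
  assumes "f \<in> \<Q>" "f 0 = 0"
  shows "(\<lambda>r. chi_E f r - chi_B f r) \<in> \<Q>"
proof -
  obtain K where K: "finite K" "f \<in> weight_moulds K"
    using assms(1) Q_iff_weight_moulds by blast
  then have "chi_E f \<in> weight_moulds K" "chi_B f \<in> weight_moulds K"
    using assms(2) by (auto intro: weight_moulds_chi_E weight_moulds_chi_B)
  then have "(\<lambda>r. chi_E f r - chi_B f r) \<in> weight_moulds K"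
    by (auto simp: weight_moulds_def intro: weight_sums_diff)
  then show ?thesis
    using K(1) Q_iff_weight_moulds by blast
qed

section \<open>Comparison of the two maps\<close>

definition vanishes_below :: "nat \<Rightarrow> ('a list \<Rightarrow> 'b::zero) \<Rightarrow> bool" where
  "vanishes_below k F \<longleftrightarrow> (\<forall>u. length u < k \<longrightarrow> F u = 0)"

definition upto_letters :: "nat \<Rightarrow> ('a list \<Rightarrow> 'b::zero) \<Rightarrow> 'a list \<Rightarrow> 'b" where
  "upto_letters m F u = (if length u \<le> m then F u else 0)"

text \<open>The block and the contracted word have \<open>length w + 1\<close> letters together. A
  lower bound for one of them is an upper bound for the other, and only values in this range
  enter.\<close>

lemma contract_support_cong:
  assumes "vanishes_below k F" "vanishes_below l G"
    and "\<And>u. length u + l \<le> Suc (length w) \<Longrightarrow> F u = F' u"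
    and "\<And>u. length u + k \<le> Suc (length w) \<Longrightarrow> G u = G' u"
    and "vanishes_below k F'" "vanishes_below l G'"
  shows "contract F G w = contract F' G' w"
  unfolding contract_def
proof (intro sum.cong refl)
  fix s assume "s \<in> splits3 w"
  then obtain a b c where s: "s = (a, b, c)" "a @ b @ c = w" "b \<noteq> []"
    by (auto simp: splits3_def)
  have "length a + length b + length c = length w"
    using s(2) by auto
  have *: "F b * G (a @ x # c) = F' b * G' (a @ x # c)" for x
  proof (cases "length b < k \<or> length (a @ x # c) < l")
    case True
    then show ?thesis
      using assms(1,2,5,6) unfolding vanishes_below_def by auto
  next
    case False
    with s have "F b = F' b" "G (a @ x # c) = G' (a @ x # c)"
      by (auto intro!: assms(3,4))
    then show ?thesis by simp
  qed
  show "(case s of (a, b, c) \<Rightarrow> F b * (G (a @ hd b # c) - (if a = [] then 0 else G (a @ last b # c)))) =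
      (case s of (a, b, c) \<Rightarrow> F' b * (G' (a @ hd b # c) - (if a = [] then 0 else G' (a @ last b # c))))"
    unfolding s using *[of "hd b"] *[of "last b"] by (auto simp: right_diff_distrib)
qed

lemma dbracket_support_cong:
  assumes "vanishes_below k F" "vanishes_below l G"
    and "\<And>u. length u + l \<le> Suc (length w) \<Longrightarrow> F u = F' u"
    and "\<And>u. length u + k \<le> Suc (length w) \<Longrightarrow> G u = G' u"
    and "vanishes_below k F'" "vanishes_below l G'"
  shows "dbracket F G w = dbracket F' G' w"
  using contract_support_cong[OF assms] contract_support_cong[OF assms(2,1,4,3,6,5)]
  by (simp add: dbracket_def dcontract_def)

lemma dbracket_zero [simp]: "dbracket (\<lambda>_. 0) G w = 0" "dbracket F (\<lambda>_. 0) w = 0"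
  by (simp_all add: dbracket_def dcontract_def contract_def)

text \<open>The contracted block survives as one letter, hence the loss of one in the bound.\<close>

lemma vanishes_below_dbracket:
  assumes "vanishes_below k F" "vanishes_below l G"
  shows "vanishes_below (k + l - 1) (dbracket F G)"
  unfolding vanishes_below_def
proof (intro allI impI)
  fix u :: "'a list" assume "length u < k + l - 1"
  then have "dbracket F G u = dbracket (\<lambda>_. 0) (\<lambda>_. 0) u"
    by (intro dbracket_support_cong[OF assms]) (use assms in \<open>auto simp: vanishes_below_def\<close>)
  then show "dbracket F G u = 0" by simp
qed

text \<open>\<open>X\<close> starts at \<open>d + 1\<close> letters, and every bracket with the
  \<open>k\<close>-letter part of \<open>p\<close> adds \<open>k - 1\<close>. Words of at most
  \<open>d + 4\<close> letters allow three added letters in total, which leaves the listed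
  terms.\<close>

lemma exp_ad_truncated:
  fixes X p :: "'a list \<Rightarrow> 'b::field_char_0"
  assumes X: "vanishes_below (Suc d) X" and p: "vanishes_below 2 p" and w: "length w \<le> d + 4"
  defines "Y1 \<equiv> dbracket X (letters 2 p)" and "Y2 \<equiv> dbracket X (letters 3 p)"
    and "Y3 \<equiv> dbracket X (letters 4 p)" and "N \<equiv> \<lambda>F. dbracket F p"
  shows "N X w = Y1 w + Y2 w + Y3 w"
    "N (N X) w = dbracket Y1 (letters 2 p) w + (dbracket Y1 (letters 3 p) w + dbracket Y2 (letters 2 p) w)"
    "N (N (N X)) w = dbracket (dbracket Y1 (letters 2 p)) (letters 2 p) w"
proof -
  have up: "upto_letters 4 p = (\<lambda>u. letters 2 p u + (letters 3 p u + letters 4 p u))"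
    "upto_letters 3 p = (\<lambda>u. letters 2 p u + letters 3 p u)"
    "upto_letters 2 p = letters 2 p" "upto_letters 1 p = (\<lambda>_. 0)"
    using p by (auto simp: fun_eq_iff upto_letters_def letters_def vanishes_below_def)
  have vup: "vanishes_below 2 (upto_letters m p)" "vanishes_below m (letters m p)" for m
    using p by (auto simp: vanishes_below_def upto_letters_def letters_def)
  \<comment> \<open>If \<open>F\<close> needs \<open>k\<close> letters, \<open>p\<close> is
    evaluated on at most \<open>d + 5 - k\<close> letters, and \<open>m\<close> is at least
    that.\<close>
  have trunc: "N F w = dbracket F (upto_letters m p) w"
    if "vanishes_below k F" "d + 5 \<le> k + m" "length w \<le> d + 4" for F k m w
    unfolding N_def
    by (rule dbracket_support_cong[OF that(1) p _ _ that(1) vup(1)])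
      (use that in \<open>auto simp: upto_letters_def\<close>)
  have cong: "N F w = N F' w"
    if "\<And>u. length u \<le> d + 4 \<Longrightarrow> F u = F' u" "length w \<le> d + 4" for F F' w
    unfolding N_def
    by (rule dbracket_support_cong[of 0 _ 2]) (use that p in \<open>auto simp: vanishes_below_def\<close>)
  have Y: "vanishes_below (d + 2) Y1" "vanishes_below (d + 3) Y2" "vanishes_below (d + 4) Y3"
    using vanishes_below_dbracket[OF X vup(2), of 2] vanishes_below_dbracket[OF X vup(2), of 3]
      vanishes_below_dbracket[OF X vup(2), of 4]
    by (simp_all add: Y1_def Y2_def Y3_def eval_nat_numeral)
  have N1: "N X w = Y1 w + (Y2 w + Y3 w)" if "length w \<le> d + 4" for w
    using trunc[OF X, of 4 w] that by (simp add: up dbracket_add_right Y1_def Y2_def Y3_def)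
  show "N X w = Y1 w + Y2 w + Y3 w"
    using N1[OF w] by simp
  define Z2 where "Z2 = dbracket Y1 (letters 2 p)"
  define Z3 where "Z3 = (\<lambda>u. dbracket Y1 (letters 3 p) u + dbracket Y2 (letters 2 p) u)"
  have N2: "N (N X) w = Z2 w + Z3 w" if w: "length w \<le> d + 4" for w
  proof -
    have "N (N X) w = N (\<lambda>u. Y1 u + (Y2 u + Y3 u)) w"
      by (rule cong[OF N1 w])
    also have "\<dots> = N Y1 w + (N Y2 w + N Y3 w)"
      by (simp add: N_def dbracket_add_left)
    also have "N Y1 w = dbracket Y1 (letters 2 p) w + dbracket Y1 (letters 3 p) w"
      using trunc[OF Y(1), of 3 w] w by (simp add: up dbracket_add_right)
    also have "N Y2 w = dbracket Y2 (letters 2 p) w"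
      using trunc[OF Y(2), of 2 w] w by (simp add: up)
    also have "N Y3 w = 0"
      using trunc[OF Y(3), of 1 w] w by (simp add: up[simplified])
    finally show ?thesis
      by (simp add: Z2_def Z3_def)
  qed
  show "N (N X) w = dbracket Y1 (letters 2 p) w + (dbracket Y1 (letters 3 p) w + dbracket Y2 (letters 2 p) w)"
    using N2[OF w] by (simp add: Z2_def Z3_def)
  have Z: "vanishes_below (d + 3) Z2" "vanishes_below (d + 4) Z3"
    using vanishes_below_dbracket[OF Y(1) vup(2), of 2] vanishes_below_dbracket[OF Y(1) vup(2), of 3]
      vanishes_below_dbracket[OF Y(2) vup(2), of 2]
    by (simp_all add: Z2_def Z3_def vanishes_below_def)
  have "N (N (N X)) w = N (\<lambda>u. Z2 u + Z3 u) w"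
    by (rule cong[OF N2 w])
  also have "\<dots> = N Z2 w + N Z3 w"
    by (simp add: N_def dbracket_add_left)
  also have "N Z2 w = dbracket Z2 (letters 2 p) w"
    using trunc[OF Z(1), of 2 w] w by (simp add: up)
  also have "N Z3 w = 0"
    using trunc[OF Z(2), of 1 w] w by (simp add: up[simplified])
  finally show "N (N (N X)) w = dbracket (dbracket Y1 (letters 2 p)) (letters 2 p) w"
    by (simp add: Z2_def)
qed

text \<open>The Jacobi identity turns the term \<open>{{a, b}, X}\<close> coming from \<open>p4\<close> into the difference between
  the symmetric coefficients of \<open>{a, {b, X}}\<close> and \<open>{b, {a, X}}\<close> in the exponential and the unequal
  ones in the recursion.\<close>

lemma exp_ad_eq_recursion:
  fixes X p a b c :: "'a list \<Rightarrow> 'b::field_char_0"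
  assumes X: "vanishes_below (Suc d) X" and p: "vanishes_below 2 p" and w: "length w \<le> d + 4"
    and p2: "letters 2 p = (\<lambda>u. - 1/2 * a u)"
    and p3: "letters 3 p = (\<lambda>u. - 1/4 * b u)"
    and p4: "letters 4 p = (\<lambda>u. - 1/6 * c u + 1/48 * dbracket a b u)"
    and C1: "C1 = (\<lambda>u. 1/2 * dbracket a X u)"
    and C2: "C2 = (\<lambda>u. 1/4 * (dbracket a C1 u + dbracket b X u))"
    and C3: "C3 = (\<lambda>u. 1/6 * (dbracket a C2 u + (dbracket b C1 u + dbracket c X u)))"
  defines "N \<equiv> \<lambda>F. dbracket F p"
  shows "X w + N X w + N (N X) w / 2 + N (N (N X)) w / 6 = X w + C1 w + C2 w + C3 w"
proof -
  \<comment> \<open>Exchanging the arguments of the bracket turns the negative coefficients of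
    \<open>p\<close> into positive ones.\<close>
  have m2: "dbracket F (letters 2 p) = (\<lambda>u. 1/2 * dbracket a F u)" for F
    unfolding p2 by (rule ext) (simp only: dbracket_scale_right dbracket_swap[of F], simp)
  have m3: "dbracket F (letters 3 p) = (\<lambda>u. 1/4 * dbracket b F u)" for F
    unfolding p3 by (rule ext) (simp only: dbracket_scale_right dbracket_swap[of F], simp)
  have m4: "dbracket X (letters 4 p) =
      (\<lambda>u. 1/6 * dbracket c X u - 1/48 * (dbracket a (dbracket b X) u - dbracket b (dbracket a X) u))"
    unfolding p4 dbracket_jacobi
    by (rule ext) (simp only: dbracket_add_right dbracket_scale_right dbracket_swap[of X], simp)
  note E = exp_ad_truncated[OF X p w, unfolded m2 m3 m4 dbracket_scale_right]
  show ?thesis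
    unfolding N_def E C3 C2 C1 dbracket_scale_right dbracket_add_right
    by (simp add: field_simps)
qed

text \<open>Brown's map regrouped by the added depth \<open>j\<close> instead of the depth of the
  source, so that the recursion becomes one between whole moulds.\<close>

definition chi_B_layer :: "mould \<Rightarrow> nat \<Rightarrow> mould" where
  "chi_B_layer f j n = (if j \<le> n then chi_B_comp (n - j) (f (n - j)) j else 0)"

lemma chi_B_layers:
  assumes "r < N"
  shows "chi_B f r = (\<Sum>j<N. chi_B_layer f j r)"
proof -
  have "chi_B f r = (\<Sum>d<Suc r. chi_B_single d (f d) r)"
    by (rule chi_B_eq) simp
  also have "\<dots> = (\<Sum>j<Suc r. chi_B_layer f j r)"
    by (rule sum.reindex_bij_witness[of _ "\<lambda>j. r - j" "\<lambda>j. r - j"])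
      (auto simp: chi_B_layer_def chi_B_single_def)
  also have "\<dots> = (\<Sum>j<N. chi_B_layer f j r)"
    using assms by (intro sum.mono_neutral_left) (auto simp: chi_B_layer_def)
  finally show ?thesis .
qed

lemma in_depth_same: "in_depth i a i = a"
  by (simp add: in_depth_def)

lemma ihara_prod_in_depth:
  "ihara_prod (in_depth i a) g n = (if i \<le> n then ihara_comp i (n - i) a (g (n - i)) else 0)"
  "ihara_prod g (in_depth i a) n = (if i \<le> n then ihara_comp (n - i) i (g (n - i)) a else 0)"
proof -
  have "ihara_prod (in_depth i a) g n =
      (\<Sum>r\<le>n. if r = i then ihara_comp i (n - i) a (g (n - i)) else 0)"
    unfolding ihara_prod_def by (intro sum.cong refl) (auto simp: in_depth_def)
  then show "ihara_prod (in_depth i a) g n = (if i \<le> n then ihara_comp i (n - i) a (g (n - i)) else 0)"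
    by simp
  have "ihara_prod g (in_depth i a) n =
      (\<Sum>r\<le>n. if r = n - i then (if i \<le> n then ihara_comp (n - i) i (g (n - i)) a else 0) else 0)"
    unfolding ihara_prod_def by (intro sum.cong refl) (auto simp: in_depth_def)
  then show "ihara_prod g (in_depth i a) n = (if i \<le> n then ihara_comp (n - i) i (g (n - i)) a else 0)"
    by simp
qed

text \<open>A bracket with a mould concentrated in depth \<open>i\<close> shifts the depth by
  exactly \<open>i\<close>, so the source components of \<open>f\<close> run through their
  recursions without mixing.\<close>

lemma chi_B_layer_Suc:
  "chi_B_layer f (Suc j) = (\<lambda>n. 1 / (2 * of_nat (Suc j)) *
     (\<Sum>i=1..Suc j. ihara_bracket (in_depth i (psi_0 i)) (chi_B_layer f (Suc j - i)) n))"
proof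
  fix n
  show "chi_B_layer f (Suc j) n = 1 / (2 * of_nat (Suc j)) *
     (\<Sum>i=1..Suc j. ihara_bracket (in_depth i (psi_0 i)) (chi_B_layer f (Suc j - i)) n)"
  proof (cases "Suc j \<le> n")
    case True
    have "ihara_bracket (in_depth i (psi_0 i)) (in_depth (n - Suc j + (Suc j - i))
        (chi_B_comp (n - Suc j) (f (n - Suc j)) (Suc j - i))) (n - Suc j + Suc j) =
      ihara_bracket (in_depth i (psi_0 i)) (chi_B_layer f (Suc j - i)) n" if "i \<in> {1..Suc j}" for i
    proof -
      have "n - Suc j + Suc j = n" "n - Suc j + (Suc j - i) = n - i" "n - i - (Suc j - i) = n - Suc j"
        "i \<le> n" "Suc j - i \<le> n - i"
        using that True by auto
      then show ?thesis
        by (simp add: ihara_bracket_def ihara_prod_in_depth chi_B_layer_def in_depth_same)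
    qed
    then show ?thesis
      using True by (simp add: chi_B_layer_def del: of_nat_Suc sum.cl_ivl_Suc)
  next
    case False
    then have "ihara_bracket (in_depth i (psi_0 i)) (chi_B_layer f (Suc j - i)) n = 0" if "i \<in> {1..Suc j}" for i
      using that by (auto simp: ihara_bracket_def ihara_prod_in_depth chi_B_layer_def)
    then show ?thesis
      using False by (simp add: chi_B_layer_def del: of_nat_Suc sum.cl_ivl_Suc)
  qed
qed

lemma flat_word_scaled_sum:
  assumes "\<And>i. i \<in> A \<Longrightarrow> g i \<in> ratmoulds" "\<And>r. c \<in> ratfuns r"
  shows "flat_word \<beta> (\<lambda>n. c * (\<Sum>i\<in>A. g i n)) w = ev c (flat_args \<beta> w) * (\<Sum>i\<in>A. flat_word \<beta> (g i) w)"
proof (cases "distinct w")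
  case True
  note ind = indep_flat_args[OF True] length_flat_args
  have g: "g i (length w - 1) \<in> ratfuns (length w - 1)" if "i \<in> A" for i
    using assms(1)[OF that] by (rule ratmouldsD)
  have "ev (c * (\<Sum>i\<in>A. g i (length w - 1))) (flat_args \<beta> w) =
      ev c (flat_args \<beta> w) * ev (\<Sum>i\<in>A. g i (length w - 1)) (flat_args \<beta> w)"
    by (intro ev_mult[OF ind] assms(2) ratfuns_sum g)
  also have "ev (\<Sum>i\<in>A. g i (length w - 1)) (flat_args \<beta> w) =
      (\<Sum>i\<in>A. ev (g i (length w - 1)) (flat_args \<beta> w))"
    by (intro ev_sum[OF ind] g)
  finally show ?thesis
    using True by (simp only: flat_word_def if_True)
qed (simp add: flat_word_def)

text \<open>One induction for both assertions: the word formula for layer \<open>j\<close> needs the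
  invariance of the earlier layers, and the formula for both signs gives the invariance of layer
  \<open>j\<close>.\<close>

lemma chi_B_layer_words:
  assumes f: "f \<in> ratmoulds" "f 0 = 0" "mantar_invariant f"
  defines "C \<equiv> \<lambda>\<beta> j. flat_word \<beta> (chi_B_layer f j)"
    and "q \<equiv> \<lambda>\<beta> i. letters (Suc i) (flat_word \<beta> psi_0)"
  assumes "j \<le> 3"
  shows "chi_B_layer f j \<in> ratmoulds \<and> chi_B_layer f j 0 = 0 \<and> mantar_invariant (chi_B_layer f j) \<and>
    (j > 0 \<longrightarrow> (\<forall>\<beta>. C \<beta> j = (\<lambda>w. 1 / (2 * of_nat j) * (\<Sum>i=1..j. dbracket (q \<beta> i) (C \<beta> (j - i)) w))))"
  using assms(6)
proof (induction j rule: less_induct)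
  case (less j)
  show ?case
  proof (cases j)
    case 0
    have "chi_B_layer f 0 = f" by (simp add: fun_eq_iff chi_B_layer_def)
    then show ?thesis using 0 f by simp
  next
    case (Suc n)
    have psi: "in_depth i (psi_0 i) \<in> ratmoulds" "in_depth i (psi_0 i) 0 = 0" for i
      using in_depth_psi_0_weight[of i] homogeneous_imp_ratfuns
      by (auto simp: \<Q>_weight_def ratmoulds_def) (simp add: in_depth_def psi_0_0)
    have neutral: "mantar_invariant (in_depth i (psi_0 i))" if "i \<in> {1..j}" for i
      using that less.prems by (intro mantar_invariant_psi_0) auto
    have IH: "chi_B_layer f (j - i) \<in> ratmoulds" "chi_B_layer f (j - i) 0 = 0"
        "mantar_invariant (chi_B_layer f (j - i))" if "i \<in> {1..j}" for i
      using less.IH[of "j - i"] less.prems that by auto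
    let ?g = "\<lambda>i. ihara_bracket (in_depth i (psi_0 i)) (chi_B_layer f (j - i))"
    have g: "?g i \<in> ratmoulds" if "i \<in> {1..j}" for i
      using ihara_bracket_ratmoulds[OF psi(1) IH(1)[OF that]] .
    have c: "1 / (2 * of_nat j) \<in> ratfuns r" for r
      by (intro ratfuns_divide ratfuns_mult) auto
    have layer: "chi_B_layer f j = (\<lambda>n. 1 / (2 * of_nat j) * (\<Sum>i=1..j. ?g i n))"
      unfolding Suc by (rule chi_B_layer_Suc)
    have words: "C \<beta> j = (\<lambda>w. 1 / (2 * of_nat j) * (\<Sum>i=1..j. dbracket (q \<beta> i) (C \<beta> (j - i)) w))" for \<beta>
    proof
      fix w :: "nat list"
      have br: "flat_word \<beta> (?g i) = dbracket (q \<beta> i) (C \<beta> (j - i))" if "i \<in> {1..j}" for i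
        using flat_word_ihara_bracket[OF psi(1) IH(1) psi(2) IH(2) neutral IH(3), OF that that that that, of \<beta>]
          flat_word_in_depth[of i \<beta> psi_0] that
        by (simp add: q_def C_def)
      have "C \<beta> j w = ev (1 / (2 * of_nat j)) (flat_args \<beta> w) * (\<Sum>i=1..j. flat_word \<beta> (?g i) w)"
        unfolding C_def layer by (rule flat_word_scaled_sum[OF g c])
      also have "(\<Sum>i=1..j. flat_word \<beta> (?g i) w) = (\<Sum>i=1..j. dbracket (q \<beta> i) (C \<beta> (j - i)) w)"
        using br by (intro sum.cong refl) simp
      finally have *: "C \<beta> j w = ev (1 / (2 * of_nat j)) (flat_args \<beta> w) *
          (\<Sum>i=1..j. dbracket (q \<beta> i) (C \<beta> (j - i)) w)" .
      show "C \<beta> j w = 1 / (2 * of_nat j) * (\<Sum>i=1..j. dbracket (q \<beta> i) (C \<beta> (j - i)) w)"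
      proof (cases "distinct w")
        case True
        note ind = indep_flat_args[OF True] length_flat_args
        have "ev (1 / (2 * of_nat j)) (flat_args \<beta> w) = 1 / (2 * of_nat j)"
          using ev_of_nat[OF ind, where n = "2 * j"]
          by (subst ev_divide[OF ind]) (auto simp: ratfuns_mult)
        then show ?thesis using * by simp
      next
        case False
        then show ?thesis
          by (simp add: C_def flat_word_def dbracket_def dcontract_def)
      qed
    qed
    have "mantar_invariant (chi_B_layer f j)"
      unfolding mantar_invariant_def
    proof (intro allI)
      fix \<beta> and w :: "nat list"
      have "dbracket (q (\<not> \<beta>) i) (C (\<not> \<beta>) (j - i)) (rev w) =
          (- 1) ^ length w * dbracket (q \<beta> i) (C \<beta> (j - i)) w" if "i \<in> {1..j}" for i
        using neutral[OF that] IH(3)[OF that] flat_word_in_depth[of i _ psi_0] that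
        by (intro dbracket_rev) (auto simp: mantar_invariant_def q_def C_def)
      then have "(\<Sum>i=1..j. dbracket (q (\<not> \<beta>) i) (C (\<not> \<beta>) (j - i)) (rev w)) =
          (- 1) ^ length w * (\<Sum>i=1..j. dbracket (q \<beta> i) (C \<beta> (j - i)) w)"
        unfolding sum_distrib_left by (intro sum.cong refl) simp
      then have "C (\<not> \<beta>) j (rev w) = (- 1) ^ length w * C \<beta> j w"
        unfolding words by simp
      then show "flat_word (\<not> \<beta>) (chi_B_layer f j) (rev w) =
          (- 1) ^ length w * flat_word \<beta> (chi_B_layer f j) w"
        unfolding C_def .
    qed
    moreover have "chi_B_layer f j \<in> ratmoulds"
      unfolding layer ratmoulds_def by (intro CollectI allI ratfuns_mult c ratfuns_sum ratmouldsD g)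
    moreover have "chi_B_layer f j 0 = 0"
      by (simp add: chi_B_layer_def Suc)
    ultimately show ?thesis
      using words by blast
  qed
qed

lemma chi_E_words:
  assumes f: "f \<in> ratmoulds" "\<And>i. i < d \<Longrightarrow> f i = 0" "1 \<le> d" and r: "r \<le> d + 3"
  defines "N \<equiv> \<lambda>F. dbracket F (sharp_word True log_pal)" and "X \<equiv> flat_word True f" and "w \<equiv> [0..<Suc r]"
  shows "chi_E f r = X w + N X w + N (N X) w / 2 + N (N (N X)) w / 6"
proof -
  let ?g = "\<lambda>n. ((\<lambda>h. ari_bracket h log_pal) ^^ n) (sharp f)"
  have sf: "sharp f i = 0" if "i < d" for i
    using f(2)[OF that] by (simp add: sharp_def)
  have l: "log_pal \<in> ratmoulds"
    using log_pal_homogeneous homogeneous_imp_ratfuns by (auto simp: ratmoulds_def)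
  have g: "?g n \<in> ratmoulds \<and> ?g n 0 = 0 \<and> sharp_word True (?g n) = (N ^^ n) X" for n
  proof (induction n)
    case 0
    then show ?case
      using f sf by (simp add: sharp_ratmoulds sharp_word_sharp X_def)
  next
    case (Suc n)
    then have "sharp_word True (?g (Suc n)) = (N ^^ Suc n) X"
      using sharp_word_ari_bracket[of "?g n" log_pal True] l by (simp add: N_def)
    moreover have "?g (Suc n) 0 = 0"
      using ad_ari_eq_0[of 1 "sharp f" log_pal 0 "Suc n"] sf f(3) by simp
    ultimately show ?case
      using Suc ari_bracket_ratmoulds[OF _ l] by simp
  qed
  \<comment> \<open>\<open>max\<close> keeps four terms even when \<open>r < 3\<close>. Beyond them
    the \<open>n\<close>-th term starts in depth \<open>d + n\<close>, above
    \<open>r\<close>.\<close>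
  have "Ad_ari pal (sharp f) r = (\<Sum>n<max 4 (Suc r). ?g n r / fact n)"
    using sf f(3) by (intro Ad_ari_pal_eq) auto
  also have "\<dots> = (\<Sum>n<4. ?g n r / fact n)"
    using ad_ari_eq_0[of d "sharp f" log_pal r] sf r by (intro sum.mono_neutral_right) auto
  finally have "chi_E f r = ev (\<Sum>n<4. ?g n r / fact n) (sharp_args True w)"
    by (simp add: chi_E_def flat_eq_sharp_word sharp_word_def w_def del: upt_Suc)
  also have "\<dots> = (\<Sum>n<4. ev (?g n r / fact n) (sharp_args True w))"
    using g ratfuns_of_nat[of "fact _" r]
    by (intro ev_sum[of _ r] indep_sharp_args) (auto simp: w_def dest: ratmouldsD intro!: ratfuns_divide simp del: upt_Suc)
  also have "\<dots> = (\<Sum>n<4. sharp_word True (?g n) w / fact n)"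
  proof (intro sum.cong refl)
    fix n
    have ind: "indep (sharp_args True w)" "length (sharp_args True w) = r"
      by (auto simp: w_def intro: indep_sharp_args simp del: upt_Suc)
    have "fact n \<in> ratfuns r" "ev (fact n) (sharp_args True w) = fact n"
      using ratfuns_of_nat[of "fact n" r] ev_of_nat[OF ind, of "fact n"] by simp_all
    moreover have "?g n r \<in> ratfuns r"
      using g ratmouldsD by blast
    moreover have "sharp_word True (?g n) w = ev (?g n r) (sharp_args True w)"
      by (simp add: sharp_word_def w_def del: upt_Suc)
    ultimately show "ev (?g n r / fact n) (sharp_args True w) = sharp_word True (?g n) w / fact n"
      by (simp only: ev_divide[OF ind])
  qed
  also have "\<dots> = X w + N X w + N (N X) w / 2 + N (N (N X)) w / 6"
    using g by (simp add: eval_nat_numeral)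
  finally show ?thesis .
qed

text \<open>A word of \<open>r + 2\<close> letters has depth \<open>r + 1 > 0\<close>, so the unit
  mould contributes nothing.\<close>

lemma sharp_word_exp_ari:
  assumes p: "p \<in> ratmoulds" "p 0 = 0" and w: "distinct w" "length w = Suc (Suc r)"
  defines "F \<equiv> sharp_word True p"
  shows "sharp_word True (exp_ari p) w = (\<Sum>n<Suc (Suc r). (dcontract F ^^ n) F w / fact (Suc n))"
proof -
  have g: "(ari_prod p ^^ n) p \<in> ratmoulds \<and> (ari_prod p ^^ n) p 0 = 0 \<and>
      sharp_word True ((ari_prod p ^^ n) p) = (dcontract F ^^ n) F" for n
  proof (induction n)
    case (Suc n)
    then show ?case
      using p ari_power_eq_0[of p 0 "Suc n"] sharp_word_ari_prod[OF p(1), of "(ari_prod p ^^ n) p" True]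
        ari_prod_ratmoulds[OF p(1), of "(ari_prod p ^^ n) p"]
      by (simp add: F_def)
  qed (use p in \<open>simp add: F_def\<close>)
  have ind: "indep (sharp_args True w)" "length (sharp_args True w) = Suc r"
    using w by (auto intro: indep_sharp_args)
  have fact: "fact (Suc n) \<in> ratfuns (Suc r)" "ev (fact (Suc n)) (sharp_args True w) = fact (Suc n)" for n
    using ratfuns_of_nat[of "fact (Suc n)" "Suc r"] ev_of_nat[OF ind, of "fact (Suc n)"] by (simp_all del: fact_Suc)
  have mem: "(ari_prod p ^^ n) p (Suc r) \<in> ratfuns (Suc r)" for n
    using g ratmouldsD by blast
  have "sharp_word True (exp_ari p) w =
      ev (\<Sum>n<Suc (Suc r). (ari_prod p ^^ n) p (Suc r) / fact (Suc n)) (sharp_args True w)"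
    using w exp_ari_eq[of p "Suc r", OF p(2)]
    by (simp add: sharp_word_def unit_mould_def in_depth_def del: sum.lessThan_Suc fact_Suc)
  also have "\<dots> = (\<Sum>n<Suc (Suc r). ev ((ari_prod p ^^ n) p (Suc r) / fact (Suc n)) (sharp_args True w))"
    by (intro ev_sum[OF ind] ratfuns_divide mem fact)
  also have "\<dots> = (\<Sum>n<Suc (Suc r). (dcontract F ^^ n) F w / fact (Suc n))"
  proof (intro sum.cong refl)
    fix n
    have "(dcontract F ^^ n) F w = sharp_word True ((ari_prod p ^^ n) p) w"
      using g[of n] by simp
    also have "\<dots> = ev ((ari_prod p ^^ n) p (Suc r)) (sharp_args True w)"
      using w by (simp add: sharp_word_def)
    finally show "ev ((ari_prod p ^^ n) p (Suc r) / fact (Suc n)) (sharp_args True w) =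
        (dcontract F ^^ n) F w / fact (Suc n)"
      by (simp only: ev_divide[OF ind mem fact(1)] fact(2))
  qed
  finally show ?thesis .
qed

lemma chi_eq_low_depth:
  assumes f: "f \<in> ls_Q" and d: "\<And>i. i < d \<Longrightarrow> f i = 0" "1 \<le> d" and r: "r \<le> d + 3"
  shows "chi_E f r = chi_B f r"
proof -
  define p where "p = sharp_word True log_pal"
  define q where "q = flat_word True psi_0"
  define X where "X = flat_word True f"
  define C where "C j = flat_word True (chi_B_layer f j)" for j
  have fm: "f \<in> ratmoulds" "f 0 = 0" "mantar_invariant f"
    using f Q_ratmoulds ls_Q_mantar_invariant by (auto simp: ls_Q_def)
  have l: "log_pal \<in> ratmoulds"
    using log_pal_homogeneous homogeneous_imp_ratfuns by (auto simp: ratmoulds_def)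
  have p1: "p u = 0" if "length u < 2" for u
    using that by (auto simp: p_def sharp_word_def)
  have e: "sharp_word True pal w = (\<Sum>n<Suc (Suc k). (dcontract p ^^ n) p w / fact (Suc n))"
    if "distinct w" "length w = Suc (Suc k)" for w k
    using sharp_word_exp_ari[OF l log_pal_0 that] unfolding exp_ari_log_pal p_def .
  \<comment> \<open>Each further factor \<open>p\<close> needs one more letter, so on words of at
    most four letters the exponential has at most three terms.\<close>
  have dc: "vanishes_below (Suc (Suc n)) ((dcontract p ^^ n) p)" for n
  proof (induction n)
    case 0
    then show ?case using p1 by (simp add: vanishes_below_def)
  next
    case (Suc n)
    have "contract p ((dcontract p ^^ n) p) u = 0" if "length u < Suc (Suc (Suc n))" for u
    proof -
      have "contract p ((dcontract p ^^ n) p) u = contract (\<lambda>_. 0) ((dcontract p ^^ n) p) u"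
        by (rule contract_support_cong[of 2 _ "Suc (Suc n)"])
          (use Suc that p1 in \<open>auto simp: vanishes_below_def\<close>)
      then show ?thesis by (simp add: contract_def)
    qed
    then show ?case
      by (auto simp: vanishes_below_def dcontract_def[of p "(dcontract p ^^ n) p"])
  qed
  have dc0: "(dcontract p ^^ n) p w = 0" if "length w < Suc (Suc n)" for n w
    using dc that by (simp add: vanishes_below_def)
  have e2: "p w = sharp_word True pal w" if "distinct w" "length w = 2" for w
    using e[of w 0] that dc0[of w 1] by (simp add: numeral_2_eq_2)
  have e3: "p w + 1/2 * dcontract p p w = sharp_word True pal w" if "distinct w" "length w = 3" for w
    using e[of w 1] that dc0[of w 2] by (simp add: eval_nat_numeral)
  have e4: "p w + 1/2 * dcontract p p w + 1/6 * dcontract p (dcontract p p) w = sharp_word True pal w"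
    if "distinct w" "length w = 4" for w
    using e[of w 2] that dc0[of w 3] by (simp add: eval_nat_numeral)
  have px: "p [x] = 0" for x
    by (rule p1) simp
  have p0: "p w = 0" if "\<not> distinct w" for w
    using that by (simp add: p_def sharp_word_def)
  have pw: "letters 2 p = (\<lambda>w. - 1/2 * letters 2 q w)"
    "letters 3 p = (\<lambda>w. - 1/4 * letters 3 q w)"
    "letters 4 p = (\<lambda>w. - 1/6 * letters 4 q w + 1/48 * dbracket (letters 2 q) (letters 3 q) w)"
    unfolding q_def
    by (rule letters_log_pal; (rule px | erule p0 | erule (1) e2 | erule (1) e3 | erule (1) e4))+
  have layer: "C j = (\<lambda>w. 1 / (2 * of_nat j) * (\<Sum>i=1..j. dbracket (letters (Suc i) q) (C (j - i)) w))"
    if "1 \<le> j" "j \<le> 3" for j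
    using chi_B_layer_words[OF fm that(2)] that(1) unfolding C_def q_def by auto
  have C0: "C 0 = X"
  proof -
    have "chi_B_layer f 0 = f" by (simp add: fun_eq_iff chi_B_layer_def)
    then show ?thesis by (simp add: C_def X_def)
  qed
  have C1: "C 1 = (\<lambda>u. 1/2 * dbracket (letters 2 q) X u)"
    using layer[of 1] C0 by (simp add: numeral_2_eq_2)
  have C2: "C 2 = (\<lambda>u. 1/4 * (dbracket (letters 2 q) (C 1) u + dbracket (letters 3 q) X u))"
    using layer[of 2] C0 by (simp add: eval_nat_numeral)
  have C3: "C 3 = (\<lambda>u. 1/6 * (dbracket (letters 2 q) (C 2) u +
      (dbracket (letters 3 q) (C 1) u + dbracket (letters 4 q) X u)))"
    using layer[of 3] C0 by (simp add: eval_nat_numeral add.assoc)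
  let ?w = "[0..<Suc r]"
  have X: "vanishes_below (Suc d) X"
    using d by (auto simp: X_def flat_word_def vanishes_below_def)
  have p: "vanishes_below 2 p"
    using p1 by (simp add: vanishes_below_def)
  have "chi_E f r = X ?w + dbracket X p ?w + dbracket (dbracket X p) p ?w / 2 +
      dbracket (dbracket (dbracket X p) p) p ?w / 6"
    unfolding X_def p_def by (rule chi_E_words[OF fm(1) d r])
  also have "\<dots> = X ?w + C 1 ?w + C 2 ?w + C 3 ?w"
    using r by (intro exp_ad_eq_recursion[OF X p _ pw C1 C2 C3]) simp
  also have "\<dots> = (\<Sum>j<4. chi_B_layer f j r)"
  proof -
    have "C j ?w = chi_B_layer f j r" if "j \<le> 3" for j
      unfolding C_def using chi_B_layer_words[OF fm that] by (intro flat_word_upt) blast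
    then show ?thesis
      unfolding C0[symmetric] by (simp add: eval_nat_numeral del: upt_Suc)
  qed
  \<comment> \<open>Layer \<open>j \<ge> 4\<close> at depth \<open>r\<close> starts from
    \<open>f\<close> in depth \<open>r - j < d\<close>, which is zero.\<close>
  also have "\<dots> = (\<Sum>j<max 4 (Suc r). chi_B_layer f j r)"
  proof (intro sum.mono_neutral_left ballI)
    fix j assume "j \<in> {..<max 4 (Suc r)} - {..<4}"
    then have "r - j < d \<and> j \<le> r" using r d by auto
    have zero: "chi_B_comp k 0 j = 0" for k j
    proof (induction j rule: less_induct)
      case (less j)
      have "ihara_bracket g (in_depth m 0) n = 0" for g m n
        by (simp add: ihara_bracket_def ihara_prod_def in_depth_def)
      with less show ?case
        by (cases j) (auto intro!: sum.neutral simp del: sum.cl_ivl_Suc)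
    qed
    show "chi_B_layer f j r = 0"
      using \<open>r - j < d \<and> j \<le> r\<close> d(1) by (simp add: chi_B_layer_def zero)
  qed auto
  also have "\<dots> = chi_B f r"
    by (rule chi_B_layers[symmetric]) simp
  finally show ?thesis .
qed

theorem theorem1p3:
  fixes f :: mould and d :: nat
  assumes "f \<in> ls_Q"
    and "f \<noteq> (\<lambda>_. 0)"
    and "d = (LEAST r. f r \<noteq> 0)"
  shows "(\<lambda>r. chi_E f r - chi_B f r) \<in> \<Q>_depth (d + 4) \<and>
         (\<forall>r \<le> d + 3. chi_E f r = chi_B f r)"
proof -
  have Q: "f \<in> \<Q>" "f 0 = 0"
    using assms(1) by (auto simp: ls_Q_def)
  have below: "f i = 0" if "i < d" for i
    using not_less_Least[of i "\<lambda>r. f r \<noteq> 0"] that assms(3) by auto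
  obtain r where "f r \<noteq> 0"
    using assms(2) by (auto simp: fun_eq_iff)
  then have "f d \<noteq> 0"
    unfolding assms(3) by (rule LeastI)
  then have "1 \<le> d"
    using Q(2) by (cases d) auto
  then have eq: "chi_E f r = chi_B f r" if "r \<le> d + 3" for r
    using chi_eq_low_depth[OF assms(1) below _ that] by blast
  moreover have "(\<lambda>r. chi_E f r - chi_B f r) \<in> \<Q>"
    by (rule chi_difference_in_Q[OF Q])
  ultimately show ?thesis
    by (auto simp: \<Q>_depth_def)
qed

end
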